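(* For every positive integer $d$, $$w_d=\frac12\,w(\mathcal{O}_{z^1}\mathcal{O}_{z^0})_{0,d},$$ where $w_d$ is the $d$-th expansion coefficient of the inverse function of $-\log(j(\tau))$ and $w(\mathcal{O}_{z^1}\mathcal{O}_{z^0})_{0,d}$ is the intersection number on $\widetilde{Mp}_{0,2}(\mathbb{P}(1,1,1,3),d)$ defined in the context.
   Context: **The numbers $w_d$.** Let $j(\tau)=q^{-1}+744+196884q+\cdots$, $q=e^{2\pi\sqrt{-1}\tau}$, be the elliptic modular $j$-invariant. Inverting this expansion gives $$2\pi\sqrt{-1}\,\tau=-\log(j)+\sum_{d=1}^\infty w_d\,j^{-d}=-\log(j)+744j^{-1}+473652j^{-2}+\cdots,$$ which defines $w_d$. **The moduli space.** Let $d\ge 1$. Use coordinates $(\mathbf{a}_0,\dots,\mathbf{a}_d,a_{3,0},\dots,a_{3,3d},u_1,\dots,u_{d-1})$ on $\mathbb{C}^{3(d+1)+(3d+1)+(d-1)}$, where $\mathbf{a}_j=(a_{0,j},a_{1,j},a_{2,j})\in\mathbb{C}^3$ and $a_{3,j},u_k\in\mathbb{C}$. Let $U$ be the open subset of points satisfying all of: $(\mathbf{a}_0,a_{3,0},a_{3,1})\neq 0$; $(\mathbf{a}_i,a_{3,3i-1},a_{3,3i},a_{3,3i+1},u_i)\ne 0$ for each $1\le i\le d-1$; $(\mathbf{a}_d,a_{3,3d-1},a_{3,3d})\ne 0$. The torus $(\mathbb{C}^* )^{d+1}\ni(\lambda_0,\dots,\lambda_d)$ acts on $U$ by $\mathbf{a}_j\mapsto\lambda_j\mathbf{a}_j$,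 $a_{3,3j}\mapsto\lambda_j^3a_{3,3j}$ ($0\le j\le d$); $a_{3,3j+1}\mapsto\lambda_j^2\lambda_{j+1}a_{3,3j+1}$, $a_{3,3j+2}\mapsto\lambda_j\lambda_{j+1}^2a_{3,3j+2}$ ($0\le j\le d-1$); $u_k\mapsto\lambda_{k-1}^{-1}\lambda_k^2\lambda_{k+1}^{-1}u_k$ ($1\le k\le d-1$). Then $\widetilde{Mp}_{0,2}(\mathbb{P}(1,1,1,3),d):=U/(\mathbb{C}^* )^{d+1}$, a compact toric orbifold of dimension $6d+2$. Its Chow ring $A^*$ (complex coefficients) is generated by $H_0,\dots,H_d$, where $H_j$ is the class of the divisor $\{a_{0,j}=0\}$. **Integration.** $\int_{\widetilde{Mp}_{0,2}(\mathbb{P}(1,1,1,3),d)}$ is the degree map on the Chow ring (zero outside degree $6d+2$), normalized by $\int \mathrm{Vol}_d=1$, where $$\mathrm{Vol}_d=3^{d+1}\prod_{i=0}^dH_i^3\prod_{i=0}^{d-1}(2H_i+H_{i+1})(H_i+2H_{i+1})\prod_{k=1}^{d-1}(-H_{k-1}+2H_k-H_{k+1})$$ (the class of a smooth point). **The intersection number.** With $e^6(x,y):=\prod_{j=0}^6((6-j)x+jy)$, $$w(\mathcal{O}_{z^a}\mathcal{O}_{z^b})_{0,d}:=\int_{\widetilde{Mp}_{0,2}(\mathbb{P}(1,1,1,3),d)}H_0^aH_d^b\cdot\frac{\prod_{i=1}^de^6(H_{i-1},H_i)}{\prod_{i=1}^{d-1}6H_i},$$ where the fraction is the polynomial obtained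 by cancelling in $\mathbb{C}[H_0,\dots,H_d]$ (each $e^6(x,y)$ is divisible by $xy$). Empty products equal $1$. *)

theory Defs
  imports
    "HOL-Complex_Analysis.Complex_Analysis"
    "HOL-Library.Poly_Mapping"
    "HOL-Algebra.QuotRing"
begin

section \<open>The numbers $w_d$\<close>

definition divisor_sum :: "nat \<Rightarrow> nat \<Rightarrow> nat" where
  "divisor_sum k n = (\<Sum>e | e dvd n. e ^ k)"

definition nome :: "complex \<Rightarrow> complex" where
  "nome \<tau> = exp (2 * of_real pi * \<i> * \<tau>)"

definition eisenstein4 :: "complex \<Rightarrow> complex" where
  "eisenstein4 \<tau> = 1 + 240 * suminf (\<lambda>n. of_nat (divisor_sum 3 (Suc n)) * nome \<tau> ^ Suc n)"

definition eisenstein6 :: "complex \<Rightarrow> complex" where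
  "eisenstein6 \<tau> = 1 - 504 * suminf (\<lambda>n. of_nat (divisor_sum 5 (Suc n)) * nome \<tau> ^ Suc n)"

text \<open>
  This is $1728\, g_2^3 / (g_2^3 - 27 g_3^2)$ with $g_2$, $g_3$ replaced by the
  normalised Eisenstein series.  Only arguments in the upper half plane are meaningful.
\<close>
definition modular_j :: "complex \<Rightarrow> complex" where
  "modular_j \<tau> = 1728 * eisenstein4 \<tau> ^ 3 / (eisenstein4 \<tau> ^ 3 - eisenstein6 \<tau> ^ 2)"

text \<open>
  The expansion $q^{-1} + 744 + 196884 q + \dots$ of $j$ as a function of $q$.  The branch of
  the logarithm is irrelevant, as \<^const>\<open>modular_j\<close> has period 1.
\<close>
definition j_expansion :: "complex fls" where
  "j_expansion = laurent_expansion (\<lambda>q. modular_j (Ln q / (2 * of_real pi * \<i>))) 0"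

text \<open>The expansion $q = X + 744 X^2 + \dots$ of $q$ in powers of $X = 1/j$.\<close>
definition q_in_inverse_j :: "complex fps" where
  "q_in_inverse_j = fps_inv (fls_regpart (inverse j_expansion))"

text \<open>
  $2\pi i \tau + \log j = \log (q/X)$, expanded in powers of $X = 1/j$; \<open>fps_ln 1\<close> is
  $\log(1+X)$.
\<close>
definition w_series :: "complex fps" where
  "w_series = fps_compose (fps_ln 1) (fps_shift 1 q_in_inverse_j - 1)"

definition w_coeff :: "nat \<Rightarrow> complex" where
  "w_coeff d = fps_nth w_series d"


section \<open>The moduli space\<close>

text \<open>
  \<open>Ac i j\<close> is $a_{i,j}$, for $i = 0,1,2$ and for $i = 3$ (with $j \le d$ and $j \le 3d$,
  respectively); \<open>Uc k\<close> is $u_k$.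
\<close>
datatype coord = Ac nat nat | Uc nat

definition coords :: "nat \<Rightarrow> coord set" where
  "coords d = {Ac i j | i j. i < 3 \<and> j \<le> d} \<union> {Ac 3 n | n. n \<le> 3 * d} \<union>
     {Uc k | k. 1 \<le> k \<and> k < d}"

definition semistable :: "nat \<Rightarrow> (coord \<Rightarrow> complex) set" where
  "semistable d = {x.
     (\<forall>c. c \<notin> coords d \<longrightarrow> x c = 0) \<and>
     (\<exists>c \<in> {Ac 0 0, Ac 1 0, Ac 2 0, Ac 3 0, Ac 3 1}. x c \<noteq> 0) \<and>
     (\<forall>i \<in> {1..<d}. \<exists>c \<in> {Ac 0 i, Ac 1 i, Ac 2 i,
        Ac 3 (3 * i - 1), Ac 3 (3 * i), Ac 3 (3 * i + 1), Uc i}. x c \<noteq> 0) \<and>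
     (\<exists>c \<in> {Ac 0 d, Ac 1 d, Ac 2 d, Ac 3 (3 * d - 1), Ac 3 (3 * d)}. x c \<noteq> 0)}"

definition torus :: "nat \<Rightarrow> (nat \<Rightarrow> complex) set" where
  "torus d = {l. \<forall>j \<le> d. l j \<noteq> 0}"

text \<open>
  For $i = 3$ and $n = 3j + r$ with $r < 3$, the factor is
  $\lambda_j^{3-r} \lambda_{j+1}^{r}$.
\<close>
fun weight_factor :: "(nat \<Rightarrow> complex) \<Rightarrow> coord \<Rightarrow> complex" where
  "weight_factor l (Ac i n) =
     (if i < 3 then l n else l (n div 3) ^ (3 - n mod 3) * l (n div 3 + 1) ^ (n mod 3))"
| "weight_factor l (Uc k) = l k ^ 2 / (l (k - 1) * l (k + 1))"

definition torus_act :: "(nat \<Rightarrow> complex) \<Rightarrow> (coord \<Rightarrow> complex) \<Rightarrow> coord \<Rightarrow> complex" where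
  "torus_act l x = (\<lambda>c. weight_factor l c * x c)"

definition orbit_of :: "nat \<Rightarrow> (coord \<Rightarrow> complex) \<Rightarrow> (coord \<Rightarrow> complex) set" where
  "orbit_of d x = {torus_act l x | l. l \<in> torus d}"

definition moduli_space :: "nat \<Rightarrow> (coord \<Rightarrow> complex) set set" where
  "moduli_space d = orbit_of d ` semistable d"

definition coord_divisor :: "nat \<Rightarrow> coord \<Rightarrow> (coord \<Rightarrow> complex) set set" where
  "coord_divisor d c = orbit_of d ` {x \<in> semistable d. x c = 0}"


section \<open>The Chow ring\<close>

text \<open>
  The Chow ring with complex coefficients of a compact toric orbifold, in the presentation of
  Jurkiewicz and Danilov: it is generated by the classes of the torus-invariant prime divisors,
  here the divisors $\{c = 0\}$ for the coordinates $c$.  The linear relations are given by the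
  divisors of the characters of the dense torus, that is, of the Laurent monomials in the
  coordinates that descend to the quotient.  The remaining (Stanley--Reisner) relations say that
  a product of distinct coordinate divisors with empty intersection vanishes.
\<close>

type_synonym divisor_poly = "(coord \<Rightarrow>\<^sub>0 nat) \<Rightarrow>\<^sub>0 complex"

definition scalar :: "complex \<Rightarrow> divisor_poly" where
  "scalar z = Poly_Mapping.single 0 z"

definition divisor_var :: "coord \<Rightarrow> divisor_poly" where
  "divisor_var c = Poly_Mapping.single (Poly_Mapping.single c 1) 1"

definition divisor_ring :: "nat \<Rightarrow> divisor_poly ring" where
  "divisor_ring d =
     \<lparr>carrier = {p. \<forall>m \<in> Poly_Mapping.keys p. Poly_Mapping.keys m \<subseteq> coords d},
      mult = (*), one = 1, zero = 0, add = (+)\<rparr>"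

definition invariant_exponents :: "nat \<Rightarrow> (coord \<Rightarrow> int) set" where
  "invariant_exponents d = {m. \<forall>l \<in> torus d. \<forall>x. (\<forall>c \<in> coords d. x c \<noteq> 0) \<longrightarrow>
     (\<Prod>c \<in> coords d. torus_act l x c powi m c) = (\<Prod>c \<in> coords d. x c powi m c)}"

definition linear_relations :: "nat \<Rightarrow> divisor_poly set" where
  "linear_relations d =
     {\<Sum>c \<in> coords d. of_int (m c) * divisor_var c | m. m \<in> invariant_exponents d}"

definition stanley_reisner_relations :: "nat \<Rightarrow> divisor_poly set" where
  "stanley_reisner_relations d =
     {\<Prod>c \<in> S. divisor_var c | S.
        S \<subseteq> coords d \<and> moduli_space d \<inter> (\<Inter>c \<in> S. coord_divisor d c) = {}}"

definition chow_ideal :: "nat \<Rightarrow> divisor_poly set" where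
  "chow_ideal d = Idl\<^bsub>divisor_ring d\<^esub> (linear_relations d \<union> stanley_reisner_relations d)"

definition chow_ring :: "nat \<Rightarrow> divisor_poly set ring" where
  "chow_ring d = divisor_ring d Quot chow_ideal d"

definition chow_class :: "nat \<Rightarrow> divisor_poly \<Rightarrow> divisor_poly set" where
  "chow_class d p = chow_ideal d +>\<^bsub>divisor_ring d\<^esub> p"

definition homogeneous_poly :: "nat \<Rightarrow> divisor_poly \<Rightarrow> bool" where
  "homogeneous_poly n p \<longleftrightarrow>
     (\<forall>m \<in> Poly_Mapping.keys p. (\<Sum>c \<in> Poly_Mapping.keys m. Poly_Mapping.lookup m c) = n)"

text \<open>A polynomial in the \<open>H j\<close> stands for its class, taken by \<^const>\<open>chow_class\<close>.\<close>
definition H :: "nat \<Rightarrow> divisor_poly" where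
  "H j = divisor_var (Ac 0 j)"


section \<open>Integration and the intersection number\<close>

definition Vol :: "nat \<Rightarrow> divisor_poly" where
  "Vol d = 3 ^ (d + 1) * (\<Prod>i = 0..d. H i ^ 3) *
     (\<Prod>i = 0..<d. (2 * H i + H (i + 1)) * (H i + 2 * H (i + 1))) *
     (\<Prod>k = 1..<d. - H (k - 1) + 2 * H k - H (k + 1))"

definition is_degree_map :: "nat \<Rightarrow> (divisor_poly set \<Rightarrow> complex) \<Rightarrow> bool" where
  "is_degree_map d I \<longleftrightarrow>
     I \<in> extensional (carrier (chow_ring d)) \<and>
     (\<forall>X \<in> carrier (chow_ring d). \<forall>Y \<in> carrier (chow_ring d).
        I (X \<oplus>\<^bsub>chow_ring d\<^esub> Y) = I X + I Y) \<and>
     (\<forall>z. \<forall>X \<in> carrier (chow_ring d).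
        I (chow_class d (scalar z) \<otimes>\<^bsub>chow_ring d\<^esub> X) = z * I X) \<and>
     (\<forall>n. \<forall>p \<in> carrier (divisor_ring d).
        homogeneous_poly n p \<and> n \<noteq> 6 * d + 2 \<longrightarrow> I (chow_class d p) = 0) \<and>
     I (chow_class d (Vol d)) = 1"

definition chow_integral :: "nat \<Rightarrow> divisor_poly set \<Rightarrow> complex" where
  "chow_integral d = (THE I. is_degree_map d I)"

definition e6 :: "divisor_poly \<Rightarrow> divisor_poly \<Rightarrow> divisor_poly" where
  "e6 x y = (\<Prod>j = 0..6. of_nat (6 - j) * x + of_nat j * y)"

text \<open>
  The quotient of the two products, by cancellation in the polynomial ring
  (where the denominator is not a zero divisor).
\<close>
definition e6_quotient :: "nat \<Rightarrow> divisor_poly" where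
  "e6_quotient d = (THE f. f * (\<Prod>i = 1..<d. 6 * H i) = (\<Prod>i = 1..d. e6 (H (i - 1)) (H i)))"

text \<open>\<open>w_corr d a b\<close> is $w(\mathcal{O}_{z^a} \mathcal{O}_{z^b})_{0,d}$.\<close>
definition w_corr :: "nat \<Rightarrow> nat \<Rightarrow> nat \<Rightarrow> complex" where
  "w_corr d a b = chow_integral d (chow_class d (H 0 ^ a * H d ^ b * e6_quotient d))"

end

theory Submission
  imports Defs
begin

text \<open>
  Let $f_n(\epsilon) = \prod_{j=1}^n F(\epsilon+j-1,\epsilon+j)/(\epsilon+j)^3$ with
  $F(x,y) = 24(x+y)(5x+y)(x+5y)$.  Both $w_d$ and half the intersection number satisfy
  $\sum_{k=0}^{d-1} f_k(0)\,w_{d-k} = f_d'(0)$ for $d \ge 1$, so they agree.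

  For $w_d$, elementary convolution identities for divisor sums yield Ramanujan's formulas for the
  derivatives of $E_2$, $E_4$, $E_6$.  They show that $E_4^{1/2}$ and $E_4^{1/2}\log q$, as functions
  of $z = 1/j$, solve the hypergeometric equation with solutions $\sum_n f_n(0) z^n$ and
  $\log z\sum_n f_n(0) z^n + \sum_n f_n'(0) z^n$; the recursion compares the coefficients.

  For the intersection number, the Stanley--Reisner relations are the products $R_0,\dots,R_d$ over the
  $d+1$ groups of coordinates in the definition of $U$, so the degree map is the residue of
  $p/(R_0\cdots R_d)$ over a torus $|H_i| = r_i$.  Up to the factor 2, the residue in question is that of
  $H_0 \prod F(H_{i-1},H_i) / (\prod H_i^3 \prod (2H_i-H_{i-1}-H_{i+1}))$.  Enlarging the contour of the
  last variable gives $-f_1(0)$ times the residue for $d-1$, from infinity, and a residue at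
  $H_d = 2H_{d-1}-H_{d-2}$.
  Repeating this with $H_{d-1}, H_{d-2}, \dots$, where the variables already treated continue an
  arithmetic progression, produces the recursion.
\<close>

section \<open>Convolutions of divisor sums\<close>

text \<open>The numbers f_n(0) and f_n'(0) enter both sides for one reason. Divided by its common
  difference z - x, the progression x, z, 2z - x, ... reads e, e + 1, e + 2, ... with e = x / (z -
  x); since F(x, y) / y^3 is homogeneous of degree 0, the product over k steps is f_k(e). The point
  z = infinity is e = 0: a residue there sees f_k(0) or, with one more power of z, f_k'(0) times
  de/dw = x, where w = 1/z.

  On the modular side, E4^(1/2) is 3F2(1/6, 1/2, 5/6; 1, 1; 1728/j), and 24 (2n + 1)(6n + 1)(6n + 5)
  in its recursion is F(n, n + 1).

  The degree map is a definite description, so uniqueness has to be proved along with existence. It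
  comes from the fan: crossing walls shows that a functional killing \<open>Vol d\<close> kills
  every maximal cone, and repeated factors of a monomial can be moved away until a cone is reached.

  The factor 2 is 6 / 3: the end factor 6 H_0 that survives in the cancelled quotient, against the
  one additional 3 in \<open>Vol d\<close>.\<close>

definition quads :: "nat \<Rightarrow> (nat \<times> nat \<times> nat \<times> nat) set" where
  "quads n = {(a, b, x, y). a \<ge> 1 \<and> b \<ge> 1 \<and> x \<ge> 1 \<and> y \<ge> 1 \<and> a * x + b * y = n}"

definition quad_sum :: "nat \<Rightarrow> (nat \<Rightarrow> nat \<Rightarrow> nat \<Rightarrow> nat \<Rightarrow> bool) \<Rightarrow> (int \<Rightarrow> int \<Rightarrow> 'a) \<Rightarrow> 'a :: ab_group_add" where
  "quad_sum n P g = (\<Sum>(a, b, x, y) \<in> {(a, b, x, y) \<in> quads n. P a b x y}. g (int a) (int b))"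

lemma finite_quads: "finite (quads n)"
proof (rule finite_subset)
  show "quads n \<subseteq> {..n} \<times> {..n} \<times> {..n} \<times> {..n}"
  proof (clarify, goal_cases)
    case (1 a b x y)
    then have h: "a \<ge> 1" "b \<ge> 1" "x \<ge> 1" "y \<ge> 1" "a * x + b * y = n"
      by (auto simp: quads_def)
    have "a * 1 \<le> a * x" "1 * x \<le> a * x" "b * 1 \<le> b * y" "1 * y \<le> b * y"
      using h by (intro mult_le_mono; simp)+
    then have "a \<le> n \<and> b \<le> n \<and> x \<le> n \<and> y \<le> n"
      unfolding mult_1_left mult_1_right h(5)[symmetric] by linarith
    then show ?case by simp
  qed
qed auto

lemma quad_sum_add: "quad_sum n P (\<lambda>a b. g a b + h a b) = quad_sum n P g + quad_sum n P h"
  by (simp add: quad_sum_def case_prod_unfold sum.distrib)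

lemma quad_sum_diff: "quad_sum n P (\<lambda>a b. g a b - h a b) = quad_sum n P g - quad_sum n P h"
  by (simp add: quad_sum_def case_prod_unfold sum_subtractf)

lemma quad_sum_split:
  assumes "\<And>a b x y. P a b x y \<longleftrightarrow> Q a b x y \<or> R a b x y"
    and "\<And>a b x y. \<not> (Q a b x y \<and> R a b x y)"
  shows "quad_sum n P g = quad_sum n Q g + quad_sum n R g"
proof -
  have "{(a, b, x, y) \<in> quads n. P a b x y} =
        {(a, b, x, y) \<in> quads n. Q a b x y} \<union> {(a, b, x, y) \<in> quads n. R a b x y}"
    using assms(1) by auto
  moreover have "{(a, b, x, y) \<in> quads n. Q a b x y} \<inter> {(a, b, x, y) \<in> quads n. R a b x y} = {}"
    using assms(2) by auto
  moreover have "finite {(a, b, x, y) \<in> quads n. S a b x y}" for S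
    by (rule finite_subset[OF _ finite_quads[of n]]) auto
  ultimately show ?thesis
    unfolding quad_sum_def by (metis (no_types, lifting) sum.union_disjoint)
qed

lemma quad_sum_swap: "quad_sum n P g = quad_sum n (\<lambda>a b x y. P b a y x) (\<lambda>a b. g b a)"
  unfolding quad_sum_def
  by (rule sum.reindex_bij_witness[where i = "\<lambda>(a, b, x, y). (b, a, y, x)" and j = "\<lambda>(a, b, x, y). (b, a, y, x)"])
     (auto simp: quads_def add.commute)

text \<open>The substitution $ax + by = a(x-y) + (a+b)y$.\<close>
lemma quad_sum_shift:
  "quad_sum n (\<lambda>a b x y. y < x) (\<lambda>a b. g a (a + b)) = quad_sum n (\<lambda>a b x y. a < b) g"
  unfolding quad_sum_def
  by (rule sum.reindex_bij_witness[where
        j = "\<lambda>(a, b, x, y). (a, a + b, x - y, y)" and i = "\<lambda>(a, b, x, y). (a, b - a, x + y, y)"])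
     (auto simp: quads_def algebra_simps intro!: le_add_diff_inverse trans_le_add1)

lemma quad_sum_cong:
  assumes "\<And>a b x y. P a b x y \<longleftrightarrow> Q a b x y" "\<And>a b x y. P a b x y \<Longrightarrow> g (int a) (int b) = h (int a) (int b)"
  shows "quad_sum n P g = quad_sum n Q h"
  unfolding quad_sum_def using assms by (intro sum.cong) auto

text \<open>Liouville's method. Splitting the range by comparing a with b, or x with y, and applying
  \<open>quad_sum_shift\<close> turns the six sums into half-range sums that cancel in pairs; only
  the diagonals a = b and x = y survive. Evenness enters in \<open>e3\<close>, where the shift
  produces f (a - b) (- b).\<close>

lemma liouville_identity:
  fixes f :: "int \<Rightarrow> int \<Rightarrow> 'a :: ab_group_add"
  assumes even: "\<And>a b. f (- a) (- b) = f a b"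
  shows "quad_sum n (\<lambda>_ _ _ _. True)
           (\<lambda>a b. f a b - f a (- b) + f a (a - b) - f a (a + b) + f (b - a) b - f (a + b) b) =
         quad_sum n (\<lambda>a b x y. a = b) (\<lambda>a b. f a a + f 0 a + f a 0) -
         quad_sum n (\<lambda>a b x y. x = y) (\<lambda>a b. f a (- b) + f a (a + b) + f (a + b) b)"
proof -
  define T :: "(int \<Rightarrow> int \<Rightarrow> 'a) \<Rightarrow> 'a" where "T = quad_sum n (\<lambda>_ _ _ _. True)"
  define Tal where "Tal = (quad_sum n (\<lambda>a b x y. a < b) :: (int \<Rightarrow> int \<Rightarrow> 'a) \<Rightarrow> 'a)"
  define Tag where "Tag = (quad_sum n (\<lambda>a b x y. b < a) :: (int \<Rightarrow> int \<Rightarrow> 'a) \<Rightarrow> 'a)"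
  define Tae where "Tae = (quad_sum n (\<lambda>a b x y. a = b) :: (int \<Rightarrow> int \<Rightarrow> 'a) \<Rightarrow> 'a)"
  define Txl where "Txl = (quad_sum n (\<lambda>a b x y. x < y) :: (int \<Rightarrow> int \<Rightarrow> 'a) \<Rightarrow> 'a)"
  define Txg where "Txg = (quad_sum n (\<lambda>a b x y. y < x) :: (int \<Rightarrow> int \<Rightarrow> 'a) \<Rightarrow> 'a)"
  define Txe where "Txe = (quad_sum n (\<lambda>a b x y. x = y) :: (int \<Rightarrow> int \<Rightarrow> 'a) \<Rightarrow> 'a)"
  note defs = T_def Tal_def Tag_def Tae_def Txl_def Txg_def Txe_def
  have splita: "T g = Tal g + Tag g + Tae g" for g
  proof -
    have "T g = Tal g + quad_sum n (\<lambda>a b x y. b \<le> a) g"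
      unfolding defs by (rule quad_sum_split) auto
    also have "quad_sum n (\<lambda>a b x y. b \<le> a) g = Tag g + Tae g"
      unfolding defs by (rule quad_sum_split) auto
    finally show ?thesis by (simp add: add.assoc)
  qed
  have splitx: "T g = Txl g + Txg g + Txe g" for g
  proof -
    have "T g = Txl g + quad_sum n (\<lambda>a b x y. y \<le> x) g"
      unfolding defs by (rule quad_sum_split) auto
    also have "quad_sum n (\<lambda>a b x y. y \<le> x) g = Txg g + Txe g"
      unfolding defs by (rule quad_sum_split) auto
    finally show ?thesis by (simp add: add.assoc)
  qed
  have shift: "Txg (\<lambda>a b. g a (a + b)) = Tal g" for g
    unfolding defs by (rule quad_sum_shift)
  have swapx: "Txl g = Txg (\<lambda>a b. g b a)" and swapa: "Tag g = Tal (\<lambda>a b. g b a)" for g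
    unfolding defs by (rule quad_sum_swap)+
  have e1: "T (\<lambda>a b. f a (a + b)) = Tal f + Tal (\<lambda>a b. f (b - a) b) + Txe (\<lambda>a b. f a (a + b))"
  proof -
    have "Txl (\<lambda>a b. f a (a + b)) = Txg (\<lambda>a b. (\<lambda>a b. f (b - a) b) a (a + b))"
      by (subst swapx) (simp add: add.commute)
    also have "\<dots> = Tal (\<lambda>a b. f (b - a) b)" by (rule shift)
    finally show ?thesis by (simp add: splitx shift algebra_simps)
  qed
  have e2: "T (\<lambda>a b. f (a + b) b) = Tag f + Tag (\<lambda>a b. f a (a - b)) + Txe (\<lambda>a b. f (a + b) b)"
  proof -
    have "Txg (\<lambda>a b. f (a + b) b) = Txg (\<lambda>a b. (\<lambda>a b. f b (b - a)) a (a + b))" by simp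
    also have "\<dots> = Tag (\<lambda>a b. f a (a - b))" by (subst shift) (simp add: swapa)
    finally have 1: "Txg (\<lambda>a b. f (a + b) b) = Tag (\<lambda>a b. f a (a - b))" .
    have "Txl (\<lambda>a b. f (a + b) b) = Txg (\<lambda>a b. (\<lambda>a b. f b a) a (a + b))"
      by (subst swapx) (simp add: add.commute)
    also have "\<dots> = Tag f" by (subst shift) (simp add: swapa)
    finally show ?thesis using 1 by (simp add: splitx algebra_simps)
  qed
  have e3: "Tag (\<lambda>a b. f (b - a) b) = Txl (\<lambda>a b. f a (- b))"
  proof -
    have "Txl (\<lambda>a b. f a (- b)) = Txg (\<lambda>a b. (\<lambda>a b. f (b - a) (- a)) a (a + b))"
      by (subst swapx) simp
    also have "\<dots> = Tag (\<lambda>a b. f (a - b) (- b))" by (subst shift) (simp add: swapa)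
    also have "(\<lambda>a b. f (a - b) (- b)) = (\<lambda>a b. f (b - a) b)"
      using even by (metis minus_diff_eq)
    finally show ?thesis by simp
  qed
  have e4: "Tal (\<lambda>a b. f a (a - b)) = Txg (\<lambda>a b. f a (- b))"
    by (subst shift[symmetric]) simp
  have e5: "Tae (\<lambda>a b. f a b) = Tae (\<lambda>a b. f a a)" "Tae (\<lambda>a b. f (b - a) b) = Tae (\<lambda>a b. f 0 a)"
     "Tae (\<lambda>a b. f a (a - b)) = Tae (\<lambda>a b. f a 0)"
    unfolding defs by (rule quad_sum_cong; simp)+
  show ?thesis
    unfolding defs[symmetric]
    unfolding quad_sum_add quad_sum_diff T_def Tae_def Txe_def
    unfolding defs[symmetric] e1 e2
    unfolding splita[of "\<lambda>a b. f a b"] splita[of "\<lambda>a b. f (b - a) b"] splita[of "\<lambda>a b. f a (a - b)"]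
      splitx[of "\<lambda>a b. f a (- b)"] e3 e4 e5
    by (simp add: algebra_simps)
qed

text \<open>If a = b = e, then e (x + y) = n, so e divides n and x takes n/e - 1 values.\<close>

lemma quad_sum_diag_left:
  fixes h :: "int \<Rightarrow> 'a :: comm_ring_1"
  assumes "n > 0"
  shows "quad_sum n (\<lambda>a b x y. a = b) (\<lambda>a b. h a) = (\<Sum>e | e dvd n. (of_nat (n div e) - 1) * h (int e))"
proof -
  have "quad_sum n (\<lambda>a b x y. a = b) (\<lambda>a b. h a) =
        (\<Sum>(e, x) \<in> Sigma {e. e dvd n} (\<lambda>e. {1..<n div e}). h (int e))"
    unfolding quad_sum_def
    by (rule sum.reindex_bij_witness[where j = "\<lambda>(a, b, x, y). (a, x)" and i = "\<lambda>(e, x). (e, e, x, n div e - x)"])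
       (use assms in \<open>auto simp: quads_def dvd_def Suc_le_eq simp flip: add_mult_distrib2\<close>)
  also have "\<dots> = (\<Sum>e | e dvd n. \<Sum>x\<in>{1..<n div e}. h (int e))"
    by (rule sum.Sigma[symmetric]) (use assms in auto)
  also have "\<dots> = (\<Sum>e | e dvd n. (of_nat (n div e) - 1) * h (int e))"
    using assms by (intro sum.cong) (auto simp: Suc_le_eq div_greater_zero_iff dvd_imp_le)
  finally show ?thesis .
qed

text \<open>If x = y, then (a + b) x = n: the divisor is e = a + b, and a < e remains free.\<close>

lemma quad_sum_diag_right:
  assumes "n > 0"
  shows "quad_sum n (\<lambda>a b x y. x = y) h = (\<Sum>e | e dvd n. \<Sum>a\<in>{1..<e}. h (int a) (int e - int a))"
proof -
  have "quad_sum n (\<lambda>a b x y. x = y) h =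
        (\<Sum>(e, a) \<in> Sigma {e. e dvd n} (\<lambda>e. {1..<e}). h (int a) (int e - int a))"
    unfolding quad_sum_def
    by (rule sum.reindex_bij_witness[where j = "\<lambda>(a, b, x, y). (a + b, a)" and i = "\<lambda>(e, a). (a, e - a, n div e, n div e)"])
       (use assms in \<open>auto simp: quads_def dvd_def simp flip: add_mult_distrib\<close>)
  also have "\<dots> = (\<Sum>e | e dvd n. \<Sum>a\<in>{1..<e}. h (int a) (int e - int a))"
    by (rule sum.Sigma[symmetric]) (use assms in auto)
  finally show ?thesis .
qed

definition sigma :: "nat \<Rightarrow> nat \<Rightarrow> complex" where
  "sigma k n = of_nat (divisor_sum k n)"

lemma sigma_convolution:
  "quad_sum n (\<lambda>_ _ _ _. True) (\<lambda>a b. of_int a ^ i * of_int b ^ j) = (\<Sum>m\<in>{1..<n}. sigma i m * sigma j (n - m))"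
proof -
  have "quad_sum n (\<lambda>_ _ _ _. True) (\<lambda>a b. of_int a ^ i * of_int b ^ j) =
     (\<Sum>(m, a, b) \<in> Sigma {1..<n} (\<lambda>m. {a. a dvd m} \<times> {b. b dvd (n - m)}). of_nat a ^ i * of_nat b ^ j :: complex)"
    unfolding quad_sum_def
    by (rule sum.reindex_bij_witness[where j = "\<lambda>(a, b, x, y). (a * x, a, b)" and i = "\<lambda>(m, a, b). (a, b, m div a, (n - m) div b)"])
       (auto simp: quads_def dvd_def Suc_le_eq intro!: Nat.gr0I split: if_splits)
  also have "\<dots> = (\<Sum>m\<in>{1..<n}. \<Sum>(a, b)\<in>{a. a dvd m} \<times> {b. b dvd (n - m)}. of_nat a ^ i * of_nat b ^ j :: complex)"
    by (subst sum.Sigma) (auto intro!: finite_divisors_nat)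
  also have "\<dots> = (\<Sum>m\<in>{1..<n}. sigma i m * sigma j (n - m))"
    by (intro sum.cong refl) (simp add: sigma_def divisor_sum_def sum.cartesian_product[symmetric] sum_product)
  finally show ?thesis .
qed

lemma liouville_identity_divisors:
  fixes f :: "int \<Rightarrow> int \<Rightarrow> complex"
  assumes "n > 0" "\<And>a b. f (- a) (- b) = f a b"
  shows "quad_sum n (\<lambda>_ _ _ _. True)
           (\<lambda>a b. f a b - f a (- b) + f a (a - b) - f a (a + b) + f (b - a) b - f (a + b) b) =
         (\<Sum>e | e dvd n. (of_nat (n div e) - 1) * (f (int e) (int e) + f 0 (int e) + f (int e) 0) -
            (\<Sum>a\<in>{1..<e}. f (int a) (int a - int e) + f (int a) (int e) + f (int e) (int e - int a)))"
  by (subst liouville_identity, rule assms(2), subst quad_sum_diag_left[OF assms(1)],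
      subst quad_sum_diag_right[OF assms(1)]) (simp add: sum_subtractf)

definition sigma_conv :: "nat \<Rightarrow> nat \<Rightarrow> nat \<Rightarrow> complex" where
  "sigma_conv i j n = (\<Sum>m\<in>{1..<n}. sigma i m * sigma j (n - m))"

lemma sigma_conv_commute: "sigma_conv i j n = sigma_conv j i n"
  unfolding sigma_conv_def
  by (rule sum.reindex_bij_witness[where i = "\<lambda>m. n - m" and j = "\<lambda>m. n - m"]) (auto simp: mult.commute)

lemma power_sums:
  fixes e :: nat
  assumes "e \<ge> 1"
  defines "x \<equiv> (of_nat e :: complex)"
  shows "(\<Sum>a\<in>{1..<e}. of_nat a) = x * (x - 1) / 2"
    and "(\<Sum>a\<in>{1..<e}. of_nat a ^ 2) = x * (x - 1) * (2 * x - 1) / 6"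
    and "(\<Sum>a\<in>{1..<e}. of_nat a ^ 3) = x ^ 2 * (x - 1) ^ 2 / 4"
    and "(\<Sum>a\<in>{1..<e}. of_nat a ^ 4) = x * (x - 1) * (2 * x - 1) * (3 * x ^ 2 - 3 * x - 1) / 30"
    and "(\<Sum>a\<in>{1..<e}. of_nat a ^ 5) = x ^ 2 * (x - 1) ^ 2 * (2 * x ^ 2 - 2 * x - 1) / 12"
    and "(\<Sum>a\<in>{1..<e}. of_nat a ^ 6) = x * (x - 1) * (2 * x - 1) * (3 * x ^ 4 - 6 * x ^ 3 + 3 * x + 1) / 42"
  unfolding x_def using assms(1)
  by (induction e rule: dec_induct; simp add: field_simps eval_nat_numeral)+

lemma sigma_div_sum:
  assumes "n > 0"
  shows "(\<Sum>e | e dvd n. of_nat (n div e) * of_nat e ^ Suc k) = of_nat n * sigma k n"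
proof -
  have "(\<Sum>e | e dvd n. of_nat (n div e) * of_nat e ^ Suc k) = (\<Sum>e | e dvd n. of_nat n * of_nat e ^ k :: complex)"
    by (intro sum.cong refl) (auto simp: dvd_def field_simps)
  then show ?thesis by (simp add: sigma_def divisor_sum_def sum_distrib_left)
qed

lemma sigma_sum: "sigma k n = (\<Sum>e | e dvd n. of_nat e ^ k)"
  by (simp add: sigma_def divisor_sum_def)

lemma divisors_pos: "n > 0 \<Longrightarrow> e \<in> {e. e dvd n} \<Longrightarrow> (e :: nat) \<ge> 1"
  by (cases e) auto

lemma quad_sum_scale:
  fixes g :: "int \<Rightarrow> int \<Rightarrow> 'a :: comm_ring_1"
  shows "quad_sum n P (\<lambda>a b. c * g a b) = c * quad_sum n P g"
  by (simp add: quad_sum_def sum_distrib_left case_prod_unfold)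

lemmas quad_sum_linear = quad_sum_add quad_sum_diff quad_sum_scale


text \<open>The monomial vanishes on both axes, so the diagonal a = b contributes only f(e, e) =
  e^(i + j + 2). In each use \<open>g\<close> is a combination of products of odd powers, hence of
  convolutions, and \<open>h\<close> is a Faulhaber polynomial coming from the diagonal x =
  y.\<close>

lemma sigma_conv_polynomial:
  fixes f g :: "int \<Rightarrow> int \<Rightarrow> complex" and h :: "complex \<Rightarrow> complex"
  assumes "n > 0" and f: "\<And>a b. f a b = of_int a ^ Suc i * of_int b ^ Suc j" and "even (i + j)"
    and g: "\<And>a b. f a b - f a (- b) + f a (a - b) - f a (a + b) + f (b - a) b - f (a + b) b = g a b"
    and h: "\<And>e. e \<ge> 1 \<Longrightarrow> (\<Sum>a\<in>{1..<e}. f (int a) (int a - int e) + f (int a) (int e) + f (int e) (int e - int a)) = h (of_nat e)"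
  shows "quad_sum n (\<lambda>_ _ _ _. True) g =
         of_nat n * sigma (i + j + 1) n - sigma (i + j + 2) n - (\<Sum>e | e dvd n. h (of_nat e))"
proof -
  have even_f: "f (- a) (- b) = f a b" for a b
    using \<open>even (i + j)\<close> by (cases "even i") (auto simp: f)
  have "quad_sum n (\<lambda>_ _ _ _. True) g = quad_sum n (\<lambda>_ _ _ _. True)
           (\<lambda>a b. f a b - f a (- b) + f a (a - b) - f a (a + b) + f (b - a) b - f (a + b) b)"
    by (rule quad_sum_cong) (simp_all add: g)
  also have "\<dots> = (\<Sum>e | e dvd n. of_nat (n div e) * of_nat e ^ Suc (i + j + 1) - of_nat e ^ (i + j + 2) - h (of_nat e))"
  proof (subst liouville_identity_divisors[of n f, OF assms(1) even_f], intro sum.cong refl, goal_cases)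
    case (1 e)
    have "(of_nat (n div e) - 1) * (f (int e) (int e) + f 0 (int e) + f (int e) 0) =
        of_nat (n div e) * of_nat e ^ Suc (i + j + 1) - of_nat e ^ (i + j + 2)"
      by (simp add: f power_add algebra_simps)
    then show ?case using h[OF divisors_pos[OF assms(1) 1]] by simp
  qed
  also have "\<dots> = of_nat n * sigma (i + j + 1) n - sigma (i + j + 2) n - (\<Sum>e | e dvd n. h (of_nat e))"
    unfolding sum_subtractf sigma_div_sum[OF assms(1)] by (simp add: sigma_sum)
  finally show ?thesis .
qed

lemmas sum_linear = sum.distrib sum_subtractf sum_distrib_left[symmetric] sum_divide_distrib[symmetric]

text \<open>For f = ab the combination in \<open>liouville_identity\<close> collapses to -2ab. The
  even-index sum \<open>sigma 2\<close>, like its analogues below, cancels against a term of the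
  diagonal x = y.\<close>

lemma sigma_conv_1_1:
  assumes "n > 0"
  shows "12 * sigma_conv 1 1 n = 5 * sigma 3 n + sigma 1 n - 6 * of_nat n * sigma 1 n"
proof -
  have inner: "(\<Sum>a\<in>{1..<e}. of_int (int a) ^ Suc 0 * of_int (int a - int e) ^ Suc 0 +
        of_int (int a) ^ Suc 0 * of_int (int e) ^ Suc 0 + of_int (int e) ^ Suc 0 * of_int (int e - int a) ^ Suc 0) =
      (\<lambda>x. (5 * x ^ 3 - 6 * x ^ 2 + x ^ 1) / 6) (of_nat e :: complex)" (is "?l = _") if "e \<ge> 1" for e
  proof -
    have "?l = (\<Sum>a\<in>{1..<e}. of_nat a ^ 2 - of_nat e * of_nat a + of_nat e ^ 2)"
      by (intro sum.cong refl) (simp add: algebra_simps power2_eq_square)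
    also have "\<dots> = (5 * of_nat e ^ 3 - 6 * of_nat e ^ 2 + of_nat e ^ 1) / 6"
      using that unfolding sum_linear power_sums[OF that]
      by (simp add: field_simps eval_nat_numeral)
    finally show ?thesis .
  qed
  have "-2 * sigma_conv 1 1 n = quad_sum n (\<lambda>_ _ _ _. True) (\<lambda>a b. -2 * (of_int a ^ 1 * of_int b ^ 1))"
    unfolding sigma_conv_def sigma_convolution[symmetric] quad_sum_scale[symmetric] ..
  also have "\<dots> = of_nat n * sigma (0 + 0 + 1) n - sigma (0 + 0 + 2) n -
      (\<Sum>e | e dvd n. (\<lambda>x. (5 * x ^ 3 - 6 * x ^ 2 + x ^ 1) / 6) (of_nat e))"
    by (rule sigma_conv_polynomial[OF assms refl _ _ inner]) (simp, simp add: algebra_simps)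
  also have "\<dots> = of_nat n * sigma 1 n - sigma 2 n - (5 * sigma 3 n - 6 * sigma 2 n + sigma 1 n) / 6"
    unfolding sum_linear sigma_sum by (simp add: power2_eq_square)
  finally show ?thesis by (simp add: field_simps; algebra)
qed

text \<open>The choice f = a^3 b leads to -2 a^3 b - 6 a b^3, and both terms give the same
  convolution by symmetry.\<close>

lemma sigma_conv_1_3:
  assumes "n > 0"
  shows "240 * sigma_conv 1 3 n = 21 * sigma 5 n + 10 * sigma 3 n - 30 * of_nat n * sigma 3 n - sigma 1 n"
proof -
  have inner: "(\<Sum>a\<in>{1..<e}. of_int (int a) ^ Suc 2 * of_int (int a - int e) ^ Suc 0 +
        of_int (int a) ^ Suc 2 * of_int (int e) ^ Suc 0 + of_int (int e) ^ Suc 2 * of_int (int e - int a) ^ Suc 0) =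
      (\<lambda>x. (21 * x ^ 5 - 30 * x ^ 4 + 10 * x ^ 3 - x ^ 1) / 30) (of_nat e :: complex)" (is "?l = _") if "e \<ge> 1" for e
  proof -
    have "?l = (\<Sum>a\<in>{1..<e}. of_nat a ^ 4 - of_nat e ^ 3 * of_nat a + of_nat e ^ 4)"
      by (intro sum.cong refl) (simp add: algebra_simps eval_nat_numeral)
    also have "\<dots> = (21 * of_nat e ^ 5 - 30 * of_nat e ^ 4 + 10 * of_nat e ^ 3 - of_nat e ^ 1) / 30"
      using that unfolding sum_linear power_sums[OF that]
      by (simp add: field_simps eval_nat_numeral)
    finally show ?thesis .
  qed
  have "-2 * sigma_conv 3 1 n - 6 * sigma_conv 1 3 n =
     quad_sum n (\<lambda>_ _ _ _. True) (\<lambda>a b. -2 * (of_int a ^ 3 * of_int b ^ 1) - 6 * (of_int a ^ 1 * of_int b ^ 3))"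
    unfolding sigma_conv_def sigma_convolution[symmetric] quad_sum_linear ..
  also have "\<dots> = of_nat n * sigma (2 + 0 + 1) n - sigma (2 + 0 + 2) n -
      (\<Sum>e | e dvd n. (\<lambda>x. (21 * x ^ 5 - 30 * x ^ 4 + 10 * x ^ 3 - x ^ 1) / 30) (of_nat e))"
    by (rule sigma_conv_polynomial[OF assms refl _ _ inner]) (simp, simp add: eval_nat_numeral algebra_simps)
  also have "\<dots> = of_nat n * sigma 3 n - sigma 4 n - (21 * sigma 5 n - 30 * sigma 4 n + 10 * sigma 3 n - sigma 1 n) / 30"
    unfolding sum_linear sigma_sum by simp
  finally show ?thesis using sigma_conv_commute[of 3 1 n] by (simp add: field_simps; algebra)
qed

text \<open>Two convolutions are unknown in this weight, so two test functions are used, a^5 b and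
  a^3 b^3, and the resulting linear system is solved.\<close>

lemma sigma_conv_weight_8:
  assumes "n > 0"
  shows "504 * sigma_conv 1 5 n = 20 * sigma 7 n - 42 * of_nat n * sigma 5 n + 21 * sigma 5 n + sigma 1 n"
    and "120 * sigma_conv 3 3 n = sigma 7 n - sigma 3 n"
proof -
  have inner1: "(\<Sum>a\<in>{1..<e}. of_int (int a) ^ Suc 4 * of_int (int a - int e) ^ Suc 0 +
        of_int (int a) ^ Suc 4 * of_int (int e) ^ Suc 0 + of_int (int e) ^ Suc 4 * of_int (int e - int a) ^ Suc 0) =
      (\<lambda>x. (27 * x ^ 7 - 42 * x ^ 6 + 21 * x ^ 5 - 7 * x ^ 3 + x ^ 1) / 42) (of_nat e :: complex)" (is "?l = _") if "e \<ge> 1" for e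
  proof -
    have "?l = (\<Sum>a\<in>{1..<e}. of_nat a ^ 6 - of_nat e ^ 5 * of_nat a + of_nat e ^ 6)"
      by (intro sum.cong refl) (simp add: algebra_simps eval_nat_numeral)
    also have "\<dots> = (27 * of_nat e ^ 7 - 42 * of_nat e ^ 6 + 21 * of_nat e ^ 5 - 7 * of_nat e ^ 3 + of_nat e ^ 1) / 42"
      using that unfolding sum_linear power_sums[OF that]
      by (simp add: field_simps eval_nat_numeral)
    finally show ?thesis .
  qed
  have inner2: "(\<Sum>a\<in>{1..<e}. of_int (int a) ^ Suc 2 * of_int (int a - int e) ^ Suc 2 +
        of_int (int a) ^ Suc 2 * of_int (int e) ^ Suc 2 + of_int (int e) ^ Suc 2 * of_int (int e - int a) ^ Suc 2) =
      (\<lambda>x. (207 * x ^ 7 - 420 * x ^ 6 + 210 * x ^ 5 - 7 * x ^ 3 + 10 * x ^ 1) / 420) (of_nat e :: complex)" (is "?l = _") if "e \<ge> 1" for e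
  proof -
    have "?l = (\<Sum>a\<in>{1..<e}. of_nat a ^ 6 - 3 * of_nat e * of_nat a ^ 5 + 3 * of_nat e ^ 2 * of_nat a ^ 4
      - of_nat e ^ 3 * of_nat a ^ 3 + 3 * of_nat e ^ 4 * of_nat a ^ 2 - 3 * of_nat e ^ 5 * of_nat a + of_nat e ^ 6)"
      by (intro sum.cong refl) (simp add: algebra_simps eval_nat_numeral)
    also have "\<dots> = (207 * of_nat e ^ 7 - 420 * of_nat e ^ 6 + 210 * of_nat e ^ 5 - 7 * of_nat e ^ 3 + 10 * of_nat e ^ 1) / 420"
      using that unfolding sum_linear power_sums[OF that]
      by (simp add: field_simps eval_nat_numeral)
    finally show ?thesis .
  qed
  have "-2 * sigma_conv 5 1 n - 20 * sigma_conv 3 3 n - 10 * sigma_conv 1 5 n =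
     quad_sum n (\<lambda>_ _ _ _. True) (\<lambda>a b. -2 * (of_int a ^ 5 * of_int b ^ 1) - 20 * (of_int a ^ 3 * of_int b ^ 3)
        - 10 * (of_int a ^ 1 * of_int b ^ 5))"
    unfolding sigma_conv_def sigma_convolution[symmetric] quad_sum_linear ..
  also have "\<dots> = of_nat n * sigma (4 + 0 + 1) n - sigma (4 + 0 + 2) n -
      (\<Sum>e | e dvd n. (\<lambda>x. (27 * x ^ 7 - 42 * x ^ 6 + 21 * x ^ 5 - 7 * x ^ 3 + x ^ 1) / 42) (of_nat e))"
    by (rule sigma_conv_polynomial[OF assms refl _ _ inner1]) (simp, simp add: eval_nat_numeral algebra_simps)
  also have "\<dots> = of_nat n * sigma 5 n - sigma 6 n -
      (27 * sigma 7 n - 42 * sigma 6 n + 21 * sigma 5 n - 7 * sigma 3 n + sigma 1 n) / 42"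
    unfolding sum_linear sigma_sum by simp
  finally have 1: "-2 * sigma_conv 5 1 n - 20 * sigma_conv 3 3 n - 10 * sigma_conv 1 5 n = \<dots>" .
  have "-2 * sigma_conv 3 3 n - 6 * sigma_conv 5 1 n - 6 * sigma_conv 1 5 n =
     quad_sum n (\<lambda>_ _ _ _. True) (\<lambda>a b. -2 * (of_int a ^ 3 * of_int b ^ 3) - 6 * (of_int a ^ 5 * of_int b ^ 1)
        - 6 * (of_int a ^ 1 * of_int b ^ 5))"
    unfolding sigma_conv_def sigma_convolution[symmetric] quad_sum_linear ..
  also have "\<dots> = of_nat n * sigma (2 + 2 + 1) n - sigma (2 + 2 + 2) n -
      (\<Sum>e | e dvd n. (\<lambda>x. (207 * x ^ 7 - 420 * x ^ 6 + 210 * x ^ 5 - 7 * x ^ 3 + 10 * x ^ 1) / 420) (of_nat e))"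
    by (rule sigma_conv_polynomial[OF assms refl _ _ inner2]) (simp, simp add: eval_nat_numeral algebra_simps)
  also have "\<dots> = of_nat n * sigma 5 n - sigma 6 n -
      (207 * sigma 7 n - 420 * sigma 6 n + 210 * sigma 5 n - 7 * sigma 3 n + 10 * sigma 1 n) / 420"
    unfolding sum_linear sigma_sum by simp
  finally have 2: "-2 * sigma_conv 3 3 n - 6 * sigma_conv 5 1 n - 6 * sigma_conv 1 5 n = \<dots>" .
  have e: "120 * u = p - q" "504 * v = 20 * p - 42 * m * r + 21 * r + t"
    if "-2 * v - 20 * u - 10 * v = m * r - s - (27 * p - 42 * s + 21 * r - 7 * q + t) / 42"
      "-2 * u - 6 * v - 6 * v = m * r - s - (207 * p - 420 * s + 210 * r - 7 * q + 10 * t) / 420"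
    for u v m p q r s t :: complex
  proof -
    have clear: "k * x = k * y - z" if "x = y - z / k" "k \<noteq> 0" for k x y z :: complex
      using that by (simp add: field_simps)
    have 1: "42 * (-2 * v - 20 * u - 10 * v) = 42 * (m * r - s) - (27 * p - 42 * s + 21 * r - 7 * q + t)"
      by (rule clear[OF that(1)]) simp
    have 2: "420 * (-2 * u - 6 * v - 6 * v) = 420 * (m * r - s) - (207 * p - 420 * s + 210 * r - 7 * q + 10 * t)"
      by (rule clear[OF that(2)]) simp
    \<comment> \<open>The unknown v has total coefficient -12 in both relations, so their difference
      at the common scale 420 contains only u, with 420 * 18 = 63 * 120.\<close>
    have 3: "63 * (120 * u) = 63 * (p - q)"
      using arg_cong2[OF 1 2, of "\<lambda>x y. y - 10 * x"] by (simp add: algebra_simps)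
    then show "120 * u = p - q" by (subst (asm) mult_left_cancel) simp_all
    show "504 * v = 20 * p - 42 * m * r + 21 * r + t"
      using arg_cong2[OF 1 3, of "\<lambda>x y. - x - y / 9"] by (simp add: algebra_simps add_divide_distrib diff_divide_distrib)
  qed
  show "504 * sigma_conv 1 5 n = 20 * sigma 7 n - 42 * of_nat n * sigma 5 n + 21 * sigma 5 n + sigma 1 n"
       "120 * sigma_conv 3 3 n = sigma 7 n - sigma 3 n"
    using e[OF 1[unfolded sigma_conv_commute[of 5 1 n]] 2[unfolded sigma_conv_commute[of 5 1 n]]]
    by simp_all
qed

section \<open>Generating series and Ramanujan's differential equations\<close>

definition sigma_fps :: "nat \<Rightarrow> complex fps" where
  "sigma_fps k = Abs_fps (\<lambda>n. if n = 0 then 0 else sigma k n)"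

text \<open>This is q d/dq, and also z d/dz for series in z = 1/j.\<close>

definition euler_deriv :: "'a :: comm_semiring_1 fps \<Rightarrow> 'a fps" where
  "euler_deriv f = fps_X * fps_deriv f"

lemma euler_deriv_nth: "fps_nth (euler_deriv f) n = of_nat n * fps_nth f n"
  by (cases n) (simp_all add: euler_deriv_def)

lemma sigma_fps_mult_nth: "n > 0 \<Longrightarrow> fps_nth (sigma_fps i * sigma_fps j) n = sigma_conv i j n"
proof -
  assume "n > 0"
  have "fps_nth (sigma_fps i * sigma_fps j) n = (\<Sum>m\<in>{0..n}. fps_nth (sigma_fps i) m * fps_nth (sigma_fps j) (n - m))"
    by (simp add: fps_mult_nth)
  also have "\<dots> = (\<Sum>m\<in>{1..<n}. fps_nth (sigma_fps i) m * fps_nth (sigma_fps j) (n - m))"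
    by (rule sum.mono_neutral_right) (auto simp: sigma_fps_def)
  also have "\<dots> = sigma_conv i j n"
    by (auto simp: sigma_conv_def sigma_fps_def intro!: sum.cong)
  finally show ?thesis .
qed

lemma sigma_fps_mult_0: "fps_nth (sigma_fps i * sigma_fps j) 0 = 0"
  by (simp add: sigma_fps_def)

lemma sigma_fps_nth: "fps_nth (sigma_fps k) n = (if n = 0 then 0 else sigma k n)"
  by (simp add: sigma_fps_def)

lemma fps_numeral_mult_nth: "fps_nth (numeral k * f) n = numeral k * fps_nth (f :: 'a :: comm_ring_1 fps) n"
  by (simp add: numeral_fps_const)

lemma sigma_fps_products:
  "12 * (sigma_fps 1 * sigma_fps 1) = 5 * sigma_fps 3 + sigma_fps 1 - 6 * euler_deriv (sigma_fps 1)"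
  "240 * (sigma_fps 1 * sigma_fps 3) = 21 * sigma_fps 5 + 10 * sigma_fps 3 - 30 * euler_deriv (sigma_fps 3) - sigma_fps 1"
  "504 * (sigma_fps 1 * sigma_fps 5) = 20 * sigma_fps 7 - 42 * euler_deriv (sigma_fps 5) + 21 * sigma_fps 5 + sigma_fps 1"
  "120 * (sigma_fps 3 * sigma_fps 3) = sigma_fps 7 - sigma_fps 3"
proof (rule_tac [!] fps_ext)
  note s = fps_numeral_mult_nth fps_add_nth fps_sub_nth sigma_fps_mult_0 sigma_fps_mult_nth sigma_fps_nth euler_deriv_nth
  note c = sigma_conv_1_1[simplified] sigma_conv_1_3[simplified] sigma_conv_weight_8[simplified]
  fix n
  show "fps_nth (12 * (sigma_fps 1 * sigma_fps 1)) n = fps_nth (5 * sigma_fps 3 + sigma_fps 1 - 6 * euler_deriv (sigma_fps 1)) n"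
    "fps_nth (240 * (sigma_fps 1 * sigma_fps 3)) n =
       fps_nth (21 * sigma_fps 5 + 10 * sigma_fps 3 - 30 * euler_deriv (sigma_fps 3) - sigma_fps 1) n"
    "fps_nth (504 * (sigma_fps 1 * sigma_fps 5)) n =
       fps_nth (20 * sigma_fps 7 - 42 * euler_deriv (sigma_fps 5) + 21 * sigma_fps 5 + sigma_fps 1) n"
    "fps_nth (120 * (sigma_fps 3 * sigma_fps 3)) n = fps_nth (sigma_fps 7 - sigma_fps 3) n"
    by (cases "n = 0"; simp only: s; simp add: c)+
qed

definition "E2 = 1 - 24 * sigma_fps 1"
definition "E4 = 1 + 240 * sigma_fps 3"
definition "E6 = 1 - 504 * sigma_fps 5"

lemma euler_deriv_simps:
  fixes f g :: "complex fps"
  shows "euler_deriv (f + g) = euler_deriv f + euler_deriv g"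
    "euler_deriv (f - g) = euler_deriv f - euler_deriv g"
    "euler_deriv (f * g) = euler_deriv f * g + f * euler_deriv g"
    "euler_deriv (numeral k) = 0" "euler_deriv 1 = 0" "euler_deriv 0 = 0"
  by (simp_all add: euler_deriv_def algebra_simps numeral_fps_const)

theorem ramanujan_identities:
  "12 * euler_deriv E2 = E2 ^ 2 - E4"
  "3 * euler_deriv E4 = E2 * E4 - E6"
  "2 * euler_deriv E6 = E2 * E6 - E4 ^ 2"
proof -
  have e: "euler_deriv E2 = - 24 * euler_deriv (sigma_fps 1)"
    "euler_deriv E4 = 240 * euler_deriv (sigma_fps 3)"
    "euler_deriv E6 = - 504 * euler_deriv (sigma_fps 5)"
    unfolding E2_def E4_def E6_def euler_deriv_simps by simp_all
  \<comment> \<open>The third line removes \<open>sigma_fps 7\<close> by the relation for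
    \<open>sigma_fps 3 * sigma_fps 3\<close>, which is the identity E4^2 = E8.\<close>
  have l: "6 * euler_deriv (sigma_fps 1) = 5 * sigma_fps 3 + sigma_fps 1 - 12 * (sigma_fps 1 * sigma_fps 1)"
    "30 * euler_deriv (sigma_fps 3) = 21 * sigma_fps 5 + 10 * sigma_fps 3 - sigma_fps 1 - 240 * (sigma_fps 1 * sigma_fps 3)"
    "42 * euler_deriv (sigma_fps 5) = 20 * (120 * (sigma_fps 3 * sigma_fps 3) + sigma_fps 3) + 21 * sigma_fps 5 + sigma_fps 1 -
       504 * (sigma_fps 1 * sigma_fps 5)"
    by (simp_all only: sigma_fps_products) (simp_all add: algebra_simps)
  have "12 * euler_deriv E2 = - 48 * (6 * euler_deriv (sigma_fps 1))"
    "3 * euler_deriv E4 = 24 * (30 * euler_deriv (sigma_fps 3))"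
    "2 * euler_deriv E6 = - 24 * (42 * euler_deriv (sigma_fps 5))"
    unfolding e by simp_all
  then show "12 * euler_deriv E2 = E2 ^ 2 - E4" "3 * euler_deriv E4 = E2 * E4 - E6"
     "2 * euler_deriv E6 = E2 * E6 - E4 ^ 2"
    unfolding l unfolding E2_def E4_def E6_def by (simp_all add: algebra_simps power2_eq_square)
qed

lemma euler_deriv_power2: "euler_deriv (f ^ 2 :: complex fps) = 2 * f * euler_deriv f"
  and euler_deriv_power3: "euler_deriv (f ^ 3 :: complex fps) = 3 * f ^ 2 * euler_deriv f"
  and euler_deriv_power4: "euler_deriv (f ^ 4 :: complex fps) = 4 * f ^ 3 * euler_deriv f"
  by (simp_all add: euler_deriv_def eval_nat_numeral algebra_simps)

lemmas euler_deriv_rules = euler_deriv_simps euler_deriv_power2 euler_deriv_power3 euler_deriv_power4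

lemma E_nth_0: "fps_nth E2 0 = 1" "fps_nth E4 0 = 1" "fps_nth E6 0 = 1"
  by (simp_all add: E2_def E4_def E6_def sigma_fps_nth fps_numeral_mult_nth)

lemma E4_inverse: "E4 * inverse E4 = 1" and E6_inverse: "E6 * inverse E6 = 1"
  by (simp_all add: inverse_mult_eq_1' E_nth_0)

lemma E4_nonzero: "E4 \<noteq> 0" and E6_nonzero: "E6 \<noteq> 0"
  using E_nth_0 by auto

section \<open>The hypergeometric equation satisfied by periods\<close>

text \<open>$J = 1/j$ as a power series in $q$.\<close>
definition J_inv :: "complex fps" where
  "J_inv = fps_const (1 / 1728) * (E4 ^ 3 - E6 ^ 2) * inverse E4 ^ 3"

lemma J_inv_eq: "1728 * J_inv * E4 ^ 3 = E4 ^ 3 - E6 ^ 2"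
proof -
  have "1728 * J_inv * E4 ^ 3 = (1728 * fps_const (1 / 1728)) * (E4 ^ 3 - E6 ^ 2) * (E4 * inverse E4) ^ 3"
    unfolding J_inv_def by (simp only: power_mult_distrib mult_ac)
  also have "1728 * fps_const (1 / 1728) = (1 :: complex fps)"
    by (simp add: numeral_fps_const)
  finally show ?thesis by (simp add: E4_inverse)
qed

text \<open>By Ramanujan's identities, E4^3 - E6^2 has logarithmic derivative E2 and E4^3 has E2 -
  E6/E4; the quotient J therefore has E6/E4, and E2 disappears.\<close>

lemma J_inv_deriv: "euler_deriv J_inv * E4 = J_inv * E6"
proof -
  have "1728 * euler_deriv J_inv * E4 ^ 3 + 1728 * J_inv * E4 ^ 2 * (3 * euler_deriv E4) =
      E4 ^ 2 * (3 * euler_deriv E4) - E6 * (2 * euler_deriv E6)"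
    using arg_cong[OF J_inv_eq, of euler_deriv] by (simp add: euler_deriv_rules algebra_simps)
  then have "1728 * euler_deriv J_inv * E4 ^ 3 + 1728 * J_inv * E4 ^ 2 * (E2 * E4 - E6) = E2 * (E4 ^ 3 - E6 ^ 2)"
    unfolding ramanujan_identities by (simp add: algebra_simps eval_nat_numeral)
  then have "(1728 * E4 ^ 2) * (euler_deriv J_inv * E4) = (1728 * E4 ^ 2) * (J_inv * E6)"
    unfolding J_inv_eq[symmetric] by (simp add: algebra_simps eval_nat_numeral)
  then show ?thesis using E4_nonzero by (subst (asm) mult_left_cancel) auto
qed

text \<open>By \<open>J_inv_deriv\<close>, q d/dq = (E6/E4) z d/dz for z = J, so this is z d/dz
  written as a derivation on series in q.\<close>

definition theta_J :: "complex fps \<Rightarrow> complex fps" where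
  "theta_J u = E4 * inverse E6 * euler_deriv u"

lemma theta_J_eq: "E6 * theta_J u = E4 * euler_deriv u"
  using E6_inverse by (simp add: theta_J_def mult.left_commute[of E6] mult.assoc[symmetric])

lemma theta_J_simps:
  "theta_J (f + g) = theta_J f + theta_J g" "theta_J (f - g) = theta_J f - theta_J g"
  "theta_J (f * g) = theta_J f * g + f * theta_J g"
  "theta_J (numeral k) = 0" "theta_J 1 = 0" "theta_J 0 = 0"
  by (simp_all add: theta_J_def euler_deriv_simps algebra_simps)

text \<open>
  This is $E_4^{1/2}$, of which only the logarithmic derivative $(E_2 E_4 - E_6)/(6 E_4)$ matters.
\<close>
definition weight_1 :: "complex fps" where
  "weight_1 = fps_exp 1 oo fps_integral0 (fps_shift 1 (fps_const (1 / 6) * (E2 * E4 - E6) * inverse E4))"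

text \<open>The logarithmic derivative of E4^(1/2) under \<open>theta_J\<close>. The factor E4
  cancels, so from here on only powers of E6 occur as denominators.\<close>

definition "weight_quot1 = fps_const (1 / 6) * (E2 * E4 - E6) * inverse E6"

lemma weight_1_deriv: "euler_deriv weight_1 = weight_1 * (fps_const (1 / 6) * (E2 * E4 - E6) * inverse E4)" (is "_ = _ * ?s")
proof -
  \<comment> \<open>The constant term vanishes, so the shift by 1 in \<open>weight_1\<close> is an
    exact division by q.\<close>
  have "fps_nth ?s 0 = 0" by (simp add: E_nth_0)
  then have s: "fps_X * fps_shift 1 ?s = ?s"
    by (subst fps_ext) (auto simp: fps_X_mult_nth)
  have "euler_deriv weight_1 = fps_X * ((fps_exp 1 oo fps_integral0 (fps_shift 1 ?s)) * fps_shift 1 ?s)"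
    unfolding euler_deriv_def weight_1_def by (subst fps_compose_deriv) (simp_all add: fps_deriv_fps_integral)
  also have "\<dots> = weight_1 * ?s"
    unfolding weight_1_def mult.left_commute[of fps_X] s ..
  finally show ?thesis .
qed

lemma weight_1_nth_0: "fps_nth weight_1 0 = 1"
  by (simp add: weight_1_def)

lemma theta_weight_1: "theta_J weight_1 = weight_quot1 * weight_1"
proof -
  have "theta_J weight_1 = (E4 * inverse E4) * (weight_quot1 * weight_1)"
    unfolding theta_J_def weight_1_deriv weight_quot1_def by (simp only: mult_ac)
  then show ?thesis by (simp add: E4_inverse)
qed

text \<open>If theta u = b u and theta^k u = c u, then theta^(k+1) u = (theta c + b c) u. This
  yields the quotients theta^k u / u of u = \<open>weight_1\<close> for k = 2 and 3.\<close>

definition "weight_quot2 = theta_J weight_quot1 + weight_quot1 * weight_quot1"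
definition "weight_quot3 = theta_J weight_quot2 + weight_quot1 * weight_quot2"

lemma theta2_weight_1: "theta_J (theta_J weight_1) = weight_quot2 * weight_1"
  by (simp add: theta_weight_1 theta_J_simps weight_quot2_def algebra_simps)

lemma theta3_weight_1: "theta_J (theta_J (theta_J weight_1)) = weight_quot3 * weight_1"
  unfolding theta2_weight_1 by (simp add: theta_weight_1 theta_J_simps weight_quot3_def algebra_simps)

lemma weight_quot1_eq: "6 * (E6 * weight_quot1) = E2 * E4 - E6"
proof -
  have "6 * (E6 * weight_quot1) = (6 * fps_const (1 / 6)) * (E6 * inverse E6) * (E2 * E4 - E6)"
    unfolding weight_quot1_def by (simp only: mult_ac)
  also have "6 * fps_const (1 / 6) = (1 :: complex fps)"
    by (simp add: numeral_fps_const)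
  finally show ?thesis by (simp add: E6_inverse)
qed

text \<open>Clearing denominators keeps the computations with $E_2, E_4, E_6$ polynomial.\<close>
lemma theta_quotient_1:
  assumes "c * (E6 * u) = v" "euler_deriv c = 0"
  shows "c * (E6 ^ 3 * theta_J u) = E4 * (E6 * euler_deriv v - euler_deriv E6 * v)"
proof -
  have "euler_deriv v = c * (euler_deriv E6 * u + E6 * euler_deriv u)"
    by (simp add: assms(1)[symmetric] assms(2) euler_deriv_simps)
  moreover have "c * (E6 ^ 3 * theta_J u) = E4 * (c * E6 ^ 2 * euler_deriv u)"
    using theta_J_eq[of u] by (simp add: eval_nat_numeral mult_ac)
  ultimately show ?thesis
    by (simp add: assms(1)[symmetric] algebra_simps eval_nat_numeral)
qed

text \<open>Each \<open>theta_J\<close> costs two powers of E6, one from its own factor 1/E6 and one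
  from the quotient rule; hence the denominators E6, E6^3, E6^5.\<close>

lemma theta_quotient_3:
  assumes "c * (E6 ^ 3 * u) = v" "euler_deriv c = 0"
  shows "c * (E6 ^ 5 * theta_J u) = E4 * (E6 * euler_deriv v - 3 * euler_deriv E6 * v)"
proof -
  have "euler_deriv v = c * (3 * E6 ^ 2 * euler_deriv E6 * u + E6 ^ 3 * euler_deriv u)"
    by (simp add: assms(1)[symmetric] assms(2) euler_deriv_rules)
  moreover have "c * (E6 ^ 5 * theta_J u) = E4 * (c * E6 ^ 4 * euler_deriv u)"
    using theta_J_eq[of u] by (simp add: eval_nat_numeral mult_ac)
  ultimately show ?thesis
    by (simp add: assms(1)[symmetric] algebra_simps eval_nat_numeral)
qed

lemma weight_quot2_eq: "72 * (E6 ^ 3 * weight_quot2) =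
   E2 ^ 2 * E4 ^ 2 * E6 - E4 ^ 3 * E6 - 8 * E2 * E4 * E6 ^ 2 + 6 * E2 * E4 ^ 4 + 2 * E6 ^ 3" (is "_ = ?A2")
proof -
  have "72 * (E6 ^ 3 * theta_J weight_quot1) = 12 * E4 * (E6 * euler_deriv (E2 * E4 - E6) - euler_deriv E6 * (E2 * E4 - E6))"
    using arg_cong[OF theta_quotient_1[OF weight_quot1_eq euler_deriv_simps(4)], of "(*) 12"] by simp
  also have "\<dots> = E4 * (E6 * (E4 * (12 * euler_deriv E2) + 4 * E2 * (3 * euler_deriv E4) - 6 * (2 * euler_deriv E6))
      - 6 * (2 * euler_deriv E6) * (E2 * E4 - E6))"
    by (simp add: euler_deriv_simps algebra_simps)
  finally have 1: "72 * (E6 ^ 3 * theta_J weight_quot1) = \<dots>" .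
  have "72 * (E6 ^ 3 * (weight_quot1 * weight_quot1)) = 2 * E6 * (6 * (E6 * weight_quot1)) * (6 * (E6 * weight_quot1))"
    by (simp add: algebra_simps eval_nat_numeral)
  also have "\<dots> = 2 * E6 * (E2 * E4 - E6) * (E2 * E4 - E6)"
    unfolding weight_quot1_eq ..
  finally have 2: "72 * (E6 ^ 3 * (weight_quot1 * weight_quot1)) = 2 * E6 * (E2 * E4 - E6) * (E2 * E4 - E6)" .
  have "72 * (E6 ^ 3 * weight_quot2) = 72 * (E6 ^ 3 * theta_J weight_quot1) + 72 * (E6 ^ 3 * (weight_quot1 * weight_quot1))"
    by (simp add: weight_quot2_def algebra_simps)
  then show ?thesis unfolding 1 2 ramanujan_identities by (simp add: algebra_simps eval_nat_numeral)
qed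

lemma weight_quot3_eq: "432 * (E6 ^ 5 * weight_quot3) = (E4 ^ 3 - E6 ^ 2) *
   (9 * E2 ^ 2 * E4 ^ 2 * E6 - 9 * E4 ^ 3 * E6 - 26 * E2 * E4 * E6 ^ 2 + 54 * E2 * E4 ^ 4 + 2 * E6 ^ 3)"
proof -
  let ?A2 = "E2 ^ 2 * E4 ^ 2 * E6 - E4 ^ 3 * E6 - 8 * E2 * E4 * E6 ^ 2 + 6 * E2 * E4 ^ 4 + 2 * E6 ^ 3"
  have "432 * (E6 ^ 5 * theta_J weight_quot2) = 6 * E4 * (E6 * euler_deriv ?A2 - 3 * euler_deriv E6 * ?A2)"
    using arg_cong[OF theta_quotient_3[OF weight_quot2_eq euler_deriv_simps(4)], of "(*) 6"] by simp
  also have "\<dots> = E4 * (E6 * (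
       (2 * E2 * E4 ^ 2 * E6 - 8 * E4 * E6 ^ 2 + 6 * E4 ^ 4) * (6 * euler_deriv E2)
     + (2 * E2 ^ 2 * E4 * E6 - 3 * E4 ^ 2 * E6 - 8 * E2 * E6 ^ 2 + 24 * E2 * E4 ^ 3) * (2 * (3 * euler_deriv E4))
     + (E2 ^ 2 * E4 ^ 2 - E4 ^ 3 - 16 * E2 * E4 * E6 + 6 * E6 ^ 2) * (3 * (2 * euler_deriv E6))
      ) - 9 * (2 * euler_deriv E6) * ?A2)"
    unfolding euler_deriv_rules by (simp add: algebra_simps)
  also have "\<dots> = E4 * (E6 * (
       (E2 * E4 ^ 2 * E6 - 4 * E4 * E6 ^ 2 + 3 * E4 ^ 4) * (12 * euler_deriv E2)
     + (2 * E2 ^ 2 * E4 * E6 - 3 * E4 ^ 2 * E6 - 8 * E2 * E6 ^ 2 + 24 * E2 * E4 ^ 3) * (2 * (3 * euler_deriv E4))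
     + (E2 ^ 2 * E4 ^ 2 - E4 ^ 3 - 16 * E2 * E4 * E6 + 6 * E6 ^ 2) * (3 * (2 * euler_deriv E6))
      ) - 9 * (2 * euler_deriv E6) * ?A2)"
    by (simp add: algebra_simps)
  finally have 1: "432 * (E6 ^ 5 * theta_J weight_quot2) = \<dots>" .
  have "432 * (E6 ^ 5 * (weight_quot1 * weight_quot2)) = E6 * (6 * (E6 * weight_quot1)) * (72 * (E6 ^ 3 * weight_quot2))"
    by (simp add: algebra_simps eval_nat_numeral)
  also have "\<dots> = E6 * (E2 * E4 - E6) * ?A2"
    unfolding weight_quot1_eq weight_quot2_eq ..
  finally have 2: "432 * (E6 ^ 5 * (weight_quot1 * weight_quot2)) = E6 * (E2 * E4 - E6) * ?A2" .
  have "432 * (E6 ^ 5 * weight_quot3) = 432 * (E6 ^ 5 * theta_J weight_quot2) + 432 * (E6 ^ 5 * (weight_quot1 * weight_quot2))"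
    by (simp add: weight_quot3_def algebra_simps)
  then show ?thesis unfolding 1 2 ramanujan_identities by (simp add: algebra_simps eval_nat_numeral)
qed

text \<open>The value of the derivation \<^const>\<open>theta_J\<close> at $\log q$.\<close>
definition "theta_log_q = E4 * inverse E6"

lemma theta_log_q_eq: "E6 * theta_log_q = E4" "1 * (E6 * theta_log_q) = E4"
  using E6_inverse by (simp_all add: theta_log_q_def mult.left_commute)

lemma theta2_log_q_eq: "6 * (E6 ^ 3 * theta_J theta_log_q) = 3 * E4 ^ 4 - E2 * E4 ^ 2 * E6 - 2 * E4 * E6 ^ 2"
proof -
  have "6 * (E6 ^ 3 * theta_J theta_log_q) = E4 * (2 * E6 * (3 * euler_deriv E4) - 3 * (2 * euler_deriv E6) * E4)"
    using arg_cong[OF theta_quotient_1[OF theta_log_q_eq(2) euler_deriv_simps(5)], of "(*) 6"] by (simp add: algebra_simps)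
  then show ?thesis unfolding ramanujan_identities by (simp add: algebra_simps eval_nat_numeral)
qed

lemma theta3_log_q_eq: "72 * (E6 ^ 5 * theta_J (theta_J theta_log_q)) = E4 * (54 * E4 ^ 6 - 18 * E2 * E4 ^ 4 * E6 -
   59 * E4 ^ 3 * E6 ^ 2 + 3 * E2 ^ 2 * E4 ^ 2 * E6 ^ 2 + 12 * E2 * E4 * E6 ^ 3 + 8 * E6 ^ 4)"
proof -
  let ?C = "3 * E4 ^ 4 - E2 * E4 ^ 2 * E6 - 2 * E4 * E6 ^ 2"
  have "72 * (E6 ^ 5 * theta_J (theta_J theta_log_q)) = 12 * E4 * (E6 * euler_deriv ?C - 3 * euler_deriv E6 * ?C)"
    using arg_cong[OF theta_quotient_3[OF theta2_log_q_eq euler_deriv_simps(4)], of "(*) 12"] by simp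
  also have "\<dots> = E4 * (E6 * (- (E4 ^ 2 * E6) * (12 * euler_deriv E2)
     + (12 * E4 ^ 3 - 2 * E2 * E4 * E6 - 2 * E6 ^ 2) * (4 * (3 * euler_deriv E4))
     + (- E2 * E4 ^ 2 - 4 * E4 * E6) * (6 * (2 * euler_deriv E6))) - 18 * (2 * euler_deriv E6) * ?C)"
    unfolding euler_deriv_rules by (simp add: algebra_simps)
  finally show ?thesis
    unfolding ramanujan_identities by (simp add: algebra_simps eval_nat_numeral)
qed

text \<open>
  The hypergeometric operator $\theta^3 - 24 z (2\theta+1)(6\theta+1)(6\theta+5)$ in the variable
  $z = J$, and its derivative with respect to $\theta$.
\<close>
definition hyp_op :: "complex fps \<Rightarrow> complex fps" where
  "hyp_op u = theta_J (theta_J (theta_J u)) -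
     24 * J_inv * (72 * theta_J (theta_J (theta_J u)) + 108 * theta_J (theta_J u) + 46 * theta_J u + 5 * u)"

definition hyp_op' :: "complex fps \<Rightarrow> complex fps" where
  "hyp_op' u = 3 * theta_J (theta_J u) - 24 * J_inv * (216 * theta_J (theta_J u) + 216 * theta_J u + 46 * u)"

text \<open>Since 24 * 72 = 1728 and 1 - 1728 J = E6^2 / E4^3, collecting x on one side turns the
  equation into 72 E6^2 x = (E4^3 - E6^2) y; the hypothesis is this times E6^3.\<close>

lemma J_inv_clear:
  assumes "72 * (E6 ^ 5 * x) = (E4 ^ 3 - E6 ^ 2) * (E6 ^ 3 * y)"
  shows "x = 24 * J_inv * (72 * x + y)"
proof -
  have "(72 * E4 ^ 3 * E6 ^ 3) * (24 * J_inv * (72 * x + y)) = E6 ^ 3 * (1728 * J_inv * E4 ^ 3) * (72 * x + y)"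
    by (simp add: algebra_simps)
  also have "\<dots> = (72 * E4 ^ 3 * E6 ^ 3) * x + ((E4 ^ 3 - E6 ^ 2) * (E6 ^ 3 * y) - 72 * (E6 ^ 5 * x))"
    unfolding J_inv_eq by (simp add: algebra_simps eval_nat_numeral)
  also have "\<dots> = (72 * E4 ^ 3 * E6 ^ 3) * x" by (simp add: assms)
  finally show ?thesis
    using E4_nonzero E6_nonzero by (subst (asm) mult_left_cancel) auto
qed

text \<open>After division by \<open>weight_1\<close> and clearing of E6, the claim is a polynomial
  identity in E2, E4, E6, which may be treated as independent variables.\<close>

lemma hyp_op_weight_1: "hyp_op weight_1 = 0"
proof -
  have "6 * (72 * (E6 ^ 5 * weight_quot3)) = 6 * ((E4 ^ 3 - E6 ^ 2) * (E6 ^ 3 * (108 * weight_quot2 + 46 * weight_quot1 + 5)))"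
  proof -
    have "6 * ((E4 ^ 3 - E6 ^ 2) * (E6 ^ 3 * (108 * weight_quot2 + 46 * weight_quot1 + 5))) =
       (E4 ^ 3 - E6 ^ 2) * (9 * (72 * (E6 ^ 3 * weight_quot2)) + 46 * E6 ^ 2 * (6 * (E6 * weight_quot1)) + 30 * E6 ^ 3)"
      by (simp add: algebra_simps eval_nat_numeral)
    also have "\<dots> = 432 * (E6 ^ 5 * weight_quot3)"
      unfolding weight_quot2_eq weight_quot1_eq weight_quot3_eq by (simp add: algebra_simps eval_nat_numeral)
    finally show ?thesis by simp
  qed
  then have "72 * (E6 ^ 5 * weight_quot3) = (E4 ^ 3 - E6 ^ 2) * (E6 ^ 3 * (108 * weight_quot2 + 46 * weight_quot1 + 5))"
    by (subst (asm) mult_left_cancel) simp_all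
  from J_inv_clear[OF this]
  have "weight_quot3 - 24 * J_inv * (72 * weight_quot3 + (108 * weight_quot2 + 46 * weight_quot1 + 5)) = 0"
    by simp
  moreover have "hyp_op weight_1 = (weight_quot3 - 24 * J_inv * (72 * weight_quot3 + (108 * weight_quot2 + 46 * weight_quot1 + 5))) * weight_1"
    unfolding hyp_op_def theta3_weight_1 unfolding theta2_weight_1 unfolding theta_weight_1
    by (simp add: algebra_simps)
  ultimately show ?thesis by simp
qed

text \<open>The hypothesis says that U is log(q/J) up to a constant, as q d/dq log J = E6/E4.
  Formally \<open>weight_1\<close> times log q = U + log z is a solution, and L(u log z) = (L u) log
  z + L' u with L' the derivative of L in theta; removing log z leaves this equation.\<close>

lemma hyp_op_weight_1_log:
  assumes "euler_deriv U * E4 = E4 - E6"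
  shows "hyp_op (weight_1 * U) + hyp_op' weight_1 = 0"
proof -
  have U: "theta_J U = theta_log_q - 1"
  proof -
    have "E6 * theta_J U = E6 * (theta_log_q - 1)"
      using assms by (simp only: theta_J_eq right_diff_distrib theta_log_q_eq mult_1_right mult.commute[of _ E4])
    then show ?thesis using E6_nonzero by simp
  qed
  \<comment> \<open>By Leibniz, \<open>?c3\<close> and \<open>?c2\<close> are the parts free of log
    q in theta^3 and theta^2 of \<open>weight_1\<close> log q, divided by
    \<open>weight_1\<close>.\<close>
  let ?c3 = "3 * weight_quot2 * theta_log_q + 3 * weight_quot1 * theta_J theta_log_q + theta_J (theta_J theta_log_q)"
  let ?c2 = "2 * weight_quot1 * theta_log_q + theta_J theta_log_q"
  have c2: "6 * (E6 ^ 3 * ?c2) = 2 * E6 * (E2 * E4 - E6) * E4 + (3 * E4 ^ 4 - E2 * E4 ^ 2 * E6 - 2 * E4 * E6 ^ 2)"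
  proof -
    have "6 * (E6 ^ 3 * ?c2) = 2 * E6 * (6 * (E6 * weight_quot1)) * (E6 * theta_log_q) + 6 * (E6 ^ 3 * theta_J theta_log_q)"
      by (simp add: algebra_simps eval_nat_numeral)
    then show ?thesis unfolding weight_quot1_eq theta_log_q_eq theta2_log_q_eq .
  qed
  have c3: "72 * (E6 ^ 5 * ?c3) = 3 * E6 * (72 * (E6 ^ 3 * weight_quot2)) * (E6 * theta_log_q) +
      6 * E6 * (6 * (E6 * weight_quot1)) * (6 * (E6 ^ 3 * theta_J theta_log_q)) + 72 * (E6 ^ 5 * theta_J (theta_J theta_log_q))"
    by (simp add: algebra_simps eval_nat_numeral)
  have "72 * (E6 ^ 5 * ?c3) = (E4 ^ 3 - E6 ^ 2) * (E6 ^ 3 * (108 * ?c2 + 46 * theta_log_q))"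
  proof -
    have "(E4 ^ 3 - E6 ^ 2) * (E6 ^ 3 * (108 * ?c2 + 46 * theta_log_q)) =
      (E4 ^ 3 - E6 ^ 2) * (18 * (6 * (E6 ^ 3 * ?c2)) + 46 * E6 ^ 2 * (E6 * theta_log_q))"
      by (simp only: algebra_simps eval_nat_numeral) (simp add: algebra_simps)
    then show ?thesis unfolding c3 c2 theta_log_q_eq theta3_log_q_eq theta2_log_q_eq weight_quot1_eq weight_quot2_eq
      by (simp add: algebra_simps eval_nat_numeral)
  qed
  from J_inv_clear[OF this] have c: "?c3 = 24 * J_inv * (72 * ?c3 + (108 * ?c2 + 46 * theta_log_q))" .
  have t1: "theta_J (weight_1 * U) = weight_1 * (weight_quot1 * U + theta_log_q - 1)"
    by (simp add: theta_J_simps theta_weight_1 U algebra_simps)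
  have t2: "theta_J (theta_J (weight_1 * U)) = weight_1 * (weight_quot2 * U + ?c2 - 2 * weight_quot1)"
    unfolding t1 by (simp add: theta_J_simps theta_weight_1 U weight_quot2_def algebra_simps)
  have t3: "theta_J (theta_J (theta_J (weight_1 * U))) = weight_1 * (weight_quot3 * U + ?c3 - 3 * weight_quot2)"
    unfolding t2 by (simp add: theta_J_simps theta_weight_1 U weight_quot2_def weight_quot3_def algebra_simps)
  have "hyp_op (weight_1 * U) + hyp_op' weight_1 =
     U * hyp_op weight_1 + weight_1 * (?c3 - 24 * J_inv * (72 * ?c3 + (108 * ?c2 + 46 * theta_log_q)))"
    unfolding hyp_op_def hyp_op'_def t3 theta3_weight_1 unfolding t2 theta2_weight_1 unfolding t1 theta_weight_1
    by (simp add: algebra_simps)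
  then show ?thesis using c hyp_op_weight_1 by simp
qed

lemma E_power_nth: "fps_nth (E4 ^ 3) 0 = 1" "fps_nth (E6 ^ 2) 0 = 1" "fps_nth (E4 ^ 3) 1 = 720" "fps_nth (E6 ^ 2) 1 = - 1008"
proof -
  have "sigma k (Suc 0) = 1" for k
    by (simp add: sigma_def divisor_sum_def)
  then have e: "fps_nth E4 1 = 240" "fps_nth E6 1 = - 504"
    by (simp_all add: E4_def E6_def fps_numeral_mult_nth sigma_fps_nth)
  show "fps_nth (E4 ^ 3) 0 = 1" "fps_nth (E6 ^ 2) 0 = 1"
    by (simp_all add: power3_eq_cube power2_eq_square E_nth_0)
  show "fps_nth (E4 ^ 3) 1 = 720" "fps_nth (E6 ^ 2) 1 = - 1008"
    unfolding power3_eq_cube power2_eq_square fps_mult_nth_1 fps_mult_nth_0 E_nth_0 e by simp_all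
qed

lemma J_inv_nth_0: "fps_nth J_inv 0 = 0"
  unfolding J_inv_def fps_mult_nth_0 fps_sub_nth E_power_nth by simp

lemma J_inv_nth_1: "fps_nth J_inv 1 = 1"
proof -
  have "fps_nth (1728 * (J_inv * E4 ^ 3)) 1 = 1728 * (fps_nth J_inv 0 * 720 + fps_nth J_inv 1 * 1)"
    by (simp only: fps_numeral_mult_nth[of _ "J_inv * E4 ^ 3"] fps_mult_nth_1[of J_inv] E_power_nth)
  moreover have "fps_nth (E4 ^ 3 - E6 ^ 2) 1 = 720 - (- 1008)" by (simp only: fps_sub_nth E_power_nth)
  moreover have "1728 * (J_inv * E4 ^ 3) = E4 ^ 3 - E6 ^ 2" by (simp only: J_inv_eq[symmetric] mult.assoc)
  ultimately have "1728 * (fps_nth J_inv 0 * 720 + fps_nth J_inv 1 * 1) = 720 - (- 1008)" by metis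
  then have "1728 * fps_nth J_inv 1 = 1728 * 1" unfolding J_inv_nth_0 by (simp only: mult_zero_left add_0_left mult_1_right) simp
  then show ?thesis by (subst (asm) mult_left_cancel) simp
qed

lemma theta_J_compose: "theta_J (f oo J_inv) = euler_deriv f oo J_inv"
proof -
  have "E4 * (E6 * theta_J (f oo J_inv)) = E4 * E4 * (fps_X * ((fps_deriv f oo J_inv) * fps_deriv J_inv))"
    unfolding theta_J_eq by (simp add: euler_deriv_def fps_compose_deriv J_inv_nth_0)
  also have "\<dots> = E4 * (fps_deriv f oo J_inv) * (euler_deriv J_inv * E4)"
    by (simp add: euler_deriv_def mult_ac)
  also have "\<dots> = E4 * (E6 * ((fps_deriv f oo J_inv) * J_inv))"
    unfolding J_inv_deriv by (simp add: mult_ac)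
  finally have "theta_J (f oo J_inv) = (fps_deriv f oo J_inv) * J_inv"
    using E4_nonzero E6_nonzero by simp
  also have "\<dots> = euler_deriv f oo J_inv"
    by (simp add: euler_deriv_def fps_compose_mult_distrib J_inv_nth_0 mult.commute)
  finally show ?thesis .
qed

section \<open>The equation in the variable z = 1/j and Frobenius' method\<close>

definition hyp_z :: "complex fps \<Rightarrow> complex fps" where
  "hyp_z f = euler_deriv (euler_deriv (euler_deriv f)) - 24 * fps_X *
     (72 * euler_deriv (euler_deriv (euler_deriv f)) + 108 * euler_deriv (euler_deriv f) + 46 * euler_deriv f + 5 * f)"

definition hyp_z' :: "complex fps \<Rightarrow> complex fps" where
  "hyp_z' f = 3 * euler_deriv (euler_deriv f) -
     24 * fps_X * (216 * euler_deriv (euler_deriv f) + 216 * euler_deriv f + 46 * f)"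

lemma fps_numeral_compose: "(numeral k :: complex fps) oo g = numeral k"
  by (simp add: numeral_fps_const)

lemmas fps_compose_simps = fps_compose_add_distrib fps_compose_sub_distrib
  fps_compose_mult_distrib[OF J_inv_nth_0] fps_numeral_compose

lemma hyp_op_compose: "hyp_op (f oo J_inv) = hyp_z f oo J_inv" "hyp_op' (f oo J_inv) = hyp_z' f oo J_inv"
  unfolding hyp_op_def hyp_z_def hyp_op'_def hyp_z'_def theta_J_compose fps_compose_simps
  by (simp_all add: J_inv_nth_0)

lemma fps_inv_J_inv_nth_0: "fps_nth (fps_inv J_inv) 0 = 0"
  by (simp add: fps_inv_def)

lemma J_inv_fps_inv: "J_inv oo fps_inv J_inv = fps_X" "fps_inv J_inv oo J_inv = fps_X"
  by (rule fps_inv_right fps_inv; use J_inv_nth_0 J_inv_nth_1 in simp)+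

lemma J_inv_compose_cancel:
  assumes "f oo J_inv = g oo J_inv"
  shows "f = g"
proof -
  have h: "h = (h oo J_inv) oo fps_inv J_inv" for h
    by (subst fps_compose_assoc[symmetric]) (simp_all only: J_inv_nth_0 fps_inv_J_inv_nth_0 J_inv_fps_inv fps_compose_fps_X)
  show ?thesis
    by (rule trans[OF h[of f, unfolded assms] h[of g, symmetric]])
qed

lemma compose_J_inv_surj: "\<exists>f. u = f oo J_inv"
proof
  show "u = (u oo fps_inv J_inv) oo J_inv"
    by (subst fps_compose_assoc[symmetric]) (simp_all only: J_inv_nth_0 fps_inv_J_inv_nth_0 J_inv_fps_inv fps_compose_fps_X)
qed

lemma hyp_z_nth:
  "fps_nth (hyp_z f) (Suc n) = of_nat (Suc n) ^ 3 * fps_nth f (Suc n) -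
     24 * (2 * of_nat n + 1) * (6 * of_nat n + 1) * (6 * of_nat n + 5) * fps_nth f n"
  "fps_nth (hyp_z' f) (Suc n) = 3 * of_nat (Suc n) ^ 2 * fps_nth f (Suc n) -
     24 * (216 * of_nat n ^ 2 + 216 * of_nat n + 46) * fps_nth f n"
  by (simp_all add: hyp_z_def hyp_z'_def fps_numeral_mult_nth mult.assoc euler_deriv_nth fps_X_mult_nth)
     (simp_all add: algebra_simps eval_nat_numeral)

lemma hyp_z_nth_0: "fps_nth (hyp_z f) 0 = 0" "fps_nth (hyp_z' f) 0 = 0"
  by (simp_all add: hyp_z_def hyp_z'_def fps_numeral_mult_nth mult.assoc euler_deriv_nth)

lemma hyp_z_diff: "hyp_z (f - g) = hyp_z f - hyp_z g"
  by (simp add: hyp_z_def euler_deriv_simps algebra_simps)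

text \<open>The indicial polynomial n^3 has no positive root, so a power series solution is
  determined by its constant term.\<close>

lemma hyp_z_unique:
  assumes "hyp_z f = hyp_z g" "fps_nth f 0 = fps_nth g 0"
  shows "f = g"
proof -
  define h where "h = f - g"
  have h: "hyp_z h = 0" "fps_nth h 0 = 0"
    using assms by (simp_all add: h_def hyp_z_diff)
  have "fps_nth h n = 0" for n
  proof (induction n)
    case (Suc n)
    have "fps_nth (hyp_z h) (Suc n) = 0" using h(1) by simp
    then have "(of_nat (Suc n) :: complex) ^ 3 * fps_nth h (Suc n) = 0"
      unfolding hyp_z_nth Suc by simp
    then show ?case by (simp del: of_nat_Suc)
  qed (rule h(2))
  then have "h = 0" by (simp add: fps_eq_iff)
  then show ?thesis by (simp add: h_def)
qed

text \<open>
  Frobenius' method: $\sum_n f_n(\epsilon) z^{n+\epsilon}$, with $f_n$ as below, solves the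
  hypergeometric equation modulo $\epsilon^3$.
\<close>
definition frobenius :: "nat \<Rightarrow> complex \<Rightarrow> complex" where
  "frobenius n x = (\<Prod>j = 1..n. 24 * (2 * x + 2 * of_nat j - 1) * (6 * x + 6 * of_nat j - 5) * (6 * x + 6 * of_nat j - 1) /
     (x + of_nat j) ^ 3)"

definition "frob0 n = frobenius n 0"
definition "frob1 n = deriv (frobenius n) 0"

lemma frobenius_holomorphic: "frobenius n holomorphic_on ball 0 1"
  unfolding frobenius_def
proof (intro holomorphic_intros)
  fix j x assume "j \<in> {1..n}" "x \<in> ball (0 :: complex) 1"
  show "(x + of_nat j) ^ 3 \<noteq> 0"
  proof
    assume "(x + of_nat j) ^ 3 = 0"
    then have "x = - of_nat j" by (simp add: add_eq_0_iff2)
    with \<open>x \<in> _\<close> have "real j < 1" by simp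
    with \<open>j \<in> _\<close> show False by simp
  qed
qed

lemma frobenius_deriv: "(frobenius n has_field_derivative frob1 n) (at 0)"
  unfolding frob1_def using frobenius_holomorphic
  by (intro holomorphic_derivI[of _ "ball 0 1"]) auto

lemma frobenius_Suc:
  assumes "x + of_nat (Suc n) \<noteq> 0"
  shows "(x + of_nat (Suc n)) ^ 3 * frobenius (Suc n) x =
     24 * (2 * x + 2 * of_nat n + 1) * (6 * x + 6 * of_nat n + 1) * (6 * x + 6 * of_nat n + 5) * frobenius n x"
proof -
  let ?t = "24 * (2 * x + 2 * of_nat (Suc n) - 1) * (6 * x + 6 * of_nat (Suc n) - 5) * (6 * x + 6 * of_nat (Suc n) - 1)"
  have "frobenius (Suc n) x = frobenius n x * (?t / (x + of_nat (Suc n)) ^ 3)"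
    unfolding frobenius_def by (subst prod.nat_ivl_Suc') (simp_all add: mult.commute)
  then have "(x + of_nat (Suc n)) ^ 3 * frobenius (Suc n) x = ?t * frobenius n x"
    using assms by (simp del: of_nat_Suc)
  also have "?t = 24 * (2 * x + 2 * of_nat n + 1) * (6 * x + 6 * of_nat n + 1) * (6 * x + 6 * of_nat n + 5)"
    by (simp add: algebra_simps)
  finally show ?thesis .
qed

text \<open>The second identity is the derivative of \<open>frobenius_Suc\<close> at 0, the
  first-order part in epsilon of Frobenius' recursion.\<close>

lemma frob_Suc:
  "of_nat (Suc n) ^ 3 * frob0 (Suc n) = 24 * (2 * of_nat n + 1) * (6 * of_nat n + 1) * (6 * of_nat n + 5) * frob0 n" (is ?A)
  "of_nat (Suc n) ^ 3 * frob1 (Suc n) + 3 * of_nat (Suc n) ^ 2 * frob0 (Suc n) =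
     24 * (2 * of_nat n + 1) * (6 * of_nat n + 1) * (6 * of_nat n + 5) * frob1 n +
     24 * (216 * of_nat n ^ 2 + 216 * of_nat n + 46) * frob0 n" (is ?B)
proof -
  show ?A using frobenius_Suc[of 0 n] by (simp add: frob0_def del: of_nat_Suc)
  let ?p = "\<lambda>x :: complex. (x + of_nat (Suc n)) ^ 3"
  let ?r = "\<lambda>x :: complex. 24 * (2 * x + 2 * of_nat n + 1) * (6 * x + 6 * of_nat n + 1) * (6 * x + 6 * of_nat n + 5)"
  have p: "(?p has_field_derivative 3 * of_nat (Suc n) ^ 2) (at 0)"
    by (auto intro!: derivative_eq_intros)
  have r: "(?r has_field_derivative 24 * (216 * of_nat n ^ 2 + 216 * of_nat n + 46)) (at 0)"
    by (auto intro!: derivative_eq_intros simp: algebra_simps power2_eq_square)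
  have ev: "eventually (\<lambda>x. ?p x * frobenius (Suc n) x = ?r x * frobenius n x) (nhds 0)"
  proof (rule eventually_nhds_in_open[of "ball 0 1", THEN eventually_mono])
    fix x :: complex assume x: "x \<in> ball 0 1"
    have "x + of_nat (Suc n) \<noteq> 0"
    proof
      assume "x + of_nat (Suc n) = 0"
      then have "x = - of_nat (Suc n)" by (simp add: add_eq_0_iff2)
      then have "norm x = real (Suc n)" by (simp only: norm_minus_cancel norm_of_nat)
      with x show False by simp
    qed
    then show "?p x * frobenius (Suc n) x = ?r x * frobenius n x" by (rule frobenius_Suc)
  qed auto
  have l': "((\<lambda>x. ?p x * frobenius (Suc n) x) has_field_derivative
      3 * of_nat (Suc n) ^ 2 * frobenius (Suc n) 0 + frob1 (Suc n) * ?p 0) (at 0)"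
    by (rule DERIV_mult[OF p frobenius_deriv])
  have r': "((\<lambda>x. ?r x * frobenius n x) has_field_derivative
      24 * (216 * of_nat n ^ 2 + 216 * of_nat n + 46) * frobenius n 0 + frob1 n * ?r 0) (at 0)"
    by (rule DERIV_mult[OF r frobenius_deriv])
  from r' have "((\<lambda>x. ?p x * frobenius (Suc n) x) has_field_derivative
      24 * (216 * of_nat n ^ 2 + 216 * of_nat n + 46) * frobenius n 0 + frob1 n * ?r 0) (at 0)"
    using DERIV_cong_ev[OF refl ev refl] by blast
  from DERIV_unique[OF l' this] show ?B
    by (simp add: frob0_def mult.commute add.commute del: of_nat_Suc)
qed

lemma frob_0: "frob0 0 = 1" "frob1 0 = 0"
proof -
  have "frobenius 0 = (\<lambda>_. 1)" by (simp add: frobenius_def fun_eq_iff)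
  then show "frob0 0 = 1" "frob1 0 = 0" by (simp_all add: frob0_def frob1_def)
qed

lemma hyp_z_frob0: "hyp_z (Abs_fps frob0) = 0"
proof (rule fps_ext)
  fix n show "fps_nth (hyp_z (Abs_fps frob0)) n = fps_nth 0 n"
    by (cases n) (simp_all only: hyp_z_nth_0 hyp_z_nth fps_nth_Abs_fps frob_Suc(1), simp_all)
qed

text \<open>Equivalently, log z times the series of \<open>frob0\<close> plus the series of
  \<open>frob1\<close> is formally a solution.\<close>

lemma hyp_z_frob1: "hyp_z (Abs_fps frob1) = - hyp_z' (Abs_fps frob0)"
proof (rule fps_ext)
  fix n show "fps_nth (hyp_z (Abs_fps frob1)) n = fps_nth (- hyp_z' (Abs_fps frob0)) n"
  proof (cases n)
    case (Suc m)
    have "a - c = - (b - d)" if "a + b = c + d" for a b c d :: complex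
      using that by (simp add: algebra_simps)
    from this[OF frob_Suc(2)[of m]] show ?thesis
      unfolding Suc fps_neg_nth hyp_z_nth fps_nth_Abs_fps .
  qed (simp add: hyp_z_nth_0)
qed

lemma weight_1_eq: "weight_1 = Abs_fps frob0 oo J_inv"
proof -
  obtain f where f: "weight_1 = f oo J_inv" using compose_J_inv_surj by blast
  have "hyp_z f oo J_inv = 0 oo J_inv"
    unfolding hyp_op_compose(1)[symmetric] f[symmetric] hyp_op_weight_1 by simp
  then have 1: "hyp_z f = 0" by (rule J_inv_compose_cancel)
  have 2: "fps_nth f 0 = 1" using weight_1_nth_0 unfolding f fps_compose_nth_0 .
  have "f = Abs_fps frob0"
    by (rule hyp_z_unique) (simp_all only: 1 2 hyp_z_frob0 fps_nth_Abs_fps frob_0)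
  with f show ?thesis by (simp only:)
qed

text \<open>Here w stands for log(q/z) in powers of z. By \<open>hyp_op_weight_1_log\<close> and
  \<open>hyp_z_frob1\<close> both sides satisfy the same inhomogeneous equation, and both have
  constant term 0.\<close>

lemma log_series_eq:
  assumes "euler_deriv (w oo J_inv) * E4 = E4 - E6" "fps_nth w 0 = 0"
  shows "Abs_fps frob0 * w = Abs_fps frob1"
proof (rule hyp_z_unique)
  have "weight_1 * (w oo J_inv) = (Abs_fps frob0 * w) oo J_inv"
    by (simp only: weight_1_eq fps_compose_mult_distrib[OF J_inv_nth_0])
  then have "(hyp_z (Abs_fps frob0 * w) + hyp_z' (Abs_fps frob0)) oo J_inv = 0 oo J_inv"
    using hyp_op_weight_1_log[OF assms(1)]
    by (simp only: weight_1_eq hyp_op_compose fps_compose_add_distrib fps_compose_0)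
  then have "hyp_z (Abs_fps frob0 * w) + hyp_z' (Abs_fps frob0) = 0" by (rule J_inv_compose_cancel)
  then show "hyp_z (Abs_fps frob0 * w) = hyp_z (Abs_fps frob1)"
    unfolding hyp_z_frob1 by (rule eq_neg_iff_add_eq_0[THEN iffD2])
  show "fps_nth (Abs_fps frob0 * w) 0 = fps_nth (Abs_fps frob1) 0"
    by (simp only: fps_mult_nth_0 assms(2) fps_nth_Abs_fps frob_0 mult_zero_right)
qed

section \<open>The inverse of the expansion of $j$\<close>

definition log_series :: "complex fps" where
  "log_series = fps_ln 1 oo (fps_shift 1 (fps_inv J_inv) - 1)"

text \<open>\<open>G\<close> is q/X as a series in X = 1/j and \<open>M\<close> is q/J as a series
  in q. So \<open>log_series oo J_inv\<close> is log(q/J), whose derivative under q d/dq is 1 -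
  E6/E4 by \<open>J_inv_deriv\<close>.\<close>

lemma log_series_deriv: "euler_deriv (log_series oo J_inv) * E4 = E4 - E6"
proof -
  define G where "G = fps_shift 1 (fps_inv J_inv)"
  define M where "M = G oo J_inv"
  have V0: "fps_nth (fps_inv J_inv) 0 = 0" by (simp add: fps_inv_def)
  have "fps_X * G = fps_inv J_inv"
    unfolding G_def by (rule fps_ext) (auto simp: fps_X_mult_nth V0)
  then have "(fps_X * G) oo J_inv = fps_X"
    by (simp add: fps_inv J_inv_nth_0 J_inv_nth_1[simplified])
  then have JM: "J_inv * M = fps_X"
    by (simp add: fps_compose_mult_distrib J_inv_nth_0 M_def)
  have "fps_nth (J_inv * M) 1 = 1" unfolding JM by simp
  then have M0: "fps_nth M 0 = 1" by (simp add: fps_mult_nth_1 J_inv_nth_0 J_inv_nth_1[simplified])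
  then have G0: "fps_nth G 0 = 1" by (simp add: M_def)
  have L: "log_series oo J_inv = fps_ln 1 oo (M - 1)"
    unfolding log_series_def G_def[symmetric] M_def
    by (subst fps_compose_assoc[symmetric]) (simp_all add: J_inv_nth_0 G0 fps_compose_sub_distrib)
  have "fps_deriv (log_series oo J_inv) = (inverse (1 + fps_X) oo (M - 1)) * fps_deriv M"
    unfolding L by (subst fps_compose_deriv) (simp_all add: M0 fps_ln_deriv)
  also have "inverse (1 + fps_X) oo (M - 1) = inverse M"
    by (subst fps_inverse_compose) (simp_all add: M0 fps_compose_add_distrib)
  finally have "M * euler_deriv (log_series oo J_inv) = (inverse M * M) * euler_deriv M"
    by (simp add: euler_deriv_def mult_ac)
  also have "inverse M * M = 1" by (simp add: inverse_mult_eq_1 M0)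
  finally have 1: "M * euler_deriv (log_series oo J_inv) = euler_deriv M" by simp
  have "euler_deriv J_inv * M + J_inv * euler_deriv M = J_inv * M"
    using arg_cong[OF JM, of euler_deriv] unfolding euler_deriv_simps(3) unfolding JM
    by (simp add: euler_deriv_def[of fps_X])
  then have "M * (euler_deriv J_inv + J_inv * euler_deriv (log_series oo J_inv)) = M * J_inv"
    unfolding 1[symmetric] by (simp add: algebra_simps)
  moreover have "M \<noteq> 0" using M0 by auto
  ultimately have "(euler_deriv J_inv + J_inv * euler_deriv (log_series oo J_inv)) * E4 = J_inv * E4"
    by simp
  then have "J_inv * (E6 + euler_deriv (log_series oo J_inv) * E4) = J_inv * E4"
    unfolding distrib_right J_inv_deriv by (simp add: algebra_simps)
  moreover have "J_inv \<noteq> 0" using J_inv_nth_1 by auto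
  ultimately have "E6 + euler_deriv (log_series oo J_inv) * E4 = E4" by simp
  then show ?thesis by (simp add: algebra_simps)
qed

lemma frob_log_series: "(\<Sum>k\<in>{0..d}. frob0 k * fps_nth log_series (d - k)) = frob1 d"
proof -
  have "Abs_fps frob0 * log_series = Abs_fps frob1"
    by (rule log_series_eq[OF log_series_deriv]) (simp add: log_series_def)
  from arg_cong[OF this, of "\<lambda>f. fps_nth f d"] show ?thesis
    by (simp add: fps_mult_nth)
qed

section \<open>Convergence and the Laurent expansion of j\<close>

lemma sigma_summable: "fps_conv_radius (sigma_fps k) > 0"
proof -
  \<comment> \<open>For n > 0, sigma_k(n) <= n^(k+1) <= 2^(n(k+1)), so at this radius the terms are
    bounded by 2^(-n). Any positive radius suffices for the expansion at q = 0.\<close>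
  define z :: complex where "z = of_real ((1 / 2) ^ (k + 2))"
  have "summable (\<lambda>n. fps_nth (sigma_fps k) n * z ^ n)"
  proof (rule summable_comparison_test'[where N = 0])
    show "summable (\<lambda>n. (1 / 2 :: real) ^ n)" by (rule summable_geometric) simp
    fix n
    have "divisor_sum k n \<le> n ^ (k + 1)" if "n > 0"
    proof -
      have "divisor_sum k n \<le> (\<Sum>e | e dvd n. n ^ k)"
        unfolding divisor_sum_def using that by (intro sum_mono power_mono) (auto dest: dvd_imp_le)
      also have "\<dots> \<le> n * n ^ k"
      proof -
        have "{e. e dvd n} \<subseteq> {1..n}"
          using that by (auto simp: Suc_le_eq dvd_imp_le intro: dvd_pos_nat)
        then have "card {e. e dvd n} \<le> n" using card_mono[of "{1..n}"] by fastforce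
        then show ?thesis by simp
      qed
      finally show ?thesis by simp
    qed
    also have "n ^ (k + 1) \<le> (2 ^ n) ^ (k + 1)"
      using less_exp[of n] by (intro power_mono) auto
    finally have *: "divisor_sum k n \<le> 2 ^ (n * (k + 1))" if "n > 0"
      using that by (simp only: power_mult)
    have "norm (fps_nth (sigma_fps k) n * z ^ n) \<le> 2 ^ (n * (k + 1)) * ((1 / 2) ^ (k + 2)) ^ n"
    proof (cases "n = 0")
      case False
      then have "real (divisor_sum k n) \<le> real (2 ^ (n * (k + 1)))"
        using * by (simp only: of_nat_le_iff)
      then have "real (divisor_sum k n) * norm (z ^ n) \<le> 2 ^ (n * (k + 1)) * norm (z ^ n)"
        by (intro mult_right_mono) simp_all
      moreover have "norm (z ^ n) = ((1 / 2) ^ (k + 2)) ^ n"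
        unfolding z_def norm_power norm_of_real by simp
      ultimately show ?thesis using False
        by (simp only: sigma_fps_nth sigma_def norm_mult norm_of_nat if_False)
    qed (simp add: sigma_fps_nth)
    also have "\<dots> = (2 ^ (k + 1) * (1 / 2) ^ (k + 2)) ^ n"
      unfolding power_mult_distrib power_mult[symmetric] by (simp only: mult.commute)
    also have "2 ^ (k + 1) * (1 / 2) ^ (k + 2) = (1 / 2 :: real)"
      by (simp add: power_divide)
    finally show "norm (fps_nth (sigma_fps k) n * z ^ n) \<le> (1 / 2) ^ n" .
  qed
  then have "fps_conv_radius (sigma_fps k) \<ge> norm z"
    unfolding fps_conv_radius_def by (rule conv_radius_geI)
  moreover have "ereal (norm z) > 0" by (simp add: z_def)
  ultimately show ?thesis by (rule less_le_trans[rotated])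
qed

lemma suminf_sigma:
  assumes "ereal (norm u) < fps_conv_radius (sigma_fps k)"
  shows "suminf (\<lambda>n. of_nat (divisor_sum k (Suc n)) * u ^ Suc n) = eval_fps (sigma_fps k) u"
proof -
  have "summable (\<lambda>n. fps_nth (sigma_fps k) n * u ^ n)"
    using assms by (rule summable_fps)
  from suminf_split_head[OF this] show ?thesis
    by (simp add: eval_fps_def sigma_fps_nth sigma_def)
qed

lemma j_expansion_eq: "j_expansion = fps_to_fls (1728 * E4 ^ 3) / fps_to_fls (E4 ^ 3 - E6 ^ 2)"
proof -
  let ?A = "\<lambda>u. 1 + 240 * eval_fps (sigma_fps 3) u" and ?B = "\<lambda>u. 1 - 504 * eval_fps (sigma_fps 5) u"
  have A: "?A has_fps_expansion E4" and B: "?B has_fps_expansion E6"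
    unfolding E4_def E6_def
    by (intro fps_expansion_intros eval_fps_has_fps_expansion sigma_summable)+
  have "(\<lambda>u. (1728 * ?A u ^ 3) / (?A u ^ 3 - ?B u ^ 2)) has_laurent_expansion
      fps_to_fls (1728 * E4 ^ 3) / fps_to_fls (E4 ^ 3 - E6 ^ 2)"
    by (intro has_laurent_expansion_divide has_laurent_expansion_fps fps_expansion_intros A B)
  also have "?this \<longleftrightarrow> (\<lambda>q. modular_j (Ln (0 + q) / (2 * of_real pi * \<i>))) has_laurent_expansion
      fps_to_fls (1728 * E4 ^ 3) / fps_to_fls (E4 ^ 3 - E6 ^ 2)"
  proof (rule has_laurent_expansion_cong)
    have ev: "eventually (\<lambda>u. u \<in> eball 0 (fps_conv_radius (sigma_fps k))) (at 0)" for k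
      by (rule eventually_at_in_open') (auto simp: sigma_summable zero_ereal_def[symmetric])
    show "\<forall>\<^sub>F u in at 0. (1728 * ?A u ^ 3) / (?A u ^ 3 - ?B u ^ 2) = modular_j (Ln (0 + u) / (2 * of_real pi * \<i>))"
      using ev[of 3] ev[of 5] eventually_neq_at_within[of 0]
    proof eventually_elim
      case (elim u)
      \<comment> \<open>The branch of the logarithm is undone by the exponential, so the agreement
        holds on a full punctured neighbourhood of 0.\<close>
      have "nome (Ln u / (2 * of_real pi * \<i>)) = u" using elim by (simp add: nome_def)
      then have "eisenstein4 (Ln u / (2 * of_real pi * \<i>)) = ?A u" "eisenstein6 (Ln u / (2 * of_real pi * \<i>)) = ?B u"
        using elim unfolding eisenstein4_def eisenstein6_def by (simp_all add: suminf_sigma in_eball_iff del: power_Suc)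
      then show ?case by (simp add: modular_j_def)
    qed
  qed simp
  finally show ?thesis unfolding j_expansion_def by (rule laurent_expansion_eqI)
qed

lemma inverse_j_expansion: "inverse j_expansion = fps_to_fls J_inv"
proof -
  have "fps_to_fls (1728 * E4 ^ 3) * fps_to_fls J_inv = fps_to_fls (E4 ^ 3 - E6 ^ 2)"
    unfolding fls_times_fps_to_fls[symmetric] J_inv_eq[symmetric] by (simp add: mult_ac)
  moreover have "fps_to_fls (1728 * E4 ^ 3) \<noteq> 0" using E4_nonzero by simp
  ultimately show ?thesis
    unfolding j_expansion_eq inverse_divide by (metis nonzero_mult_div_cancel_left)
qed

theorem w_coeff_recursion: "(\<Sum>k\<in>{0..d}. frob0 k * w_coeff (d - k)) = frob1 d"
proof -
  have "w_series = log_series"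
    unfolding w_series_def log_series_def q_in_inverse_j_def inverse_j_expansion by simp
  then show ?thesis using frob_log_series by (simp add: w_coeff_def)
qed

section \<open>Means over tori\<close>

text \<open>Total mass 1, so products are probability measures and constants are their own
  means.\<close>

definition circ :: "real measure" where
  "circ = restrict_space lborel {0..1}"

text \<open>This is the contour integral of f(z) dz / (2 pi i z). A residue thus appears as the mean
  of z times the integrand.\<close>

definition circle_mean :: "real \<Rightarrow> (complex \<Rightarrow> complex) \<Rightarrow> complex" where
  "circle_mean r f = (\<integral>t. f (of_real r * cis (2 * pi * t)) \<partial>circ)"

lemma emeasure_circ: "emeasure circ (space circ) = 1"
  by (simp add: circ_def space_restrict_space emeasure_restrict_space)

lemma finite_measure_circ: "finite_measure circ"
  by standard (simp add: emeasure_circ)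

lemma circle_mean_cong:
  assumes "r \<ge> 0" "\<And>z. norm z = r \<Longrightarrow> f z = g z"
  shows "circle_mean r f = circle_mean r g"
  unfolding circle_mean_def
  by (intro Bochner_Integration.integral_cong refl assms(2)) (use assms(1) in \<open>simp add: norm_mult\<close>)

lemma circle_mean_cmult: "circle_mean r (\<lambda>z. c * f z) = c * circle_mean r f"
  unfolding circle_mean_def by simp

lemma circle_mean_contour:
  assumes "(g has_contour_integral I) (circlepath 0 r)" "continuous_on (sphere 0 r) g" "r > 0"
  shows "circle_mean r (\<lambda>z. z * g z) = I / (2 * of_real pi * \<i>)"
proof -
  define G where "G t = (2 * of_real pi * \<i>) * (of_real r * cis (2 * pi * t) * g (of_real r * cis (2 * pi * t)))" for t
  have e: "exp (2 * of_real pi * \<i> * of_real t) = cis (2 * pi * t)" for t :: real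
    by (simp add: cis_conv_exp mult_ac)
  have "((\<lambda>t. g (circlepath 0 r t) * vector_derivative (circlepath 0 r) (at t within {0..1})) has_integral I) {0..1}"
    using assms(1) unfolding has_contour_integral_def .
  then have "(G has_integral I) {0..1}"
  proof (rule has_integral_cong[THEN iffD1, rotated])
    fix t :: real assume "t \<in> {0..1}"
    then have "vector_derivative (circlepath 0 r) (at t within {0..1}) = 2 * of_real pi * \<i> * of_real r * cis (2 * pi * t)"
      using vector_derivative_circlepath01[of t 0 r] by (simp add: e)
    moreover have "circlepath 0 r t = of_real r * cis (2 * pi * t)" by (simp add: circlepath e)
    ultimately show "g (circlepath 0 r t) * vector_derivative (circlepath 0 r) (at t within {0..1}) = G t"
      by (simp only: G_def mult_ac)
  qed
  moreover have cont: "continuous_on {0..1} G"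
    unfolding G_def
    by (intro continuous_intros continuous_on_compose2[OF assms(2)]) (use \<open>r > 0\<close> in \<open>auto simp: norm_mult\<close>)
  ultimately have "(LBINT t:{0..1}. G t) = I"
    using set_borel_integral_eq_integral(2)[OF borel_integrable_atLeastAtMost'[OF cont]] by (simp add: integral_unique)
  then have "(\<integral>t. G t \<partial>circ) = I"
    by (simp add: circ_def integral_restrict_space set_lebesgue_integral_def)
  then have "2 * of_real pi * \<i> * circle_mean r (\<lambda>z. z * g z) = I"
    unfolding circle_mean_def G_def by simp
  then show ?thesis by (simp add: field_simps)
qed

lemma circle_mean_cauchy:
  assumes "f holomorphic_on cball 0 r" "norm w < r"
  shows "circle_mean r (\<lambda>z. f z * (z / (z - w))) = f w"
proof -
  have "((\<lambda>u. f u / (u - w)) has_contour_integral 2 * of_real pi * \<i> * f w) (circlepath 0 r)"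
    by (rule Cauchy_integral_circlepath_simple) (use assms in auto)
  moreover have "continuous_on (sphere 0 r) (\<lambda>u. f u / (u - w))"
    by (intro continuous_intros holomorphic_on_imp_continuous_on[OF holomorphic_on_subset[OF assms(1)]])
       (use assms(2) in auto)
  ultimately have "circle_mean r (\<lambda>z. z * (f z / (z - w))) = 2 * of_real pi * \<i> * f w / (2 * of_real pi * \<i>)"
    using assms(2) norm_ge_zero[of w] by (intro circle_mean_contour) linarith+
  then show ?thesis by (simp add: mult_ac)
qed

lemma circle_mean_0:
  assumes "f holomorphic_on cball 0 r" "0 < r"
  shows "circle_mean r f = f 0"
proof -
  have "circle_mean r f = circle_mean r (\<lambda>z. f z * (z / (z - 0)))"
    by (rule circle_mean_cong) (use assms(2) in auto)
  also have "\<dots> = f 0" by (rule circle_mean_cauchy) (use assms in auto)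
  finally show ?thesis .
qed

lemma circle_mean_deriv:
  assumes "f holomorphic_on cball 0 r" "0 < r"
  shows "circle_mean r (\<lambda>z. f z / z) = deriv f 0"
proof -
  have cont: "continuous_on (cball 0 r) f" by (rule holomorphic_on_imp_continuous_on[OF assms(1)])
  have hol: "f holomorphic_on ball 0 r" by (rule holomorphic_on_subset[OF assms(1)]) auto
  note d = Cauchy_derivative_integral_circlepath[OF cont hol, of 0]
  have "((\<lambda>u. f u / (u - 0)\<^sup>2) has_contour_integral contour_integral (circlepath 0 r) (\<lambda>u. f u / (u - 0)\<^sup>2)) (circlepath 0 r)"
    using d(1) assms(2) by (simp add: has_contour_integral_integral)
  then have "circle_mean r (\<lambda>z. z * (f z / (z - 0)\<^sup>2)) = contour_integral (circlepath 0 r) (\<lambda>u. f u / (u - 0)\<^sup>2) / (2 * of_real pi * \<i>)"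
    by (rule circle_mean_contour)
       (use assms(2) in \<open>auto intro!: continuous_intros continuous_on_subset[OF cont]\<close>)
  moreover have "deriv f 0 = contour_integral (circlepath 0 r) (\<lambda>u. f u / (u - 0)\<^sup>2) / (2 * of_real pi * \<i>)"
    using DERIV_imp_deriv[OF d(2)] assms(2) by simp
  moreover have "circle_mean r (\<lambda>z. z * (f z / (z - 0)\<^sup>2)) = circle_mean r (\<lambda>z. f z / z)"
    by (rule circle_mean_cong) (use assms(2) in \<open>auto simp: power2_eq_square\<close>)
  ultimately show ?thesis by simp
qed

lemma circle_mean_inverse:
  assumes "r > 0"
  shows "circle_mean r (\<lambda>z. f (1 / z)) = circle_mean (1 / r) f"
proof -
  define h where "h t = indicator {0..1} t *\<^sub>R f (of_real (1 / r) * cis (2 * pi * t))" for t :: real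
  have "1 / (of_real r * cis (2 * pi * t)) = of_real (1 / r) * cis (2 * pi * (1 - t))" for t
  proof -
    have "cis (2 * pi * (1 - t)) = cis (2 * pi) * inverse (cis (2 * pi * t))"
      by (simp only: cis_inverse cis_mult) (simp add: algebra_simps)
    then have "cis (2 * pi * (1 - t)) = 1 / cis (2 * pi * t)"
      by (simp only: cis_2pi mult_1_left inverse_eq_divide)
    then show ?thesis by simp
  qed
  then have "circle_mean r (\<lambda>z. f (1 / z)) = (\<integral>t. indicator {0..1} t *\<^sub>R f (of_real (1 / r) * cis (2 * pi * (1 - t))) \<partial>lborel)"
    by (simp add: circle_mean_def circ_def integral_restrict_space set_lebesgue_integral_def)
  also have "\<dots> = (\<integral>t. h (1 + (- 1) * t) \<partial>lborel)"
    by (intro Bochner_Integration.integral_cong) (auto simp: h_def indicator_def)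
  also have "\<dots> = (\<integral>t. h t \<partial>lborel)"
    by (subst lborel_integral_real_affine[where c = "-1" and t = 1 and f = h]) simp_all
  also have "\<dots> = circle_mean (1 / r) f"
    by (simp add: circle_mean_def circ_def integral_restrict_space set_lebesgue_integral_def h_def)
  finally show ?thesis .
qed

text \<open>With w = 1/z the outside of the circle becomes a disc and z / (a - z) = w / (w - 1/a) -
  1. The two terms on the right come from the pole at a and from infinity.\<close>

lemma circle_mean_exterior:
  assumes "f holomorphic_on cball 0 (1 / r)" "0 < r" "r < norm a"
  shows "circle_mean r (\<lambda>z. f (1 / z) * (z / (a - z))) = f (1 / a) - f 0"
proof -
  have "circle_mean r (\<lambda>z. f (1 / z) * (z / (a - z))) =
     circle_mean r (\<lambda>z. f (1 / z) * ((1 / z) / (1 / z - 1 / a)) - f (1 / z))"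
  proof (rule circle_mean_cong)
    fix z :: complex assume "norm z = r"
    then have "z \<noteq> 0" "a \<noteq> 0" "a \<noteq> z" using assms by auto
    then show "f (1 / z) * (z / (a - z)) = f (1 / z) * ((1 / z) / (1 / z - 1 / a)) - f (1 / z)"
      by (simp add: field_simps)
  qed (use assms in simp)
  also have "\<dots> = circle_mean (1 / r) (\<lambda>z. f z * (z / (z - 1 / a)) - f z)"
    by (rule circle_mean_inverse[OF assms(2), of "\<lambda>z. f z * (z / (z - 1 / a)) - f z"])
  also have "\<dots> = circle_mean (1 / r) (\<lambda>z. f z * (z / (z - 1 / a))) - circle_mean (1 / r) f"
  proof -
    have lt: "norm (1 / a) < 1 / r" using assms divide_strict_left_mono[of r "norm a" 1] mult_pos_pos[OF order.strict_trans[OF assms(2,3)] assms(2)]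
      by (simp add: norm_divide)
    have cont: "continuous_on (cball 0 (1 / r)) f" by (rule holomorphic_on_imp_continuous_on[OF assms(1)])
    have i: "integrable circ (\<lambda>t. g (of_real (1 / r) * cis (2 * pi * t)))" if "continuous_on (sphere 0 (1 / r)) g" for g :: "complex \<Rightarrow> complex"
    proof -
      have "continuous_on {0..1} (\<lambda>t. g (of_real (1 / r) * cis (2 * pi * t)))"
        by (intro continuous_on_compose2[OF that] continuous_intros) (use assms(2) in \<open>auto simp: norm_mult norm_divide\<close>)
      from borel_integrable_atLeastAtMost'[OF this] show ?thesis
        by (simp add: circ_def set_integrable_def integrable_restrict_space)
    qed
    show ?thesis unfolding circle_mean_def
      by (intro Bochner_Integration.integral_diff i continuous_intros continuous_on_subset[OF cont])
         (use lt in auto)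
  qed
  also have "\<dots> = f (1 / a) - f 0"
  proof -
    have lt: "norm (1 / a) < 1 / r" using assms divide_strict_left_mono[of r "norm a" 1] mult_pos_pos[OF order.strict_trans[OF assms(2,3)] assms(2)]
      by (simp add: norm_divide)
    show ?thesis
      using circle_mean_cauchy[OF assms(1) lt] circle_mean_0[OF assms(1)] assms(2) by simp
  qed
  finally show ?thesis .
qed


text \<open>
  The radii are increasing and strictly concave, so that on the torus each factor of the
  denominators is dominated by a single variable.
\<close>
definition rad :: "nat \<Rightarrow> real" where "rad i = 2 - (1 / 2) ^ i"

lemma rad_bounds: "1 \<le> rad i" "rad i < 2"
  by (simp_all add: rad_def power_le_one)

lemma rad_pos: "0 < rad i" using rad_bounds(1)[of i] by simp

lemma rad_mono: "rad i < rad (Suc i)" by (simp add: rad_def)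

lemma rad_concave: "rad i + rad (Suc (Suc i)) < 2 * rad (Suc i)" by (simp add: rad_def)

definition torus_pt :: "(nat \<Rightarrow> real) \<Rightarrow> nat \<Rightarrow> complex" where
  "torus_pt t i = of_real (rad i) * cis (2 * pi * t i)"

text \<open>Every coordinate is constrained, not only those of a given index set: a point of the
  product measure is \<open>undefined\<close> outside the index set, and \<open>torus_pt\<close>
  still sends it here.\<close>

definition torus_set :: "(nat \<Rightarrow> complex) set" where
  "torus_set = {h. \<forall>i. norm (h i) = rad i}"

lemma torus_pt_in: "torus_pt t \<in> torus_set"
  using rad_pos by (simp add: torus_pt_def torus_set_def norm_mult less_imp_le)

lemma torus_set_update: "h \<in> torus_set \<Longrightarrow> norm z = rad i \<Longrightarrow> h(i := z) \<in> torus_set"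
  by (simp add: torus_set_def)

definition torus_mean :: "nat set \<Rightarrow> ((nat \<Rightarrow> complex) \<Rightarrow> complex) \<Rightarrow> complex" where
  "torus_mean I f = (\<integral>t. f (torus_pt t) \<partial>Pi\<^sub>M I (\<lambda>_. circ))"

text \<open>Measurable and bounded, hence integrable. Together with \<open>torus_low\<close> for
  denominators, this class is stable under the arithmetic that occurs, so the integrability needed
  for Fubini follows from introduction rules.\<close>

definition torus_ok :: "nat set \<Rightarrow> ((nat \<Rightarrow> complex) \<Rightarrow> complex) \<Rightarrow> bool" where
  "torus_ok I f \<longleftrightarrow> (\<lambda>t. f (torus_pt t)) \<in> borel_measurable (Pi\<^sub>M I (\<lambda>_. circ)) \<and> (\<exists>B. \<forall>h\<in>torus_set. norm (f h) \<le> B)"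

interpretation circ: finite_measure circ by (rule finite_measure_circ)

interpretation circs: product_sigma_finite "\<lambda>_ :: nat. circ" ..

lemma emeasure_torus: "finite I \<Longrightarrow> emeasure (Pi\<^sub>M I (\<lambda>_ :: nat. circ)) (space (Pi\<^sub>M I (\<lambda>_. circ))) = 1"
  by (simp add: space_PiM circs.emeasure_PiM emeasure_circ)

lemma torus_ok_integrable:
  assumes "finite I" "torus_ok I f"
  shows "integrable (Pi\<^sub>M I (\<lambda>_. circ)) (\<lambda>t. f (torus_pt t))"
proof -
  obtain B where B: "\<And>h. h \<in> torus_set \<Longrightarrow> norm (f h) \<le> B"
    using assms(2) unfolding torus_ok_def by blast
  interpret finite_measure "Pi\<^sub>M I (\<lambda>_ :: nat. circ)"
    by standard (simp add: emeasure_torus[OF assms(1)])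
  show ?thesis
    using assms(2) B torus_pt_in unfolding torus_ok_def by (intro integrable_const_bound[of _ B]) auto
qed

named_theorems torus_ok_intros

lemma torus_ok_const [torus_ok_intros]: "torus_ok I (\<lambda>h. c)"
  unfolding torus_ok_def by auto

lemma torus_ok_coord [torus_ok_intros]:
  assumes "i \<in> I" shows "torus_ok I (\<lambda>h. h i)"
proof -
  have "(\<lambda>t. torus_pt t i) \<in> borel_measurable (Pi\<^sub>M I (\<lambda>_. circ))"
  proof -
    have "(\<lambda>x :: real. x) \<in> borel_measurable circ"
      unfolding circ_def by (intro measurable_restrict_space1) simp
    from measurable_compose[OF measurable_component_singleton[OF assms] this]
    have [measurable]: "(\<lambda>t. t i) \<in> borel_measurable (Pi\<^sub>M I (\<lambda>_. circ))" .
    have [measurable]: "cis \<in> borel_measurable borel"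
      by (intro borel_measurable_continuous_onI continuous_intros)
    show ?thesis unfolding torus_pt_def by measurable
  qed
  then show ?thesis unfolding torus_ok_def by (auto simp: torus_set_def)
qed

lemma torus_ok_add [torus_ok_intros]:
  assumes "torus_ok I f" "torus_ok I g" shows "torus_ok I (\<lambda>h. f h + g h)"
proof -
  obtain A B where "\<And>h. h \<in> torus_set \<Longrightarrow> norm (f h) \<le> A" "\<And>h. h \<in> torus_set \<Longrightarrow> norm (g h) \<le> B"
    using assms unfolding torus_ok_def by blast
  then have "\<forall>h\<in>torus_set. norm (f h + g h) \<le> A + B" by (meson norm_triangle_mono)
  then show ?thesis using assms unfolding torus_ok_def by auto
qed

lemma torus_ok_mult [torus_ok_intros]:
  assumes "torus_ok I f" "torus_ok I g" shows "torus_ok I (\<lambda>h. f h * g h)"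
proof -
  obtain A B where A: "\<And>h. h \<in> torus_set \<Longrightarrow> norm (f h) \<le> A" and B: "\<And>h. h \<in> torus_set \<Longrightarrow> norm (g h) \<le> B"
    using assms unfolding torus_ok_def by blast
  have "norm (f h * g h) \<le> A * B" if "h \<in> torus_set" for h
    using A[OF that] B[OF that] order_trans[OF norm_ge_zero A[OF that]]
    by (simp add: norm_mult mult_mono)
  then show ?thesis using assms unfolding torus_ok_def by auto
qed

lemma torus_ok_diff [torus_ok_intros]:
  assumes "torus_ok I f" "torus_ok I g" shows "torus_ok I (\<lambda>h. f h - g h)"
  using torus_ok_add[OF assms(1) torus_ok_mult[OF torus_ok_const[of I "-1"] assms(2)]] by simp

lemma torus_ok_sum [torus_ok_intros]:
  assumes "\<And>x. x \<in> A \<Longrightarrow> torus_ok I (f x)" shows "torus_ok I (\<lambda>h. \<Sum>x\<in>A. f x h)"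
  using assms by (induction A rule: infinite_finite_induct) (auto intro!: torus_ok_intros)

lemma torus_ok_prod [torus_ok_intros]:
  assumes "\<And>x. x \<in> A \<Longrightarrow> torus_ok I (f x)" shows "torus_ok I (\<lambda>h. \<Prod>x\<in>A. f x h)"
  using assms by (induction A rule: infinite_finite_induct) (auto intro!: torus_ok_intros)

lemma torus_ok_power [torus_ok_intros]:
  assumes "torus_ok I f" shows "torus_ok I (\<lambda>h. f h ^ n)"
  using assms by (induction n) (auto intro!: torus_ok_intros)

lemma torus_ok_inverse:
  assumes "torus_ok I f" "\<And>h. h \<in> torus_set \<Longrightarrow> norm (f h) \<ge> c" "c > 0"
  shows "torus_ok I (\<lambda>h. inverse (f h))"
proof -
  have "\<forall>h\<in>torus_set. norm (inverse (f h)) \<le> inverse c"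
    using assms(2,3) by (auto simp: norm_inverse intro!: le_imp_inverse_le)
  then show ?thesis using assms(1) unfolding torus_ok_def by auto
qed

lemma torus_mean_cong:
  assumes "\<And>h. h \<in> torus_set \<Longrightarrow> f h = g h"
  shows "torus_mean I f = torus_mean I g"
  unfolding torus_mean_def by (intro Bochner_Integration.integral_cong refl assms torus_pt_in)

lemma torus_mean_add:
  "finite I \<Longrightarrow> torus_ok I f \<Longrightarrow> torus_ok I g \<Longrightarrow> torus_mean I (\<lambda>h. f h + g h) = torus_mean I f + torus_mean I g"
  unfolding torus_mean_def by (intro Bochner_Integration.integral_add torus_ok_integrable)

lemma torus_mean_diff:
  "finite I \<Longrightarrow> torus_ok I f \<Longrightarrow> torus_ok I g \<Longrightarrow> torus_mean I (\<lambda>h. f h - g h) = torus_mean I f - torus_mean I g"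
  unfolding torus_mean_def by (intro Bochner_Integration.integral_diff torus_ok_integrable)

lemma torus_mean_cmult: "torus_mean I (\<lambda>h. c * f h) = c * torus_mean I f"
  unfolding torus_mean_def by simp

lemma torus_mean_const: "finite I \<Longrightarrow> torus_mean I (\<lambda>h. c) = c"
  unfolding torus_mean_def by (simp add: measure_def emeasure_torus)

lemma torus_mean_insert:
  assumes "finite I" "i \<notin> I" "torus_ok (insert i I) f"
  shows "torus_mean (insert i I) f = torus_mean I (\<lambda>h. circle_mean (rad i) (\<lambda>z. f (h(i := z))))"
proof -
  have upd: "torus_pt (t(i := s)) = (torus_pt t)(i := of_real (rad i) * cis (2 * pi * s))" for t s
    by (auto simp: torus_pt_def fun_eq_iff)
  show ?thesis
    unfolding torus_mean_def
    using circs.product_integral_insert[OF assms(1,2) torus_ok_integrable[OF _ assms(3)]] assms(1)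
    by (simp add: upd circle_mean_def)
qed

text \<open>Integrating over the i-th variable first, the mean value property gives the value of z
  g(z) at the centre, which is 0. This is how a factor of the ideal that removes all poles in one
  variable kills the residue.\<close>

lemma torus_mean_vanish:
  assumes "finite I" "i \<in> I" "torus_ok I f"
    and "\<And>h. h \<in> torus_set \<Longrightarrow> \<exists>g. g holomorphic_on cball 0 (rad i) \<and> (\<forall>z. norm z = rad i \<longrightarrow> f (h(i := z)) = z * g z)"
  shows "torus_mean I f = 0"
proof -
  have I: "I = insert i (I - {i})" using assms(2) by auto
  have "torus_mean I f = torus_mean (I - {i}) (\<lambda>h. circle_mean (rad i) (\<lambda>z. f (h(i := z))))"
    by (subst I, rule torus_mean_insert) (use assms I[symmetric] in auto)
  also have "\<dots> = torus_mean (I - {i}) (\<lambda>h. 0)"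
  proof (rule torus_mean_cong)
    fix h assume "h \<in> torus_set"
    from assms(4)[OF this] obtain g where g: "g holomorphic_on cball 0 (rad i)"
      "\<And>z. norm z = rad i \<Longrightarrow> f (h(i := z)) = z * g z" by blast
    have "circle_mean (rad i) (\<lambda>z. f (h(i := z))) = circle_mean (rad i) (\<lambda>z. z * g z)"
      by (rule circle_mean_cong) (use g rad_pos[of i] in auto)
    also have "\<dots> = 0 * g 0"
      by (rule circle_mean_0) (use g(1) rad_pos in \<open>auto intro!: holomorphic_intros\<close>)
    finally show "circle_mean (rad i) (\<lambda>z. f (h(i := z))) = 0" by simp
  qed
  also have "\<dots> = 0" using assms(1) by (simp add: torus_mean_const)
  finally show ?thesis .
qed

definition torus_low :: "((nat \<Rightarrow> complex) \<Rightarrow> complex) \<Rightarrow> bool" where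
  "torus_low f \<longleftrightarrow> (\<exists>c>0. \<forall>h\<in>torus_set. c \<le> norm (f h))"

lemma torus_low_nonzero: "torus_low f \<Longrightarrow> h \<in> torus_set \<Longrightarrow> f h \<noteq> 0"
  by (force simp: torus_low_def)

lemma torus_low_const [torus_ok_intros]: "c \<noteq> 0 \<Longrightarrow> torus_low (\<lambda>h. c)"
  unfolding torus_low_def by (rule exI[of _ "norm c"]) auto

lemma torus_low_coord [torus_ok_intros]: "torus_low (\<lambda>h. h i)"
  unfolding torus_low_def torus_set_def using rad_bounds by (intro exI[of _ 1]) auto

lemma torus_low_mult [torus_ok_intros]:
  assumes "torus_low f" "torus_low g" shows "torus_low (\<lambda>h. f h * g h)"
proof -
  obtain a b where a: "a > 0" "\<forall>h\<in>torus_set. a \<le> norm (f h)" and b: "b > 0" "\<forall>h\<in>torus_set. b \<le> norm (g h)"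
    using assms unfolding torus_low_def by blast
  then show ?thesis unfolding torus_low_def
    by (intro exI[of _ "a * b"]) (auto simp: norm_mult intro!: mult_mono)
qed

lemma torus_low_prod [torus_ok_intros]:
  assumes "\<And>x. x \<in> A \<Longrightarrow> torus_low (f x)" shows "torus_low (\<lambda>h. \<Prod>x\<in>A. f x h)"
  using assms by (induction A rule: infinite_finite_induct) (auto intro!: torus_ok_intros)

lemma torus_low_power [torus_ok_intros]:
  assumes "torus_low f" shows "torus_low (\<lambda>h. f h ^ n)"
  using assms by (induction n) (auto intro!: torus_ok_intros)

lemma torus_ok_divide [torus_ok_intros]:
  assumes "torus_ok I f" "torus_ok I g" "torus_low g" shows "torus_ok I (\<lambda>h. f h / g h)"
proof -
  obtain c where "c > 0" "\<forall>h\<in>torus_set. c \<le> norm (g h)"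
    using assms(3) unfolding torus_low_def by blast
  then have "torus_ok I (\<lambda>h. inverse (g h))"
    by (intro torus_ok_inverse[OF assms(2)]) auto
  from torus_ok_mult[OF assms(1) this] show ?thesis by (simp add: divide_inverse)
qed

lemma norm_combination:
  fixes x y z :: complex and a b c :: real
  assumes "0 \<le> a" "0 \<le> b" "0 \<le> c"
  shows "a * norm x - b * norm y - c * norm z \<le> norm (of_real a * x - of_real b * y - of_real c * z)"
proof -
  have "norm (of_real a * x) \<le> norm (of_real a * x - of_real b * y - of_real c * z) + norm (of_real b * y + of_real c * z)"
    using norm_triangle_ineq[of "of_real a * x - of_real b * y - of_real c * z" "of_real b * y + of_real c * z"] by simp
  moreover have "norm (of_real b * y + of_real c * z) \<le> b * norm y + c * norm z"
    using norm_triangle_ineq[of "of_real b * y" "of_real c * z"] assms by (simp add: norm_mult)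
  ultimately show ?thesis using assms by (simp add: norm_mult)
qed

lemma torus_low_second_difference [torus_ok_intros]:
  assumes "1 \<le> i" shows "torus_low (\<lambda>h. 2 * h i - h (i - 1) - h (i + 1))"
proof -
  obtain k where i: "i = Suc k" using assms by (cases i) auto
  have "2 * rad (Suc k) - rad k - rad (Suc (Suc k)) \<le> norm (2 * h i - h (i - 1) - h (i + 1))" if "h \<in> torus_set" for h
    using norm_combination[of 2 1 1 "h i" "h (i - 1)" "h (i + 1)"] that by (simp add: torus_set_def i)
  moreover have "0 < 2 * rad (Suc k) - rad k - rad (Suc (Suc k))" using rad_concave[of k] by simp
  ultimately show ?thesis unfolding torus_low_def by blast
qed

section \<open>Chains of residues\<close>

definition edge_poly :: "complex \<Rightarrow> complex \<Rightarrow> complex" where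
  "edge_poly x y = 24 * (x + y) * (5 * x + y) * (x + 5 * y)"

text \<open>Steps along the progression x, y, 2y - x, ... . The cube of x is left out because
  \<open>chain_kernel\<close> already contains it where this product is attached.\<close>

definition line_prod :: "nat \<Rightarrow> complex \<Rightarrow> complex \<Rightarrow> complex" where
  "line_prod k x y = (\<Prod>j = 1..k. edge_poly (x + (of_nat j - 1) * (y - x)) (x + of_nat j * (y - x)) /
     (x + of_nat j * (y - x)) ^ 3)"

text \<open>The measure is dz / (2 pi i z) in each variable; the first product in the numerator
  compensates for it, so that means of this function are residues of the remaining fraction.\<close>

definition chain_kernel :: "nat \<Rightarrow> (nat \<Rightarrow> complex) \<Rightarrow> complex" where
  "chain_kernel m h = ((\<Prod>i\<le>m. h i) * h 0 * (\<Prod>i = 1..m. edge_poly (h (i - 1)) (h i))) /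
     ((\<Prod>i\<le>m. h i ^ 3) * (\<Prod>i = 1..<m. 2 * h i - h (i - 1) - h (i + 1)))"

definition chain_mean :: "nat \<Rightarrow> complex" where
  "chain_mean m = torus_mean {..m} (chain_kernel m)"

lemma torus_ok_edge_poly [torus_ok_intros]:
  "torus_ok I f \<Longrightarrow> torus_ok I g \<Longrightarrow> torus_ok I (\<lambda>h. edge_poly (f h) (g h))"
  unfolding edge_poly_def by (intro torus_ok_intros)

lemma torus_ok_chain_kernel: "torus_ok {..m} (chain_kernel m)"
  unfolding chain_kernel_def by (intro torus_ok_intros) auto

lemma edge_poly_scale: "edge_poly (c * x) (c * y) = c ^ 3 * edge_poly x y"
  by (simp add: edge_poly_def eval_nat_numeral algebra_simps)

text \<open>
  In terms of $w = 1/z$, the points of the arithmetic progression through $x$ and $z$ are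
  $z$ times these factors.
\<close>
definition line_factor :: "complex \<Rightarrow> nat \<Rightarrow> complex \<Rightarrow> complex" where
  "line_factor x j w = of_nat j - (of_nat j - 1) * (x * w)"

definition line_inv :: "nat \<Rightarrow> complex \<Rightarrow> complex \<Rightarrow> complex" where
  "line_inv k x w = (\<Prod>j = 1..k. edge_poly (line_factor x (j - 1) w) (line_factor x j w) / line_factor x j w ^ 3)"

lemma line_prod_inverse:
  assumes "z \<noteq> 0"
  shows "line_prod k x z = line_inv k x (1 / z)"
  unfolding line_prod_def line_inv_def
proof (rule prod.cong[OF refl])
  fix j assume j: "j \<in> {1..k}"
  have "x + (of_nat j - 1) * (z - x) = z * line_factor x (j - 1) (1 / z)"
    "x + of_nat j * (z - x) = z * line_factor x j (1 / z)"
    using j assms by (simp_all add: line_factor_def field_simps of_nat_diff)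
  then show "edge_poly (x + (of_nat j - 1) * (z - x)) (x + of_nat j * (z - x)) / (x + of_nat j * (z - x)) ^ 3 =
     edge_poly (line_factor x (j - 1) (1 / z)) (line_factor x j (1 / z)) / line_factor x j (1 / z) ^ 3"
    using assms by (simp add: edge_poly_scale power_mult_distrib)
qed

text \<open>For w = 1/z the hypothesis says |z| >= |x|, and then j exceeds (j - 1) |x w|. Hence the
  continued progression creates no poles outside the circle of z.\<close>

lemma line_factor_nonzero:
  assumes "norm (x * w) \<le> 1" "j \<ge> 1"
  shows "line_factor x j w \<noteq> 0"
proof
  assume "line_factor x j w = 0"
  then have "of_nat j = of_nat (j - 1) * (x * w)" using assms(2) by (simp add: line_factor_def of_nat_diff)
  then have "real j = real (j - 1) * norm (x * w)" by (metis norm_mult norm_of_nat)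
  also have "\<dots> \<le> real (j - 1) * 1" by (intro mult_left_mono assms) auto
  finally show False using assms(2) by simp
qed

lemma line_inv_holomorphic:
  assumes "\<And>w. w \<in> A \<Longrightarrow> norm (x * w) \<le> 1"
  shows "line_inv k x holomorphic_on A"
proof -
  have [holomorphic_intros]: "line_factor x j holomorphic_on A" for j
    unfolding line_factor_def by (intro holomorphic_intros)
  show ?thesis
    unfolding line_inv_def edge_poly_def
    by (intro holomorphic_intros) (use assms line_factor_nonzero in \<open>auto simp: Suc_le_eq\<close>)
qed

text \<open>With e = x w / (1 - x w), each \<open>line_factor x j w\<close> is (1 - x w)(e + j), and
  the common factor drops out by homogeneity. This is where residues meet Frobenius'
  coefficients.\<close>

lemma line_inv_frobenius:
  assumes "x * w \<noteq> 1"
  shows "line_inv k x w = frobenius k (x * w / (1 - x * w))"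
  unfolding line_inv_def frobenius_def
proof (rule prod.cong[OF refl])
  fix j assume j: "j \<in> {1..k}"
  define u where "u = 1 - x * w"
  define e where "e = x * w / (1 - x * w)"
  have u: "u \<noteq> 0" "x * w = u * e" "u * (1 + e) = 1" using assms by (simp_all add: u_def e_def field_simps)
  have 1: "line_factor x j w = u * (e + of_nat j)" "line_factor x (j - 1) w = u * (e + of_nat j - 1)"
    using j assms unfolding line_factor_def u_def e_def by (simp_all add: field_simps of_nat_diff)
  have "edge_poly (line_factor x (j - 1) w) (line_factor x j w) / line_factor x j w ^ 3 =
     edge_poly (e + of_nat j - 1) (e + of_nat j) / (e + of_nat j) ^ 3"
    unfolding 1 edge_poly_scale using u(1) by (simp add: power_mult_distrib)
  then show "edge_poly (line_factor x (j - 1) w) (line_factor x j w) / line_factor x j w ^ 3 =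
    24 * (2 * (x * w / (1 - x * w)) + 2 * of_nat j - 1) * (6 * (x * w / (1 - x * w)) + 6 * of_nat j - 5) *
       (6 * (x * w / (1 - x * w)) + 6 * of_nat j - 1) / (x * w / (1 - x * w) + of_nat j) ^ 3"
    unfolding e_def[symmetric] by (simp add: edge_poly_def algebra_simps)
qed

lemma line_inv_0: "line_inv k x 0 = frob0 k"
  by (simp add: line_inv_frobenius frob0_def)

text \<open>The substitution e = x w / (1 - x w) vanishes at w = 0 with derivative x.\<close>

lemma deriv_line_inv: "deriv (line_inv k x) 0 = frob1 k * x"
proof -
  have d: "((\<lambda>w. x * w / (1 - x * w)) has_field_derivative x) (at 0)"
    by (auto intro!: derivative_eq_intros)
  have "(frobenius k has_field_derivative frob1 k) (at (x * 0 / (1 - x * 0)))"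
    using frobenius_deriv by simp
  from DERIV_chain2[OF this d]
  have "((\<lambda>w. frobenius k (x * w / (1 - x * w))) has_field_derivative frob1 k * x) (at 0)" .
  moreover have "eventually (\<lambda>w. frobenius k (x * w / (1 - x * w)) = line_inv k x w) (nhds 0)"
  proof -
    have "open {w. x * w \<noteq> 1}" by (intro open_Collect_neq continuous_intros)
    from eventually_nhds_in_open[OF this, of 0] show ?thesis
      by (auto elim!: eventually_mono simp: line_inv_frobenius)
  qed
  ultimately have "(line_inv k x has_field_derivative frob1 k * x) (at 0)"
    by (subst DERIV_cong_ev[OF refl _ refl, symmetric]) simp_all
  then show ?thesis by (rule DERIV_imp_deriv)
qed

text \<open>In the first formula the poles outside the circle are a and infinity. In the second only
  infinity is left, and the additional z selects the coefficient of w instead of the constant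
  term.\<close>

lemma circle_mean_line:
  assumes "0 < r" "norm x \<le> r"
  shows "r < norm a \<Longrightarrow> circle_mean r (\<lambda>z. line_prod k x z * (z / (a - z))) = line_prod k x a - frob0 k"
    and "circle_mean r (\<lambda>z. line_prod k x z * z) = frob1 k * x"
proof -
  have "norm (x * w) \<le> 1" if "w \<in> cball 0 (1 / r)" for w
  proof -
    have "norm x * norm w \<le> r * (1 / r)" using that assms by (intro mult_mono) auto
    then show ?thesis using assms by (simp add: norm_mult)
  qed
  then have hol: "line_inv k x holomorphic_on cball 0 (1 / r)" by (rule line_inv_holomorphic)
  { assume a: "r < norm a"
    have "circle_mean r (\<lambda>z. line_prod k x z * (z / (a - z))) = circle_mean r (\<lambda>z. line_inv k x (1 / z) * (z / (a - z)))"
      by (rule circle_mean_cong) (use assms in \<open>auto simp: line_prod_inverse\<close>)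
    also have "\<dots> = line_inv k x (1 / a) - line_inv k x 0"
      by (rule circle_mean_exterior[OF hol assms(1) a])
    finally show "circle_mean r (\<lambda>z. line_prod k x z * (z / (a - z))) = line_prod k x a - frob0 k"
      using a assms by (subst line_prod_inverse) (auto simp: line_inv_0) }
  have "circle_mean r (\<lambda>z. line_prod k x z * z) = circle_mean r (\<lambda>z. line_inv k x (1 / z) / (1 / z))"
    by (rule circle_mean_cong) (use assms in \<open>auto simp: line_prod_inverse\<close>)
  also have "\<dots> = circle_mean (1 / r) (\<lambda>z. line_inv k x z / z)"
    by (rule circle_mean_inverse[OF assms(1), of "\<lambda>z. line_inv k x z / z"])
  also have "\<dots> = frob1 k * x"
    using circle_mean_deriv[OF hol] assms by (simp add: deriv_line_inv)
  finally show "circle_mean r (\<lambda>z. line_prod k x z * z) = frob1 k * x" .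
qed

text \<open>Splitting off the first step leaves the progression that starts with y, 2y - x. Read
  backwards, a variable just integrated out is absorbed into the tail.\<close>

lemma line_prod_Suc:
  "line_prod (Suc k) x y = edge_poly x y / y ^ 3 * line_prod k y (2 * y - x)"
proof -
  have "line_prod (Suc k) x y = (\<Prod>j = Suc 0..Suc k. edge_poly (x + (of_nat j - 1) * (y - x)) (x + of_nat j * (y - x)) /
     (x + of_nat j * (y - x)) ^ 3)" by (simp add: line_prod_def)
  also have "\<dots> = edge_poly x y / y ^ 3 * (\<Prod>j = Suc (Suc 0)..Suc k. edge_poly (x + (of_nat j - 1) * (y - x)) (x + of_nat j * (y - x)) /
     (x + of_nat j * (y - x)) ^ 3)"
    by (subst prod.atLeast_Suc_atMost) simp_all
  also have "(\<Prod>j = Suc (Suc 0)..Suc k. edge_poly (x + (of_nat j - 1) * (y - x)) (x + of_nat j * (y - x)) /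
     (x + of_nat j * (y - x)) ^ 3) = line_prod k y (2 * y - x)"
    unfolding prod.atLeast_Suc_atMost_Suc_shift line_prod_def
    by (intro prod.cong) (auto simp: algebra_simps)
  finally show ?thesis .
qed

text \<open>
  What remains of the mean of length $m + k$ after the last $k$ variables have been evaluated at
  the residues where they continue the progression $h_{m-1}, h_m$.
\<close>
definition mixed_mean :: "nat \<Rightarrow> nat \<Rightarrow> complex" where
  "mixed_mean m k = torus_mean {..m} (\<lambda>h. chain_kernel m h * line_prod k (h m) (2 * h m - h (m - 1)))"

lemma mixed_mean_0: "mixed_mean m 0 = chain_mean m"
  by (simp add: mixed_mean_def chain_mean_def line_prod_def)

text \<open>The continued points (j + 1) h_m - j h_(m-1) have modulus at least \<open>rad m\<close>,
  because the radii increase.\<close>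

lemma torus_ok_line_prod:
  assumes "m \<ge> 1"
  shows "torus_ok {..m} (\<lambda>h. line_prod k (h m) (2 * h m - h (m - 1)))"
proof -
  obtain n where m: "m = Suc n" using assms by (cases m) auto
  have "torus_low (\<lambda>h. h m + of_nat j * (2 * h m - h (m - 1) - h m))" for j
  proof -
    have "rad m \<le> norm (h m + of_nat j * (2 * h m - h (m - 1) - h m))" if "h \<in> torus_set" for h
    proof -
      have "rad m \<le> (real j + 1) * rad m - real j * rad n"
        using rad_mono[of n] mult_left_mono[of "rad n" "rad m" "real j"] by (simp add: m algebra_simps)
      also have "\<dots> \<le> norm (of_real (real j + 1) * h m - of_real (real j) * h n - of_real 0 * h n)"
        using norm_combination[of "real j + 1" "real j" 0 "h m" "h n" "h n"] that by (simp add: torus_set_def)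
      also have "of_real (real j + 1) * h m - of_real (real j) * h n - of_real 0 * h n = h m + of_nat j * (2 * h m - h (m - 1) - h m)"
        by (simp add: m algebra_simps)
      finally show ?thesis .
    qed
    then show ?thesis unfolding torus_low_def using rad_pos by blast
  qed
  then show ?thesis unfolding line_prod_def by (intro torus_ok_intros) auto
qed

lemma torus_ok_mixed:
  assumes "m \<ge> 1"
  shows "torus_ok {..m} (\<lambda>h. chain_kernel m h * line_prod k (h m) (2 * h m - h (m - 1)))"
  by (intro torus_ok_mult torus_ok_chain_kernel torus_ok_line_prod assms)

lemma chain_kernel_cong: "(\<And>i. i \<le> m \<Longrightarrow> h i = h' i) \<Longrightarrow> chain_kernel m h = chain_kernel m h'"
  unfolding chain_kernel_def by (intro arg_cong2[where f = "(/)"] arg_cong2[where f = "(*)"] prod.cong) auto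

lemma chain_kernel_Suc:
  assumes "n \<ge> 1" "h (Suc n) \<noteq> 0"
  shows "chain_kernel (Suc n) h = chain_kernel n h * (edge_poly (h n) (h (Suc n)) / h (Suc n) ^ 3) *
           (h (Suc n) / (2 * h n - h (n - 1) - h (Suc n)))"
proof -
  have e: "{1..<Suc n} = insert n {1..<n}" using assms(1) by auto
  show ?thesis
    unfolding chain_kernel_def e by (simp add: prod.nat_ivl_Suc' mult_ac)
qed

text \<open>The last variable is integrated out. Outside its circle the only finite pole is 2 h_n -
  h_(n-1), where the variable continues the progression and lengthens the tail by one; infinity
  contributes the product with \<open>chain_mean n\<close>.\<close>

lemma mixed_mean_step:
  assumes "n \<ge> 1"
  shows "mixed_mean (Suc n) k = mixed_mean n (Suc k) - frob0 (Suc k) * chain_mean n"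
proof -
  let ?a = "\<lambda>h. 2 * h n - h (n - 1) :: complex"
  have I: "{..Suc n} = insert (Suc n) {..n}" by auto
  have "mixed_mean (Suc n) k = torus_mean {..n} (\<lambda>h. circle_mean (rad (Suc n))
     (\<lambda>z. chain_kernel (Suc n) (h(Suc n := z)) * line_prod k z (2 * z - h n)))"
    unfolding mixed_mean_def I
    by (subst torus_mean_insert) (use torus_ok_mixed[of "Suc n" k] in \<open>simp_all add: I[symmetric]\<close>)
  also have "\<dots> = torus_mean {..n} (\<lambda>h. chain_kernel n h * line_prod (Suc k) (h n) (?a h) - frob0 (Suc k) * chain_kernel n h)"
  proof (rule torus_mean_cong)
    fix h assume h: "h \<in> torus_set"
    have "circle_mean (rad (Suc n)) (\<lambda>z. chain_kernel (Suc n) (h(Suc n := z)) * line_prod k z (2 * z - h n)) =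
      circle_mean (rad (Suc n)) (\<lambda>z. chain_kernel n h * (line_prod (Suc k) (h n) z * (z / (?a h - z))))"
    proof (rule circle_mean_cong)
      fix z :: complex assume "norm z = rad (Suc n)"
      then have "z \<noteq> 0" using rad_pos[of "Suc n"] by auto
      moreover have "n - Suc 0 \<noteq> Suc n" by simp
      moreover have "chain_kernel n (h(Suc n := z)) = chain_kernel n h" by (rule chain_kernel_cong) simp
      ultimately show "chain_kernel (Suc n) (h(Suc n := z)) * line_prod k z (2 * z - h n) =
         chain_kernel n h * (line_prod (Suc k) (h n) z * (z / (?a h - z)))"
        using assms by (subst chain_kernel_Suc) (simp_all add: line_prod_Suc)
    qed (simp add: rad_pos less_imp_le)
    also have "\<dots> = chain_kernel n h * (line_prod (Suc k) (h n) (?a h) - frob0 (Suc k))"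
    proof -
      obtain l where n: "n = Suc l" using assms by (cases n) auto
      \<comment> \<open>Concavity of the radii places the pole \<open>?a h\<close> outside the
        circle of the last variable.\<close>
      have "rad (Suc n) < 2 * rad n - rad (n - 1)" using rad_concave[of l] by (simp add: n)
      also have "\<dots> \<le> norm (?a h)"
        using norm_combination[of 2 1 0 "h n" "h (n - 1)" 0] h by (simp add: torus_set_def)
      finally have "rad (Suc n) < norm (?a h)" .
      moreover have "norm (h n) \<le> rad (Suc n)" using h rad_mono[of n] by (simp add: torus_set_def)
      ultimately show ?thesis unfolding circle_mean_cmult using circle_mean_line(1)[OF rad_pos] by simp
    qed
    finally show "circle_mean (rad (Suc n)) (\<lambda>z. chain_kernel (Suc n) (h(Suc n := z)) * line_prod k z (2 * z - h n)) =
      chain_kernel n h * line_prod (Suc k) (h n) (?a h) - frob0 (Suc k) * chain_kernel n h"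
      by (simp add: algebra_simps)
  qed
  also have "\<dots> = mixed_mean n (Suc k) - frob0 (Suc k) * chain_mean n"
    unfolding mixed_mean_def chain_mean_def torus_mean_cmult[symmetric]
    by (intro torus_mean_diff torus_ok_mixed assms torus_ok_intros torus_ok_chain_kernel) auto
  finally show ?thesis .
qed

text \<open>For m = 1 the product of second differences is empty, so there is no finite pole outside
  the circle. The kernel is (1/h_0)(F/z^3) z, and its spare power of z produces
  \<open>frob1\<close>.\<close>

lemma mixed_mean_1: "mixed_mean 1 k = frob1 (Suc k)"
proof -
  have I: "{..Suc 0} = insert (Suc 0) {..0}" by auto
  have "mixed_mean 1 k = torus_mean {..0} (\<lambda>h. circle_mean (rad (Suc 0))
     (\<lambda>z. chain_kernel (Suc 0) (h(Suc 0 := z)) * line_prod k z (2 * z - h 0)))"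
    unfolding mixed_mean_def One_nat_def I
    by (subst torus_mean_insert) (use torus_ok_mixed[of "Suc 0" k] in \<open>simp_all add: I[simplified]\<close>)
  also have "\<dots> = torus_mean {..0} (\<lambda>h. frob1 (Suc k))"
  proof (rule torus_mean_cong)
    fix h assume h: "h \<in> torus_set"
    then have h0: "h 0 \<noteq> 0" using torus_low_nonzero[OF torus_low_coord] by blast
    have "circle_mean (rad (Suc 0)) (\<lambda>z. chain_kernel (Suc 0) (h(Suc 0 := z)) * line_prod k z (2 * z - h 0)) =
      circle_mean (rad (Suc 0)) (\<lambda>z. (1 / h 0) * (line_prod (Suc k) (h 0) z * z))"
    proof (rule circle_mean_cong)
      fix z :: complex assume "norm z = rad (Suc 0)"
      then have "z \<noteq> 0" using rad_pos[of "Suc 0"] by auto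
      then show "chain_kernel (Suc 0) (h(Suc 0 := z)) * line_prod k z (2 * z - h 0) =
         (1 / h 0) * (line_prod (Suc k) (h 0) z * z)"
        using h0 by (simp add: line_prod_Suc chain_kernel_def field_simps eval_nat_numeral)
    qed (simp add: rad_pos less_imp_le)
    also have "\<dots> = (1 / h 0) * (frob1 (Suc k) * h 0)"
      unfolding circle_mean_cmult
      by (subst circle_mean_line(2)) (use h rad_mono[of 0] in \<open>auto simp: rad_pos torus_set_def\<close>)
    finally show "circle_mean (rad (Suc 0)) (\<lambda>z. chain_kernel (Suc 0) (h(Suc 0 := z)) * line_prod k z (2 * z - h 0)) = frob1 (Suc k)"
      using h0 by simp
  qed
  also have "\<dots> = frob1 (Suc k)" by (simp add: torus_mean_const)
  finally show ?thesis .
qed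

lemma mixed_mean_closed:
  "mixed_mean (Suc n) k = frob1 (Suc n + k) - (\<Sum>i\<in>{1..n}. frob0 (Suc n + k - i) * chain_mean i)"
proof (induction n arbitrary: k)
  case 0 then show ?case using mixed_mean_1[of k] by simp
next
  case (Suc n)
  show ?case
    by (subst mixed_mean_step) (simp_all add: Suc.IH Suc_diff_le)
qed

theorem chain_mean_recursion:
  assumes "d \<ge> 1"
  shows "chain_mean d = frob1 d - (\<Sum>i\<in>{1..<d}. frob0 (d - i) * chain_mean i)"
proof -
  obtain n where d: "d = Suc n" using assms by (cases d) auto
  have "{1..<d} = {1..n}" by (auto simp: d)
  then show ?thesis using mixed_mean_closed[of n 0] by (simp add: mixed_mean_0 d)
qed

theorem chain_mean_eq_w_coeff: "d \<ge> 1 \<Longrightarrow> chain_mean d = w_coeff d"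
proof (induction d rule: less_induct)
  case (less d)
  \<comment> \<open>\<open>frob1 0 = 0\<close> forces w_0 = 0, so the term of
    \<open>w_coeff_recursion\<close> containing \<open>frob0 d\<close> drops out.\<close>
  have w0: "w_coeff 0 = 0" using w_coeff_recursion[of 0] by (simp add: frob_0)
  have "frob1 d = (\<Sum>i\<in>{0..d}. frob0 (d - i) * w_coeff i)"
    unfolding w_coeff_recursion[of d, symmetric]
    by (rule sum.reindex_bij_witness[where i = "\<lambda>i. d - i" and j = "\<lambda>i. d - i"]) auto
  also have "{0..d} = insert 0 (insert d {1..<d})" using less.prems by auto
  also have "(\<Sum>i\<in>insert 0 (insert d {1..<d}). frob0 (d - i) * w_coeff i) = w_coeff d + (\<Sum>i\<in>{1..<d}. frob0 (d - i) * w_coeff i)"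
    using less.prems by (simp add: w0 frob_0)
  also have "(\<Sum>i\<in>{1..<d}. frob0 (d - i) * w_coeff i) = (\<Sum>i\<in>{1..<d}. frob0 (d - i) * chain_mean i)"
    using less.IH by (intro sum.cong) auto
  finally show ?case using chain_mean_recursion[OF less.prems] by simp
qed

section \<open>A residue functional on the Chow ring\<close>

lemma poly_mapping_sum_singles:
  fixes p :: "'a \<Rightarrow>\<^sub>0 'b :: comm_monoid_add"
  shows "p = (\<Sum>m\<in>Poly_Mapping.keys p. Poly_Mapping.single m (Poly_Mapping.lookup p m))"
  by (rule poly_mapping_eqI) (auto simp: lookup_sum lookup_single when_def in_keys_iff)

lemma poly_mapping_additive_induct:
  fixes p :: "'a \<Rightarrow>\<^sub>0 'b :: comm_monoid_add"
  assumes "\<And>m a. P (Poly_Mapping.single m a)" "\<And>p q. P p \<Longrightarrow> P q \<Longrightarrow> P (p + q)"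
  shows "P p"
proof -
  have "P (\<Sum>m\<in>A. Poly_Mapping.single m (Poly_Mapping.lookup p m))" if "finite A" for A
    using that by induction (use assms assms(1)[of undefined 0] in auto)
  from this[of "Poly_Mapping.keys p"] show ?thesis
    using poly_mapping_sum_singles[of p] by simp
qed

definition monomial_degree :: "(coord \<Rightarrow>\<^sub>0 nat) \<Rightarrow> nat" where
  "monomial_degree m = (\<Sum>c\<in>Poly_Mapping.keys m. Poly_Mapping.lookup m c)"

definition monomial_value :: "(coord \<Rightarrow> complex) \<Rightarrow> (coord \<Rightarrow>\<^sub>0 nat) \<Rightarrow> complex" where
  "monomial_value x m = (\<Prod>c\<in>Poly_Mapping.keys m. x c ^ Poly_Mapping.lookup m c)"

lemma monomial_degree_superset:
  "finite A \<Longrightarrow> Poly_Mapping.keys m \<subseteq> A \<Longrightarrow> monomial_degree m = (\<Sum>c\<in>A. Poly_Mapping.lookup m c)"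
  unfolding monomial_degree_def by (rule sum.mono_neutral_left) (auto simp: in_keys_iff)

lemma monomial_value_superset:
  "finite A \<Longrightarrow> Poly_Mapping.keys m \<subseteq> A \<Longrightarrow> monomial_value x m = (\<Prod>c\<in>A. x c ^ Poly_Mapping.lookup m c)"
  unfolding monomial_value_def by (rule prod.mono_neutral_left) (auto simp: in_keys_iff)

lemma monomial_add:
  "monomial_degree (m + n) = monomial_degree m + monomial_degree n"
  "monomial_value x (m + n) = monomial_value x m * monomial_value x n"
proof -
  let ?A = "Poly_Mapping.keys m \<union> Poly_Mapping.keys n"
  have s: "Poly_Mapping.keys (m + n) \<subseteq> ?A" by (rule keys_add)
  show "monomial_degree (m + n) = monomial_degree m + monomial_degree n"
    by (subst (1 2 3) monomial_degree_superset[of ?A]) (use s in \<open>auto simp: lookup_add sum.distrib\<close>)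
  show "monomial_value x (m + n) = monomial_value x m * monomial_value x n"
    by (subst (1 2 3) monomial_value_superset[of ?A]) (use s in \<open>auto simp: lookup_add power_add prod.distrib\<close>)
qed

text \<open>Evaluation at \<open>x\<close>, with a formal variable recording the degree.\<close>
definition graded_eval :: "(coord \<Rightarrow> complex) \<Rightarrow> divisor_poly \<Rightarrow> complex poly" where
  "graded_eval x p = (\<Sum>m\<in>Poly_Mapping.keys p.
     smult (Poly_Mapping.lookup p m) (monom (monomial_value x m) (monomial_degree m)))"

lemma graded_eval_superset:
  "finite A \<Longrightarrow> Poly_Mapping.keys p \<subseteq> A \<Longrightarrow>
   graded_eval x p = (\<Sum>m\<in>A. smult (Poly_Mapping.lookup p m) (monom (monomial_value x m) (monomial_degree m)))"
  unfolding graded_eval_def by (rule sum.mono_neutral_left) (auto simp: in_keys_iff)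

lemma graded_eval_add: "graded_eval x (p + q) = graded_eval x p + graded_eval x q"
proof -
  let ?A = "Poly_Mapping.keys p \<union> Poly_Mapping.keys q"
  have s: "Poly_Mapping.keys (p + q) \<subseteq> ?A" by (rule keys_add)
  show ?thesis
    by (subst (1 2 3) graded_eval_superset[of ?A]) (use s in \<open>auto simp: lookup_add smult_add_left sum.distrib\<close>)
qed

lemma graded_eval_single:
  "graded_eval x (Poly_Mapping.single m a) = smult a (monom (monomial_value x m) (monomial_degree m))"
  by (simp add: graded_eval_superset[of "{m}"])

lemma graded_eval_mult: "graded_eval x (p * q) = graded_eval x p * graded_eval x q"
proof (induction p rule: poly_mapping_additive_induct)
  case (1 m a)
  show ?case
  proof (induction q rule: poly_mapping_additive_induct)
    case (1 n b)
    show ?case by (simp add: graded_eval_single mult_single monomial_add mult_monom smult_monom)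
  qed (simp add: graded_eval_add algebra_simps)
qed (simp add: graded_eval_add algebra_simps)

lemma graded_eval_0 [simp]: "graded_eval x 0 = 0"
  by (simp add: graded_eval_def)

lemma graded_eval_scalar: "graded_eval x (scalar z) = [:z:]"
  by (simp add: scalar_def graded_eval_single monomial_value_def monomial_degree_def monom_0)

lemma graded_eval_1 [simp]: "graded_eval x 1 = 1"
  using graded_eval_scalar[of x 1] by (simp add: scalar_def one_pCons)

lemma graded_eval_numeral [simp]: "graded_eval x (numeral k) = numeral k"
  using graded_eval_scalar[of x "numeral k"] by (simp add: scalar_def numeral_poly)

lemma graded_eval_of_nat [simp]: "graded_eval x (of_nat k) = of_nat k"
  by (induction k) (simp_all add: graded_eval_add)

lemma graded_eval_minus: "graded_eval x (- p) = - graded_eval x p"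
  using graded_eval_add[of x p "- p"] by (simp add: eq_neg_iff_add_eq_0 add.commute)

lemma graded_eval_diff: "graded_eval x (p - q) = graded_eval x p - graded_eval x q"
  using graded_eval_add[of x p "- q"] by (simp add: graded_eval_minus)

lemma graded_eval_of_int [simp]: "graded_eval x (of_int k) = of_int k"
  by (cases k rule: int_cases2) (simp_all add: graded_eval_minus)

lemma graded_eval_sum: "graded_eval x (\<Sum>a\<in>A. f a) = (\<Sum>a\<in>A. graded_eval x (f a))"
  by (induction A rule: infinite_finite_induct) (simp_all add: graded_eval_add)

lemma graded_eval_prod: "graded_eval x (\<Prod>a\<in>A. f a) = (\<Prod>a\<in>A. graded_eval x (f a))"
  by (induction A rule: infinite_finite_induct) (simp_all add: graded_eval_mult)

lemma graded_eval_var [simp]: "graded_eval x (divisor_var c) = monom (x c) 1"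
  by (simp add: divisor_var_def graded_eval_single monomial_value_def monomial_degree_def)

lemma graded_eval_homogeneous:
  assumes "homogeneous_poly n p" "k \<noteq> n"
  shows "coeff (graded_eval x p) k = 0"
proof -
  have "monomial_degree m = n" if "m \<in> Poly_Mapping.keys p" for m
    using assms(1) that by (simp add: homogeneous_poly_def monomial_degree_def)
  then show ?thesis using assms(2) by (simp add: graded_eval_def coeff_sum)
qed

lemma prod_monom: "(\<Prod>a\<in>A. monom (f a) (n a)) = monom (\<Prod>a\<in>A. f a) (\<Sum>a\<in>A. n a)"
  by (induction A rule: infinite_finite_induct) (simp_all add: mult_monom monom_0 one_pCons)

text \<open>The exponents of \<open>weight_factor\<close> as a linear form; at h = \<open>H\<close>
  this is the class of the divisor {c = 0}. The test n mod 3 = 0 keeps \<open>h (d + 1)\<close> out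
  of the form of a_(3,3d). The ring is kept general to cover complex numbers as well as
  \<open>divisor_poly\<close>.\<close>

fun coord_form :: "coord \<Rightarrow> (nat \<Rightarrow> 'a) \<Rightarrow> 'a :: comm_ring_1" where
  "coord_form (Ac i n) h = (if i < 3 then h n
     else of_nat (3 - n mod 3) * h (n div 3) + (if n mod 3 = 0 then 0 else of_nat (n mod 3) * h (n div 3 + 1)))"
| "coord_form (Uc k) h = 2 * h k - h (k - 1) - h (k + 1)"

text \<open>The coordinates are partitioned according to the variable that dominates their weight.\<close>
fun coord_index :: "coord \<Rightarrow> nat" where
  "coord_index (Ac i n) = (if i < 3 then n else (n + 1) div 3)"
| "coord_index (Uc k) = k"

definition coord_group :: "nat \<Rightarrow> nat \<Rightarrow> coord set" where
  "coord_group d i = {c \<in> coords d. coord_index c = i}"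

lemma mod3_cases:
  fixes n :: nat
  obtains j where "n = 3 * j" | j where "n = 3 * j + 1" | j where "n = 3 * j + 2"
proof -
  have "n = 3 * (n div 3) + n mod 3" by simp
  moreover have "n mod 3 = 0 \<or> n mod 3 = 1 \<or> n mod 3 = 2" by linarith
  ultimately show ?thesis using that by (metis add_0_right)
qed

lemma finite_coords: "finite (coords d)"
proof -
  have "coords d = (\<lambda>(i, j). Ac i j) ` ({..<3} \<times> {..d}) \<union> Ac 3 ` {..3 * d} \<union> Uc ` {1..<d}"
    by (auto simp: coords_def)
  then show ?thesis by simp
qed

lemma card_coords:
  assumes "d \<ge> 1" shows "card (coords d) = 7 * d + 3"
proof -
  have 1: "coords d = (\<lambda>(i, j). Ac i j) ` ({..<3} \<times> {..d}) \<union> (Ac 3 ` {..3 * d} \<union> Uc ` {1..<d})"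
    by (auto simp: coords_def)
  have "card ((\<lambda>(i, j). Ac i j) ` ({..<3} \<times> {..d})) = 3 * (d + 1)"
    by (subst card_image) (auto simp: inj_on_def card_cartesian_product)
  moreover have "card (Ac 3 ` {..3 * d} \<union> Uc ` {1..<d}) = (3 * d + 1) + (d - 1)"
    by (subst card_Un_disjoint) (auto simp: card_image inj_on_def)
  ultimately show ?thesis using assms unfolding 1 by (subst card_Un_disjoint) auto
qed

text \<open>Only the dominating variable has to lie on its circle, the others may be anywhere in
  their discs. This covers the torus and also the move of another variable into its disc. The mixed
  forms 2 h_j + h_(j+1) use that the radii lie in [1, 2), the second differences use
  concavity.\<close>

lemma coord_form_lower:
  assumes "c \<in> coords d"
  obtains e where "e > 0" "\<And>h :: nat \<Rightarrow> complex. (\<And>j. norm (h j) \<le> rad j) \<Longrightarrow> norm (h (coord_index c)) = rad (coord_index c) \<Longrightarrow> e \<le> norm (coord_form c h)"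
proof (cases c)
  case (Ac i n)
  show ?thesis
  proof (cases "i < 3")
    case True
    then show ?thesis using Ac rad_pos[of n] by (intro that[of "rad n"]) auto
  next
    case False
    show ?thesis
    proof (cases n rule: mod3_cases)
      case (1 j)
      then have "coord_index c = j" using Ac False by simp
      then show ?thesis using Ac False 1 rad_pos[of j] by (intro that[of "rad j"]) (auto simp: norm_mult)
    next
      case (2 j)
      have "2 * rad j - rad (Suc j) \<le> norm (2 * h j + h (Suc j))" if "norm (h (Suc j)) \<le> rad (Suc j)" "norm (h j) = rad j" for h :: "nat \<Rightarrow> complex"
        using norm_combination[of 2 1 0 "h j" "- h (Suc j)" 0] that by simp
      moreover have "coord_index c = j" using Ac False 2 by simp
      moreover have "n mod 3 = 1" "n div 3 = j" using 2 by presburger+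
      ultimately show ?thesis using Ac False rad_bounds[of j] rad_bounds[of "Suc j"]
        by (intro that[of "2 * rad j - rad (Suc j)"]) auto
    next
      case (3 j)
      have "2 * rad (Suc j) - rad j \<le> norm (h j + 2 * h (Suc j))" if "norm (h j) \<le> rad j" "norm (h (Suc j)) = rad (Suc j)" for h :: "nat \<Rightarrow> complex"
        using norm_combination[of 2 1 0 "h (Suc j)" "- h j" 0] that by (simp add: add.commute)
      moreover have "coord_index c = Suc j" using Ac False 3 by simp
      moreover have "n mod 3 = 2" "n div 3 = j" using 3 by presburger+
      ultimately show ?thesis using Ac False rad_bounds[of j] rad_bounds[of "Suc j"]
        by (intro that[of "2 * rad (Suc j) - rad j"]) auto
    qed
  qed
next
  case (Uc k)
  with assms obtain l where k: "k = Suc l" by (cases k) (auto simp: coords_def)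
  have "2 * rad k - rad (k - 1) - rad (k + 1) \<le> norm (2 * h k - h (k - 1) - h (k + 1))"
    if "\<And>j. norm (h j) \<le> rad j" "norm (h k) = rad k" for h :: "nat \<Rightarrow> complex"
    using norm_combination[of 2 1 1 "h k" "h (k - 1)" "h (k + 1)"] that(1)[of "k - 1"] that(1)[of "k + 1"] that(2) by simp
  then show ?thesis using Uc rad_concave[of l] k
    by (intro that[of "2 * rad k - rad (k - 1) - rad (k + 1)"]) auto
qed

lemma torus_low_coord_form [torus_ok_intros]: "c \<in> coords d \<Longrightarrow> torus_low (coord_form c)"
  unfolding torus_low_def torus_set_def by (erule coord_form_lower) (force intro!: exI)

lemma torus_ok_coord_form [torus_ok_intros]:
  assumes "c \<in> coords d" shows "torus_ok {..d} (coord_form c)"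
proof (cases c)
  case (Ac i n)
  show ?thesis
  proof (cases "i < 3")
    case True
    then have "coord_form c = (\<lambda>h :: nat \<Rightarrow> complex. h n)" using Ac by (auto simp: fun_eq_iff)
    moreover have "n \<le> d" using True Ac assms by (auto simp: coords_def)
    ultimately show ?thesis by (auto intro!: torus_ok_intros)
  next
    case False
    with Ac assms have n: "n \<le> 3 * d" by (auto simp: coords_def)
    show ?thesis
    proof (cases "n mod 3 = 0")
      case True
      then have "coord_form c = (\<lambda>h :: nat \<Rightarrow> complex. of_nat 3 * h (n div 3))" using Ac False by (auto simp: fun_eq_iff)
      moreover have "n div 3 \<le> d" using n by simp
      ultimately show ?thesis by (auto intro!: torus_ok_intros)
    next
      case f: False
      then have "coord_form c = (\<lambda>h :: nat \<Rightarrow> complex. of_nat (3 - n mod 3) * h (n div 3) + of_nat (n mod 3) * h (n div 3 + 1))"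
        using Ac False by (auto simp: fun_eq_iff)
      moreover have "n div 3 + 1 \<le> d" using n f by presburger
      ultimately show ?thesis by (auto intro!: torus_ok_intros)
    qed
  qed
next
  case (Uc k)
  then have "coord_form c = (\<lambda>h :: nat \<Rightarrow> complex. 2 * h k - h (k - 1) - h (k + 1))" by (auto simp: fun_eq_iff)
  then show ?thesis using Uc assms by (auto simp: coords_def intro!: torus_ok_intros)
qed

lemma coord_form_holomorphic [holomorphic_intros]: "(\<lambda>z. coord_form c (h(i := z))) holomorphic_on A"
proof -
  have [holomorphic_intros]: "(\<lambda>z. (h(i := z)) j) holomorphic_on A" for j
    by (cases "j = i") (auto intro!: holomorphic_intros)
  show ?thesis
  proof (cases c)
    case (Ac m n)
    then show ?thesis
      by (cases "m < 3"; cases "n mod 3 = 0") (simp_all del: fun_upd_apply; intro holomorphic_intros)+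
  next
    case (Uc k)
    then show ?thesis by (simp del: fun_upd_apply) (intro holomorphic_intros)
  qed
qed

abbreviation coord_polys :: "nat \<Rightarrow> divisor_poly set" where
  "coord_polys d \<equiv> carrier (divisor_ring d)"

definition form_weight :: "nat \<Rightarrow> (nat \<Rightarrow> complex) \<Rightarrow> complex" where
  "form_weight d h = (\<Prod>i\<le>d. h i) / (\<Prod>c\<in>coords d. coord_form c h)"

definition form_coeff :: "nat \<Rightarrow> divisor_poly \<Rightarrow> (nat \<Rightarrow> complex) \<Rightarrow> complex" where
  "form_coeff k p h = coeff (graded_eval (\<lambda>c. coord_form c h) p) k"

text \<open>The residue of p divided by all coordinate classes; \<open>form_weight\<close> carries
  the product of the h_i that passes from residues to means. Keeping only the part of degree 6 d + 2
  makes vanishing in other degrees immediate.\<close>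

definition residue_functional :: "nat \<Rightarrow> divisor_poly \<Rightarrow> complex" where
  "residue_functional d p = torus_mean {..d} (\<lambda>h. form_coeff (6 * d + 2) p h * form_weight d h)"

lemma form_coeff_altdef:
  "form_coeff k p h = (\<Sum>m\<in>Poly_Mapping.keys p. if monomial_degree m = k then
     Poly_Mapping.lookup p m * (\<Prod>c\<in>Poly_Mapping.keys m. coord_form c h ^ Poly_Mapping.lookup m c) else 0)"
  unfolding form_coeff_def graded_eval_def coeff_sum
  by (intro sum.cong) (auto simp: monomial_value_def coeff_monom)

lemma form_coeff_ok [torus_ok_intros]:
  assumes "p \<in> coord_polys d" shows "torus_ok {..d} (form_coeff k p)"
proof -
  have "torus_ok {..d} (\<lambda>h. if monomial_degree m = k then
     Poly_Mapping.lookup p m * (\<Prod>c\<in>Poly_Mapping.keys m. coord_form c h ^ Poly_Mapping.lookup m c) else 0)"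
    if "m \<in> Poly_Mapping.keys p" for m
    using assms that by (cases "monomial_degree m = k") (auto simp: divisor_ring_def intro!: torus_ok_intros)
  then show ?thesis unfolding form_coeff_altdef[abs_def] by (intro torus_ok_intros)
qed

lemma form_coeff_holomorphic: "(\<lambda>z. form_coeff k p (h(i := z))) holomorphic_on A"
proof -
  have "(\<lambda>z. if monomial_degree m = k then Poly_Mapping.lookup p m *
      (\<Prod>c\<in>Poly_Mapping.keys m. coord_form c (h(i := z)) ^ Poly_Mapping.lookup m c) else 0) holomorphic_on A" for m
    by (cases "monomial_degree m = k") (auto intro!: holomorphic_intros)
  then show ?thesis unfolding form_coeff_altdef by (intro holomorphic_intros)
qed

lemma form_weight_ok [torus_ok_intros]: "torus_ok {..d} (form_weight d)"
  unfolding form_weight_def by (intro torus_ok_intros) auto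


lemma keys_divisor_var: "Poly_Mapping.keys (divisor_var c) = {Poly_Mapping.single c 1}"
  by (simp add: divisor_var_def)

lemma carrier_divisor_ring:
  "p \<in> coord_polys d \<longleftrightarrow> (\<forall>m\<in>Poly_Mapping.keys p. Poly_Mapping.keys m \<subseteq> coords d)"
  by (simp add: divisor_ring_def)

lemma divisor_ring_simps [simp]:
  "p \<otimes>\<^bsub>divisor_ring d\<^esub> q = p * q" "p \<oplus>\<^bsub>divisor_ring d\<^esub> q = p + q"
  "\<one>\<^bsub>divisor_ring d\<^esub> = 1" "\<zero>\<^bsub>divisor_ring d\<^esub> = 0"
  by (simp_all add: divisor_ring_def)

named_theorems divisor_carrier

lemma carrier_scalar [divisor_carrier]: "scalar z \<in> coord_polys d"
  by (auto simp: carrier_divisor_ring scalar_def)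

lemma carrier_0 [divisor_carrier]: "0 \<in> coord_polys d"
  by (simp add: carrier_divisor_ring)

lemma carrier_1 [divisor_carrier]: "1 \<in> coord_polys d"
  by (simp add: carrier_divisor_ring)

lemma carrier_numeral [divisor_carrier]: "numeral k \<in> coord_polys d"
  using carrier_scalar[of "numeral k" d] by (simp add: scalar_def)

lemma carrier_of_int [divisor_carrier]: "of_int k \<in> coord_polys d"
  using carrier_scalar[of "of_int k" d] by (simp add: scalar_def)

lemma carrier_var [divisor_carrier]: "c \<in> coords d \<Longrightarrow> divisor_var c \<in> coord_polys d"
  by (simp add: carrier_divisor_ring keys_divisor_var)

lemma carrier_add [divisor_carrier]:
  "p \<in> coord_polys d \<Longrightarrow> q \<in> coord_polys d \<Longrightarrow> p + q \<in> coord_polys d"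
  using keys_add[of p q] by (auto simp: carrier_divisor_ring)

lemma carrier_uminus [divisor_carrier]:
  "p \<in> coord_polys d \<Longrightarrow> - p \<in> coord_polys d"
  by (auto simp: carrier_divisor_ring in_keys_iff)

lemma carrier_mult [divisor_carrier]:
  assumes "p \<in> coord_polys d" "q \<in> coord_polys d"
  shows "p * q \<in> coord_polys d"
proof -
  have "Poly_Mapping.keys m \<subseteq> coords d" if m: "m \<in> Poly_Mapping.keys (p * q)" for m
  proof -
    obtain a b where ab: "m = a + b" "a \<in> Poly_Mapping.keys p" "b \<in> Poly_Mapping.keys q"
      using m keys_mult[of p q] by blast
    then show ?thesis using assms keys_add[of a b] unfolding carrier_divisor_ring by blast
  qed
  then show ?thesis by (simp add: carrier_divisor_ring)
qed

lemma carrier_prod [divisor_carrier]: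
  "(\<And>a. a \<in> A \<Longrightarrow> f a \<in> coord_polys d) \<Longrightarrow> (\<Prod>a\<in>A. f a) \<in> coord_polys d"
  by (induction A rule: infinite_finite_induct) (auto intro!: divisor_carrier)

lemma carrier_sum [divisor_carrier]:
  "(\<And>a. a \<in> A \<Longrightarrow> f a \<in> coord_polys d) \<Longrightarrow> (\<Sum>a\<in>A. f a) \<in> coord_polys d"
  by (induction A rule: infinite_finite_induct) (auto intro!: divisor_carrier)

lemma carrier_power [divisor_carrier]:
  "p \<in> coord_polys d \<Longrightarrow> p ^ n \<in> coord_polys d"
  by (induction n) (auto intro!: divisor_carrier)

lemma cring_divisor_ring: "cring (divisor_ring d)"
proof (intro cringI abelian_groupI comm_monoidI)
  fix x assume "x \<in> coord_polys d"
  then show "\<exists>y\<in>coord_polys d. y \<oplus>\<^bsub>divisor_ring d\<^esub> x = \<zero>\<^bsub>divisor_ring d\<^esub>"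
    by (intro bexI[of _ "- x"]) (auto intro!: divisor_carrier)
qed (auto intro!: divisor_carrier simp: algebra_simps)

interpretation divisor_ring: cring "divisor_ring d" for d by (rule cring_divisor_ring)

lemma residue_functional_add:
  assumes "p \<in> coord_polys d" "q \<in> coord_polys d"
  shows "residue_functional d (p + q) = residue_functional d p + residue_functional d q"
proof -
  have "residue_functional d (p + q) =
      torus_mean {..d} (\<lambda>h. form_coeff (6 * d + 2) p h * form_weight d h + form_coeff (6 * d + 2) q h * form_weight d h)"
    by (simp add: residue_functional_def form_coeff_def graded_eval_add algebra_simps)
  also have "\<dots> = residue_functional d p + residue_functional d q"
    unfolding residue_functional_def
    by (rule torus_mean_add) (auto intro!: torus_ok_intros assms)
  finally show ?thesis .
qed

lemma residue_functional_scalar: "residue_functional d (scalar z * p) = z * residue_functional d p"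
  by (simp add: residue_functional_def form_coeff_def graded_eval_mult graded_eval_scalar
      torus_mean_cmult[symmetric] mult.assoc)

lemma residue_functional_homogeneous:
  assumes "homogeneous_poly n p" "n \<noteq> 6 * d + 2"
  shows "residue_functional d p = 0"
  using graded_eval_homogeneous[OF assms(1)] assms(2)
  by (simp add: residue_functional_def form_coeff_def torus_mean_const)

lemma coord_form_nonzero:
  fixes h :: "nat \<Rightarrow> complex"
  assumes "c \<in> coords d" "\<And>j. norm (h j) \<le> rad j" "norm (h (coord_index c)) = rad (coord_index c)"
  shows "coord_form c h \<noteq> 0"
  using coord_form_lower[OF assms(1)] assms(2,3) by (metis norm_zero not_less)

text \<open>
  Without the factors in the group of $i$, the integrand is holomorphic in $h_i$.
\<close>
lemma residue_functional_group:
  assumes "i \<le> d" "q \<in> coord_polys d"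
  shows "residue_functional d ((\<Prod>c\<in>coord_group d i. divisor_var c) * q) = 0"
proof -
  let ?g = "coord_group d i"
  have fin: "finite ?g" and sub: "?g \<subseteq> coords d"
    using finite_coords[of d] by (auto simp: coord_group_def intro: rev_finite_subset)
  show ?thesis
    unfolding residue_functional_def
  proof (rule torus_mean_vanish[where i = i])
    show "torus_ok {..d} (\<lambda>h. form_coeff (6 * d + 2) ((\<Prod>c\<in>?g. divisor_var c) * q) h * form_weight d h)"
      using sub by (intro torus_ok_intros divisor_carrier assms) auto
    fix h assume h: "h \<in> torus_set"
    define k where "k = 6 * d + 2 - card ?g"
    define Q where "Q z = (if card ?g \<le> 6 * d + 2 then form_coeff k q (h(i := z)) else 0)" for z
    define G where "G z = Q z * (\<Prod>j\<in>{..d} - {i}. h j) / (\<Prod>c\<in>coords d - ?g. coord_form c (h(i := z)))" for z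
    have num: "form_coeff (6 * d + 2) ((\<Prod>c\<in>?g. divisor_var c) * q) (h(i := z)) =
        (\<Prod>c\<in>?g. coord_form c (h(i := z))) * Q z" for z
      by (auto simp: form_coeff_def graded_eval_mult graded_eval_prod prod_monom coeff_monom_mult Q_def k_def)
    have "G holomorphic_on cball 0 (rad i)"
      unfolding G_def
    proof (intro holomorphic_intros)
      show "Q holomorphic_on cball 0 (rad i)"
        by (cases "card ?g \<le> 6 * d + 2") (simp_all add: Q_def[abs_def] form_coeff_holomorphic)
      fix z :: complex assume z: "z \<in> cball 0 (rad i)"
      show "(\<Prod>c\<in>coords d - ?g. coord_form c (h(i := z))) \<noteq> 0"
      proof (subst prod_zero_iff)
        show "\<not> (\<exists>c\<in>coords d - ?g. coord_form c (h(i := z)) = 0)"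
        proof
          assume "\<exists>c\<in>coords d - ?g. coord_form c (h(i := z)) = 0"
          then obtain c where c: "c \<in> coords d" "c \<notin> ?g" "coord_form c (h(i := z)) = 0" by auto
          then have "coord_index c \<noteq> i" by (simp add: coord_group_def)
          then have "coord_form c (h(i := z)) \<noteq> 0"
            using z h c(1) by (intro coord_form_nonzero) (auto simp: torus_set_def)
          with c(3) show False by simp
        qed
      qed (use finite_coords in auto)
    qed
    moreover have "form_coeff (6 * d + 2) ((\<Prod>c\<in>?g. divisor_var c) * q) (h(i := z)) * form_weight d (h(i := z)) = z * G z"
      if "norm z = rad i" for z :: complex
    proof -
      have hz: "h(i := z) \<in> torus_set" by (rule torus_set_update[OF h that])
      have nz: "(\<Prod>c\<in>?g. coord_form c (h(i := z))) \<noteq> 0"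
        using fin sub torus_low_nonzero[OF torus_low_coord_form hz] by auto
      have "{..d} = insert i ({..d} - {i})" using assms(1) by auto
      then have "(\<Prod>j\<le>d. (h(i := z)) j) = (h(i := z)) i * (\<Prod>j\<in>{..d} - {i}. (h(i := z)) j)"
        by (metis Diff_iff finite_Diff finite_atMost insertCI prod.insert)
      also have "(\<Prod>j\<in>{..d} - {i}. (h(i := z)) j) = (\<Prod>j\<in>{..d} - {i}. h j)"
        by (rule prod.cong) auto
      finally have 1: "(\<Prod>j\<le>d. (h(i := z)) j) = z * (\<Prod>j\<in>{..d} - {i}. h j)" by simp
      have 2: "(\<Prod>c\<in>coords d. coord_form c (h(i := z))) =
          (\<Prod>c\<in>coords d - ?g. coord_form c (h(i := z))) * (\<Prod>c\<in>?g. coord_form c (h(i := z)))"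
        using prod.subset_diff[OF sub finite_coords] by blast
      show ?thesis unfolding num form_weight_def 1 2 G_def using nz by simp
    qed
    ultimately show "\<exists>g. g holomorphic_on cball 0 (rad i) \<and>
        (\<forall>z. norm z = rad i \<longrightarrow> form_coeff (6 * d + 2) ((\<Prod>c\<in>?g. divisor_var c) * q) (h(i := z)) *
           form_weight d (h(i := z)) = z * g z)" by blast
  qed (use assms in auto)
qed

section \<open>Stanley-Reisner and linear relations\<close>

lemma coord_group_eq:
  assumes "i \<le> d"
  shows "coord_group d i = {Ac 0 i, Ac 1 i, Ac 2 i} \<union> Ac 3 ` {n. n \<le> 3 * d \<and> (n + 1) div 3 = i} \<union> {Uc k | k. k = i \<and> 1 \<le> i \<and> i < d}"
    (is "_ = ?R")
proof -
  have "c \<in> coord_group d i \<longleftrightarrow> c \<in> ?R" for c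
  proof (cases c)
    case (Ac a n)
    consider "a = 0" | "a = 1" | "a = 2" | "a = 3" | "a > 3" by linarith
    then show ?thesis
      by cases (use assms in \<open>auto simp: Ac coord_group_def coords_def\<close>)
  qed (use assms in \<open>auto simp: coord_group_def coords_def\<close>)
  then show ?thesis by blast
qed

lemma div_3_eq_iff: "(m :: nat) div 3 = i \<longleftrightarrow> 3 * i \<le> m \<and> m < 3 * i + 3"
proof -
  have "m = 3 * (m div 3) + m mod 3" "m mod 3 < 3" by simp_all
  then show ?thesis by linarith
qed

lemma coord_group_0:
  assumes "d \<ge> 1" shows "coord_group d 0 = {Ac 0 0, Ac 1 0, Ac 2 0, Ac 3 0, Ac 3 1}"
proof -
  have "n \<le> 3 * d \<and> (n + 1) div 3 = 0 \<longleftrightarrow> n = 0 \<or> n = 1" for n using assms unfolding div_3_eq_iff by linarith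
  then have 1: "{n. n \<le> 3 * d \<and> (n + 1) div 3 = 0} = {0, 1}" by (simp only: set_eq_iff mem_Collect_eq insert_iff empty_iff) simp
  show ?thesis unfolding coord_group_eq[OF le0] 1 by auto
qed

lemma coord_group_d:
  assumes "d \<ge> 1" shows "coord_group d d = {Ac 0 d, Ac 1 d, Ac 2 d, Ac 3 (3 * d - 1), Ac 3 (3 * d)}"
proof -
  have "n \<le> 3 * d \<and> (n + 1) div 3 = d \<longleftrightarrow> n = 3 * d - 1 \<or> n = 3 * d" for n using assms unfolding div_3_eq_iff by linarith
  then have 1: "{n. n \<le> 3 * d \<and> (n + 1) div 3 = d} = {3 * d - 1, 3 * d}" by (simp only: set_eq_iff mem_Collect_eq insert_iff empty_iff) simp
  show ?thesis unfolding coord_group_eq[OF order_refl] 1 by auto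
qed

lemma coord_group_mid:
  assumes "i \<in> {1..<d}"
  shows "coord_group d i = {Ac 0 i, Ac 1 i, Ac 2 i, Ac 3 (3 * i - 1), Ac 3 (3 * i), Ac 3 (3 * i + 1), Uc i}"
proof -
  have i: "1 \<le> i" "i < d" using assms by auto
  then have "n \<le> 3 * d \<and> (n + 1) div 3 = i \<longleftrightarrow> n = 3 * i - 1 \<or> n = 3 * i \<or> n = 3 * i + 1" for n unfolding div_3_eq_iff by linarith
  then have 1: "{n. n \<le> 3 * d \<and> (n + 1) div 3 = i} = {3 * i - 1, 3 * i, 3 * i + 1}" by (simp only: set_eq_iff mem_Collect_eq insert_iff empty_iff) simp
  have 2: "{Uc k | k. k = i \<and> 1 \<le> i \<and> i < d} = {Uc i}" using i by auto
  show ?thesis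
    unfolding coord_group_eq[OF less_imp_le[OF i(2)]] 1 2 by auto
qed

text \<open>The first, middle and last lists in the definition of U are exactly the groups, which
  gives the three shapes a uniform description.\<close>

lemma semistable_iff:
  assumes "d \<ge> 1"
  shows "x \<in> semistable d \<longleftrightarrow> (\<forall>c. c \<notin> coords d \<longrightarrow> x c = 0) \<and> (\<forall>i\<le>d. \<exists>c\<in>coord_group d i. x c \<noteq> 0)"
proof -
  have "(\<forall>i\<le>d. P i) \<longleftrightarrow> P 0 \<and> (\<forall>i\<in>{1..<d}. P i) \<and> P d" for P :: "nat \<Rightarrow> bool"
  proof
    assume r: "P 0 \<and> (\<forall>i\<in>{1..<d}. P i) \<and> P d"
    show "\<forall>i\<le>d. P i"
    proof (intro allI impI)
      fix i assume "i \<le> d"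
      then consider "i = 0" | "1 \<le> i" "i < d" | "i = d" by linarith
      then show "P i" by cases (use r in simp_all)
    qed
  qed simp
  then have s: "(\<forall>i\<le>d. \<exists>c\<in>coord_group d i. x c \<noteq> 0) \<longleftrightarrow> (\<exists>c\<in>coord_group d 0. x c \<noteq> 0) \<and>
     (\<forall>i\<in>{1..<d}. \<exists>c\<in>coord_group d i. x c \<noteq> 0) \<and> (\<exists>c\<in>coord_group d d. x c \<noteq> 0)" .
  have m: "(\<forall>i\<in>{1..<d}. \<exists>c\<in>coord_group d i. x c \<noteq> 0) \<longleftrightarrow> (\<forall>i\<in>{1..<d}. \<exists>c\<in>{Ac 0 i, Ac 1 i, Ac 2 i,
      Ac 3 (3 * i - 1), Ac 3 (3 * i), Ac 3 (3 * i + 1), Uc i}. x c \<noteq> 0)"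
    by (intro ball_cong refl) (simp only: coord_group_mid)
  show ?thesis
    unfolding s m unfolding semistable_def mem_Collect_eq coord_group_0[OF assms] coord_group_d[OF assms] ..
qed

lemma mem_orbit_of: "x \<in> orbit_of d x"
proof -
  have "weight_factor (\<lambda>_. 1) c = 1" for c by (cases c) auto
  then have "torus_act (\<lambda>_. 1) x = x" by (simp add: torus_act_def)
  moreover have "(\<lambda>_. 1) \<in> torus d" by (simp add: torus_def)
  ultimately show ?thesis unfolding orbit_of_def by (metis (mono_tags, lifting) mem_Collect_eq)
qed

lemma stanley_reisner_iff:
  assumes "d \<ge> 1" "S \<subseteq> coords d"
  shows "moduli_space d \<inter> (\<Inter>c\<in>S. coord_divisor d c) = {} \<longleftrightarrow> (\<exists>i\<le>d. coord_group d i \<subseteq> S)"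
proof
  assume e: "moduli_space d \<inter> (\<Inter>c\<in>S. coord_divisor d c) = {}"
  show "\<exists>i\<le>d. coord_group d i \<subseteq> S"
  proof (rule ccontr)
    assume n: "\<not> (\<exists>i\<le>d. coord_group d i \<subseteq> S)"
    \<comment> \<open>A witness whose vanishing coordinates are as few as S permits: it is
      semistable because no group lies inside S.\<close>
    define x :: "coord \<Rightarrow> complex" where "x c = (if c \<in> coords d - S then 1 else 0)" for c
    have x: "x \<in> semistable d"
      unfolding semistable_iff[OF assms(1)]
    proof (intro conjI allI impI)
      fix i assume "i \<le> d"
      then obtain c where "c \<in> coord_group d i" "c \<notin> S" using n by blast
      then show "\<exists>c\<in>coord_group d i. x c \<noteq> 0" by (auto simp: x_def coord_group_def)
    qed (simp add: x_def)
    have "orbit_of d x \<in> moduli_space d \<inter> (\<Inter>c\<in>S. coord_divisor d c)"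
      using x by (auto simp: moduli_space_def coord_divisor_def x_def)
    then show False using e by blast
  qed
next
  assume "\<exists>i\<le>d. coord_group d i \<subseteq> S"
  then obtain i where i: "i \<le> d" "coord_group d i \<subseteq> S" by blast
  show "moduli_space d \<inter> (\<Inter>c\<in>S. coord_divisor d c) = {}"
  proof (rule ccontr)
    assume "\<not> ?thesis"
    then obtain X where X: "X \<in> moduli_space d" "\<And>c. c \<in> S \<Longrightarrow> X \<in> coord_divisor d c" by blast
    then obtain x where x: "x \<in> semistable d" "X = orbit_of d x" by (auto simp: moduli_space_def)
    have "x c = 0" if "c \<in> S" for c
    proof -
      obtain y where y: "X = orbit_of d y" "y c = 0" using X(2)[OF \<open>c \<in> S\<close>] by (auto simp: coord_divisor_def)
      \<comment> \<open>The torus only rescales coordinates, so the vanishing of one of them at y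
        carries over to every point of the orbit.\<close>
      have "x \<in> orbit_of d y" using mem_orbit_of[of x d] x(2) y(1) by simp
      then show ?thesis using y(2) by (auto simp: orbit_of_def torus_act_def)
    qed
    moreover obtain c where "c \<in> coord_group d i" "x c \<noteq> 0"
      using x(1) i(1) unfolding semistable_iff[OF assms(1)] by blast
    ultimately show False using i(2) by blast
  qed
qed

lemma invariant_exponents_form:
  fixes h :: "nat \<Rightarrow> complex"
  assumes "m \<in> invariant_exponents d"
  shows "(\<Sum>c\<in>coords d. of_int (m c) * coord_form c h) = 0" (is "?s = 0")
proof (rule ccontr)
  assume s: "?s \<noteq> 0"
  \<comment> \<open>Chosen so that the torus element exp(t h_j) multiplies the monomial by exp 1,
    which contradicts invariance.\<close>
  define t where "t = 1 / ?s"
  define l where "l j = exp (t * h j)" for j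
  have w: "weight_factor l c = exp (t * coord_form c h)" for c
  proof (cases c)
    case (Ac i n)
    then show ?thesis
      by (cases "n mod 3 = 0") (auto simp: l_def exp_add[symmetric] exp_of_nat_mult[symmetric] algebra_simps)
  next
    case (Uc k)
    have "weight_factor l c = exp (2 * (t * h k) - (t * h (k - 1) + t * h (k + 1)))"
      unfolding Uc by (simp add: l_def exp_diff exp_add exp_double)
    also have "2 * (t * h k) - (t * h (k - 1) + t * h (k + 1)) = t * coord_form c h"
      unfolding Uc by (simp add: algebra_simps)
    finally show ?thesis .
  qed
  have "l \<in> torus d" by (simp add: torus_def l_def)
  then have "(\<Prod>c\<in>coords d. torus_act l (\<lambda>_. 1) c powi m c) = (\<Prod>c\<in>coords d. 1 powi m c)"
    using assms unfolding invariant_exponents_def by fastforce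
  also have "(\<Prod>c\<in>coords d. torus_act l (\<lambda>_. 1) c powi m c) = (\<Prod>c\<in>coords d. exp (t * (of_int (m c) * coord_form c h)))"
    by (intro prod.cong) (simp_all add: torus_act_def w exp_power_int mult_ac)
  also have "\<dots> = exp (t * ?s)"
    by (simp add: exp_sum finite_coords sum_distrib_left)
  also have "t * ?s = 1" using s by (simp add: t_def)
  finally show False by (simp add: exp_eq_1)
qed

fun coord_weight :: "coord \<Rightarrow> nat \<Rightarrow> int" where
  "coord_weight (Ac i n) j = (if i < 3 then (if j = n then 1 else 0)
     else (if j = n div 3 then int (3 - n mod 3) else 0) + (if j = n div 3 + 1 then int (n mod 3) else 0))"
| "coord_weight (Uc k) j = (if j = k then 2 else 0) - (if j = k - 1 then 1 else 0) - (if j = k + 1 then 1 else 0)"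

lemma if_mult_zero: "of_int (if P then a else 0) * (x :: 'a :: comm_ring_1) = (if P then of_int a * x else 0)"
  by simp

lemma coord_form_weights:
  fixes h :: "nat \<Rightarrow> 'a :: comm_ring_1"
  assumes "c \<in> coords d"
  shows "(\<Sum>j\<le>d. of_int (coord_weight c j) * h j) = coord_form c h"
proof (cases c)
  case (Ac i n)
  have "n div 3 + 1 \<le> d" if "\<not> i < 3" "n mod 3 \<noteq> 0"
  proof -
    have "n \<le> 3 * d" using that(1) assms Ac by (auto simp: coords_def)
    with that(2) show ?thesis by presburger
  qed
  moreover have "n div 3 \<le> d" if "\<not> i < 3" using that assms Ac by (auto simp: coords_def)
  moreover have "n \<le> d" if "i < 3" using that assms Ac by (auto simp: coords_def)
  ultimately show ?thesis unfolding Ac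
    by (cases "i < 3"; cases "n mod 3 = 0")
       (simp_all add: distrib_right sum.distrib if_mult_zero sum.delta del: of_nat_diff of_nat_mod)
next
  case (Uc k)
  with assms have "1 \<le> k" "k < d" by (auto simp: coords_def)
  then show ?thesis unfolding Uc
    by (simp add: left_diff_distrib sum_subtractf if_mult_zero sum.delta)
qed

lemma powi_if: "(x :: complex) powi (if P then a else 0) = (if P then x powi a else 1)"
  by simp

lemma weight_factor_weights:
  assumes "c \<in> coords d" "l \<in> torus d"
  shows "(\<Prod>j\<le>d. l j powi coord_weight c j) = weight_factor l c"
proof (cases c)
  case (Ac i n)
  have l: "l j \<noteq> 0" if "j \<le> d" for j using assms(2) that by (simp add: torus_def)
  have 1: "n div 3 + 1 \<le> d" if "\<not> i < 3" "n mod 3 \<noteq> 0"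
  proof -
    have "n \<le> 3 * d" using that(1) assms Ac by (auto simp: coords_def)
    with that(2) show ?thesis by presburger
  qed
  have 2: "n div 3 \<le> d" if "\<not> i < 3" using that assms Ac by (auto simp: coords_def)
  have 3: "n \<le> d" if "i < 3" using that assms Ac by (auto simp: coords_def)
  show ?thesis
  proof (cases "i < 3")
    case True
    then show ?thesis unfolding Ac using 3 by (simp add: powi_if prod.delta)
  next
    case False
    have "(\<Prod>j\<le>d. l j powi coord_weight c j) =
       (\<Prod>j\<le>d. (if j = n div 3 then l j powi int (3 - n mod 3) else 1) * (if j = n div 3 + 1 then l j powi int (n mod 3) else 1))"
      using False l by (intro prod.cong) (auto simp: Ac power_int_add)
    also have "\<dots> = weight_factor l c"
      using False 1 2 unfolding Ac prod.distrib by (cases "n mod 3 = 0") (simp_all add: prod.delta del: of_nat_diff of_nat_mod)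
    finally show ?thesis .
  qed
next
  case (Uc k)
  with assms have k: "1 \<le> k" "k < d" by (auto simp: coords_def)
  have l: "l j \<noteq> 0" if "j \<le> d" for j using assms(2) that by (simp add: torus_def)
  have "(\<Prod>j\<le>d. l j powi coord_weight c j) = (\<Prod>j\<le>d. (if j = k then l j powi 2 else 1) *
      (if j = k - 1 then l j powi (-1) else 1) * (if j = k + 1 then l j powi (-1) else 1))"
    using k l by (intro prod.cong) (auto simp: Uc)
  also have "\<dots> = weight_factor l c"
    using k l unfolding Uc prod.distrib by (simp add: prod.delta field_simps)
  finally show ?thesis .
qed

lemma coord_relation:
  assumes e: "e \<in> coords d"
  shows "divisor_var e - coord_form e H \<in> linear_relations d"
proof -
  \<comment> \<open>The character behind the relation is the coordinate e divided by the product of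
    the a_(0,j) raised to the weights of e.\<close>
  define a where "a c = (case c of Ac i n \<Rightarrow> if i = 0 then coord_weight e n else 0 | Uc k \<Rightarrow> 0)" for c
  define m where "m c = (if c = e then 1 else 0) - a c" for c
  have sub: "Ac 0 ` {..d} \<subseteq> coords d" by (auto simp: coords_def)
  have a0: "a c = 0" if "c \<in> coords d - Ac 0 ` {..d}" for c
    using that by (cases c) (auto simp: a_def coords_def)
  have "m \<in> invariant_exponents d"
    unfolding invariant_exponents_def
  proof (intro CollectI ballI allI impI)
    fix l x assume l: "l \<in> torus d" and x: "\<forall>c\<in>coords d. x c \<noteq> (0 :: complex)"
    have lz: "l j \<noteq> 0" if "j \<le> d" for j using l that by (simp add: torus_def)
    have wz: "weight_factor l c \<noteq> 0" if "c \<in> coords d" for c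
      unfolding weight_factor_weights[OF that l, symmetric] using lz by (simp add: power_int_eq_0_iff)
    have "(\<Prod>c\<in>coords d. weight_factor l c powi m c) =
        (\<Prod>c\<in>coords d. (if c = e then weight_factor l c else 1) * inverse (weight_factor l c powi a c))"
      using wz by (intro prod.cong) (auto simp: m_def power_int_diff power_int_minus field_simps)
    also have "\<dots> = weight_factor l e * inverse (\<Prod>c\<in>coords d. weight_factor l c powi a c)"
      using e finite_coords by (simp add: prod.distrib prod.delta prod_inversef[unfolded o_def])
    also have "(\<Prod>c\<in>coords d. weight_factor l c powi a c) = (\<Prod>c\<in>Ac 0 ` {..d}. weight_factor l c powi a c)"
      by (rule prod.mono_neutral_right) (use a0 sub finite_coords in auto)
    also have "\<dots> = (\<Prod>j\<le>d. l j powi coord_weight e j)"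
      by (subst prod.reindex) (auto simp: inj_on_def a_def)
    also have "\<dots> = weight_factor l e" by (rule weight_factor_weights[OF e l])
    finally have "(\<Prod>c\<in>coords d. weight_factor l c powi m c) = 1" using wz[OF e] by simp
    then show "(\<Prod>c\<in>coords d. torus_act l x c powi m c) = (\<Prod>c\<in>coords d. x c powi m c)"
      by (simp add: torus_act_def power_int_mult_distrib prod.distrib)
  qed
  moreover have "(\<Sum>c\<in>coords d. of_int (m c) * divisor_var c) = divisor_var e - coord_form e H"
  proof -
    have "(\<Sum>c\<in>coords d. of_int (m c) * divisor_var c) =
       (\<Sum>c\<in>coords d. (if c = e then divisor_var c else 0) - of_int (a c) * divisor_var c)"
      by (intro sum.cong) (auto simp: m_def algebra_simps)
    also have "\<dots> = divisor_var e - (\<Sum>c\<in>coords d. of_int (a c) * divisor_var c)"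
      using e finite_coords by (simp add: sum_subtractf sum.delta)
    also have "(\<Sum>c\<in>coords d. of_int (a c) * divisor_var c) = (\<Sum>c\<in>Ac 0 ` {..d}. of_int (a c) * divisor_var c)"
      by (rule sum.mono_neutral_right) (use a0 sub finite_coords in auto)
    also have "\<dots> = (\<Sum>j\<le>d. of_int (coord_weight e j) * H j)"
      by (subst sum.reindex) (auto simp: inj_on_def a_def H_def)
    also have "\<dots> = coord_form e H" by (rule coord_form_weights[OF e])
    finally show ?thesis .
  qed
  ultimately show ?thesis unfolding linear_relations_def by (metis (mono_tags, lifting) mem_Collect_eq)
qed


definition base_coords :: "nat \<Rightarrow> coord set" where "base_coords d = Ac 0 ` {..d}"

definition vol_form :: "nat \<Rightarrow> (nat \<Rightarrow> 'a) \<Rightarrow> 'a :: comm_ring_1" where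
  "vol_form d h = 3 ^ (d + 1) * (\<Prod>i = 0..d. h i ^ 3) *
     (\<Prod>i = 0..<d. (2 * h i + h (i + 1)) * (h i + 2 * h (i + 1))) *
     (\<Prod>k = 1..<d. - h (k - 1) + 2 * h k - h (k + 1))"

lemma Vol_eq_vol_form: "Vol d = vol_form d H"
  by (simp add: Vol_def vol_form_def)

text \<open>Explains the formula for the volume class: the smooth point is the one where only the
  a_(0,j) are nonzero, and it is cut out by all the other coordinate divisors.\<close>

lemma prod_coord_form:
  fixes h :: "nat \<Rightarrow> 'a :: comm_ring_1"
  shows "(\<Prod>c\<in>coords d - base_coords d. coord_form c h) = vol_form d h"
proof -
  have A3: "(\<Prod>n\<le>3 * d. coord_form (Ac 3 n) h) = 3 ^ (d + 1) * (\<Prod>i = 0..d. h i) *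
     (\<Prod>i = 0..<d. (2 * h i + h (i + 1)) * (h i + 2 * h (i + 1)))" for d
  proof (induction d)
    case (Suc d)
    have s: "{..3 * Suc d} = insert (Suc (Suc (Suc (3 * d)))) (insert (Suc (Suc (3 * d))) (insert (Suc (3 * d)) {..3 * d}))" by auto
    have f: "coord_form (Ac 3 (Suc (Suc (Suc (3 * d))))) h = 3 * h (Suc d)"
      "coord_form (Ac 3 (Suc (Suc (3 * d)))) h = h d + 2 * h (Suc d)" "coord_form (Ac 3 (Suc (3 * d))) h = 2 * h d + h (Suc d)"
    proof -
      have "(Suc (Suc (Suc (3 * d)))) div 3 = Suc d" "(Suc (Suc (Suc (3 * d)))) mod 3 = 0" "(Suc (Suc (3 * d))) div 3 = d" "(Suc (Suc (3 * d))) mod 3 = 2"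
         "(Suc (3 * d)) div 3 = d" "(Suc (3 * d)) mod 3 = 1" by presburger+
      then show "coord_form (Ac 3 (Suc (Suc (Suc (3 * d))))) h = 3 * h (Suc d)"
        "coord_form (Ac 3 (Suc (Suc (3 * d)))) h = h d + 2 * h (Suc d)" "coord_form (Ac 3 (Suc (3 * d))) h = 2 * h d + h (Suc d)"
        by simp_all
    qed
    have "(\<Prod>n\<le>3 * Suc d. coord_form (Ac 3 n) h) =
       3 * h (Suc d) * ((h d + 2 * h (Suc d)) * ((2 * h d + h (Suc d)) * (\<Prod>n\<le>3 * d. coord_form (Ac 3 n) h)))"
      unfolding s by (simp del: coord_form.simps add: f)
    then show ?case unfolding Suc.IH by (simp add: mult_ac)
  qed simp
  have e: "coords d - base_coords d = (Ac 1 ` {..d} \<union> Ac 2 ` {..d}) \<union> (Ac 3 ` {..3 * d} \<union> Uc ` {1..<d})"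
  proof -
    have 1: "{Ac i j | i j. i < 3 \<and> j \<le> d} = Ac 0 ` {..d} \<union> Ac 1 ` {..d} \<union> Ac 2 ` {..d}"
    proof -
      have "{Ac i j | i j. i < 3 \<and> j \<le> d} = (\<Union>i\<in>{..<3}. Ac i ` {..d})" by auto
      also have "{..<3 :: nat} = {0, 1, 2}" by auto
      finally show ?thesis by (simp only: UN_insert UN_empty Un_empty_right Un_assoc)
    qed
    have 2: "{Ac 3 n | n. n \<le> 3 * d} = Ac 3 ` {..3 * d}" "{Uc k | k. 1 \<le> k \<and> k < d} = Uc ` {1..<d}" by auto
    have "A0 \<union> A1 \<union> A2 \<union> A3 \<union> U - A0 = (A1 \<union> A2) \<union> (A3 \<union> U)"
      if "A1 \<inter> A0 = {}" "A2 \<inter> A0 = {}" "A3 \<inter> A0 = {}" "U \<inter> A0 = {}" for A0 A1 A2 A3 U :: "coord set"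
      using that by blast
    then show ?thesis unfolding coords_def base_coords_def 1 2 by (rule) auto
  qed
  have split: "prod f (coords d - base_coords d) =
     ((\<Prod>j\<le>d. f (Ac 1 j)) * (\<Prod>j\<le>d. f (Ac 2 j))) * ((\<Prod>n\<le>3 * d. f (Ac 3 n)) * (\<Prod>k = 1..<d. f (Uc k)))"
    for f :: "coord \<Rightarrow> 'a"
  proof -
    have "prod f (coords d - base_coords d) = prod f (Ac 1 ` {..d} \<union> Ac 2 ` {..d}) * prod f (Ac 3 ` {..3 * d} \<union> Uc ` {1..<d})"
      unfolding e by (rule prod.union_disjoint) auto
    also have "prod f (Ac 1 ` {..d} \<union> Ac 2 ` {..d}) = prod f (Ac 1 ` {..d}) * prod f (Ac 2 ` {..d})"
      by (rule prod.union_disjoint) auto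
    also have "prod f (Ac 3 ` {..3 * d} \<union> Uc ` {1..<d}) = prod f (Ac 3 ` {..3 * d}) * prod f (Uc ` {1..<d})"
      by (rule prod.union_disjoint) auto
    finally show ?thesis by (simp add: prod.reindex inj_on_def)
  qed
  note coord_form.simps[simp del]
  have Ac12: "coord_form (Ac 1 j) h = h j" "coord_form (Ac 2 j) h = h j" "coord_form (Uc k) h = 2 * h k - h (k - 1) - h (k + 1)" for j k
    by (simp_all add: coord_form.simps)
  have "(\<Prod>c\<in>coords d - base_coords d. coord_form c h) =
     ((\<Prod>j\<le>d. h j) * (\<Prod>j\<le>d. h j)) * ((\<Prod>n\<le>3 * d. coord_form (Ac 3 n) h) * (\<Prod>k = 1..<d. 2 * h k - h (k - 1) - h (k + 1)))"
    unfolding split Ac12 ..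
  also have "\<dots> = vol_form d h"
  proof -
    have p3: "(\<Prod>i = 0..d. h i ^ 3) = (\<Prod>i = 0..d. h i) * (\<Prod>i = 0..d. h i) * (\<Prod>i = 0..d. h i)"
      by (simp add: prod.distrib power3_eq_cube)
    have pu: "(\<Prod>k = 1..<d. 2 * h k - h (k - 1) - h (k + 1)) = (\<Prod>k = 1..<d. - h (k - 1) + 2 * h k - h (k + 1))"
      by (intro prod.cong) simp_all
    have ac: "(a * a) * ((t * a * e) * u) = t * (a * a * a) * e * u" for a t e u :: 'a
      by (simp only: mult_ac)
    show ?thesis
      unfolding A3 unfolding vol_form_def atMost_atLeast0 p3 pu by (rule ac)
  qed
  finally show ?thesis .
qed

lemma base_coords_subset: "base_coords d \<subseteq> coords d"
  by (auto simp: base_coords_def coords_def)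

lemma prod_H_base: "(\<Prod>c\<in>base_coords d. coord_form c h) = (\<Prod>i\<le>d. h i)"
  by (simp add: base_coords_def prod.reindex inj_on_def)

lemma graded_eval_coord_form_H: "graded_eval (\<lambda>c. coord_form c h) (coord_form c H) = monom (coord_form c h) 1"
proof -
  have H: "graded_eval (\<lambda>c. coord_form c h) (H j) = monom (h j) 1" for j by (simp add: H_def)
  have n: "of_nat k * monom a (Suc 0) = monom (of_nat k * a) (Suc 0)"
      "numeral l * monom a (Suc 0) = monom (numeral l * a) (Suc 0)" for k l and a :: complex
    by (simp_all add: of_nat_poly numeral_poly smult_monom)
  show ?thesis
  proof (cases c)
    case (Ac i k)
    then show ?thesis
      by (simp add: graded_eval_add graded_eval_mult H n add_monom del: of_nat_diff)
  next
    case (Uc k)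
    then show ?thesis
      by (simp add: graded_eval_diff graded_eval_mult H n diff_monom)
  qed
qed

text \<open>The volume class cancels every factor of the denominator except the product of the h_i,
  so the integrand is constantly 1.\<close>

lemma residue_functional_Vol:
  assumes "d \<ge> 1"
  shows "residue_functional d (Vol d) = 1"
proof -
  have card: "card (coords d - base_coords d) = 6 * d + 2"
  proof -
    have "card (base_coords d) = d + 1" by (simp add: base_coords_def card_image inj_on_def)
    moreover have "card (coords d - base_coords d) = card (coords d) - card (base_coords d)"
      by (rule card_Diff_subset) (simp_all add: base_coords_subset, simp add: base_coords_def)
    ultimately show ?thesis using card_coords[OF assms] by simp
  qed
  have "graded_eval (\<lambda>c. coord_form c h) (Vol d) = monom (\<Prod>c\<in>coords d - base_coords d. coord_form c h) (6 * d + 2)" for h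
    unfolding Vol_eq_vol_form prod_coord_form[symmetric] graded_eval_prod graded_eval_coord_form_H prod_monom
    by (simp add: card)
  then have f: "form_coeff (6 * d + 2) (Vol d) h = (\<Prod>c\<in>coords d - base_coords d. coord_form c h)" for h
    by (simp add: form_coeff_def)
  have "residue_functional d (Vol d) = torus_mean {..d} (\<lambda>h. 1)"
    unfolding residue_functional_def
  proof (rule torus_mean_cong)
    fix h assume h: "h \<in> torus_set"
    have "(\<Prod>c\<in>coords d. coord_form c h) = (\<Prod>c\<in>coords d - base_coords d. coord_form c h) * (\<Prod>i\<le>d. h i)"
      unfolding prod_H_base[symmetric] by (rule prod.subset_diff[OF base_coords_subset finite_coords])
    moreover have "(\<Prod>c\<in>coords d. coord_form c h) \<noteq> 0"
      using torus_low_nonzero[OF torus_low_coord_form h] by (simp add: finite_coords)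
    ultimately show "form_coeff (6 * d + 2) (Vol d) h * form_weight d h = 1"
      unfolding f form_weight_def by simp
  qed
  then show ?thesis by (simp add: torus_mean_const)
qed

lemma coord_group_subset: "coord_group d i \<subseteq> coords d"
  by (auto simp: coord_group_def)

lemma chow_relations_carrier:
  "linear_relations d \<union> stanley_reisner_relations d \<subseteq> coord_polys d"
proof -
  have "(\<Sum>c\<in>coords d. of_int (m c) * divisor_var c) \<in> coord_polys d" for m
    by (intro divisor_carrier)
  moreover have "(\<Prod>c\<in>S. divisor_var c) \<in> coord_polys d" if "S \<subseteq> coords d" for S
    using that by (intro divisor_carrier) auto
  ultimately show ?thesis unfolding linear_relations_def stanley_reisner_relations_def by auto
qed

lemma ideal_chow_ideal: "ideal (chow_ideal d) (divisor_ring d)"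
  unfolding chow_ideal_def by (rule divisor_ring.genideal_ideal[OF chow_relations_carrier])

lemma chow_relations_subset: "linear_relations d \<union> stanley_reisner_relations d \<subseteq> chow_ideal d"
  unfolding chow_ideal_def by (rule divisor_ring.genideal_self[OF chow_relations_carrier])

lemma chow_ideal_carrier: "p \<in> chow_ideal d \<Longrightarrow> p \<in> coord_polys d"
  by (rule ideal.Icarr[OF ideal_chow_ideal])

lemma chow_ideal_add: "p \<in> chow_ideal d \<Longrightarrow> q \<in> chow_ideal d \<Longrightarrow> p + q \<in> chow_ideal d"
  using additive_subgroup.a_closed[OF ideal.axioms(1)[OF ideal_chow_ideal], of p d q] by simp

lemma chow_ideal_mult: "p \<in> chow_ideal d \<Longrightarrow> q \<in> coord_polys d \<Longrightarrow> p * q \<in> chow_ideal d"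
  using ideal.I_r_closed[OF ideal_chow_ideal, of p d q] by simp

lemma coord_group_prod_in_chow_ideal:
  assumes "d \<ge> 1" "i \<le> d" shows "(\<Prod>c\<in>coord_group d i. divisor_var c) \<in> chow_ideal d"
proof -
  have "(\<Prod>c\<in>coord_group d i. divisor_var c) \<in> stanley_reisner_relations d"
    using stanley_reisner_iff[OF assms(1) coord_group_subset] assms(2) coord_group_subset
    unfolding stanley_reisner_relations_def by blast
  then show ?thesis using chow_relations_subset by blast
qed

lemma residue_functional_chow_ideal:
  assumes "d \<ge> 1" "p \<in> chow_ideal d"
  shows "residue_functional d p = 0"
proof -
  \<comment> \<open>The largest ideal on which the functional vanishes, so only the generators of
    \<open>chow_ideal\<close> have to be tested.\<close>
  define K where "K = {p \<in> coord_polys d. \<forall>q\<in>coord_polys d. residue_functional d (p * q) = 0}"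
  have "ideal K (divisor_ring d)"
  proof (rule idealI)
    show "ring (divisor_ring d)" by (rule divisor_ring.ring_axioms)
    show "subgroup K (add_monoid (divisor_ring d))"
    proof (rule subgroup.intro)
      show "K \<subseteq> carrier (add_monoid (divisor_ring d))" by (auto simp: K_def)
    next
      fix x y assume "x \<in> K" "y \<in> K"
      then show "x \<otimes>\<^bsub>add_monoid (divisor_ring d)\<^esub> y \<in> K"
        by (auto simp: K_def distrib_right residue_functional_add divisor_carrier)
    next
      show "\<one>\<^bsub>add_monoid (divisor_ring d)\<^esub> \<in> K"
        by (auto simp: K_def divisor_carrier residue_functional_def form_coeff_def torus_mean_const)
    next
      fix x assume x: "x \<in> K"
      then have "- x \<in> K"
      proof -
        have "residue_functional d (- x * q) = 0" if "q \<in> coord_polys d" for q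
        proof -
          have "- x * q = x * (- q)" by simp
          moreover have "- q \<in> coord_polys d" using that by (rule carrier_uminus)
          moreover have "\<forall>q\<in>coord_polys d. residue_functional d (x * q) = 0"
            using x by (simp add: K_def)
          ultimately show ?thesis by (simp only:)
        qed
        then show ?thesis using x by (simp add: K_def carrier_uminus)
      qed
      moreover have "inv\<^bsub>add_monoid (divisor_ring d)\<^esub> x = - x"
        unfolding a_inv_def[symmetric] using x
        by (intro divisor_ring.minus_equality) (simp_all add: K_def carrier_uminus)
      ultimately show "inv\<^bsub>add_monoid (divisor_ring d)\<^esub> x \<in> K" by simp
    qed
  next
    fix a x assume ax: "a \<in> K" "x \<in> coord_polys d"
    have "residue_functional d (a * x * q) = 0" if "q \<in> coord_polys d" for q
      using ax that by (simp add: K_def mult.assoc carrier_mult)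
    then show "x \<otimes>\<^bsub>divisor_ring d\<^esub> a \<in> K" "a \<otimes>\<^bsub>divisor_ring d\<^esub> x \<in> K"
      using ax by (simp_all add: K_def carrier_mult mult.commute[of x])
  qed
  moreover have "linear_relations d \<union> stanley_reisner_relations d \<subseteq> K"
  proof
    fix r assume r: "r \<in> linear_relations d \<union> stanley_reisner_relations d"
    have rc: "r \<in> coord_polys d" using r chow_relations_carrier by blast
    have "residue_functional d (r * q) = 0" if q: "q \<in> coord_polys d" for q
      using r
    proof
      assume "r \<in> linear_relations d"
      then obtain m where m: "m \<in> invariant_exponents d" "r = (\<Sum>c\<in>coords d. of_int (m c) * divisor_var c)"
        by (auto simp: linear_relations_def)
      have "graded_eval (\<lambda>c. coord_form c h) r = monom (\<Sum>c\<in>coords d. of_int (m c) * coord_form c h) 1" for h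
        by (simp add: m(2) graded_eval_sum graded_eval_mult monom_sum of_int_poly smult_monom)
      then have "graded_eval (\<lambda>c. coord_form c h) (r * q) = 0" for h
        using invariant_exponents_form[OF m(1), of h] by (simp add: graded_eval_mult)
      then show ?thesis by (simp add: residue_functional_def form_coeff_def torus_mean_const)
    next
      assume "r \<in> stanley_reisner_relations d"
      then obtain S where S: "S \<subseteq> coords d" "r = (\<Prod>c\<in>S. divisor_var c)"
          "moduli_space d \<inter> (\<Inter>c\<in>S. coord_divisor d c) = {}"
        by (auto simp: stanley_reisner_relations_def)
      then obtain i where i: "i \<le> d" "coord_group d i \<subseteq> S"
        using stanley_reisner_iff[OF assms(1) S(1)] by blast
      have "r * q = (\<Prod>c\<in>coord_group d i. divisor_var c) * ((\<Prod>c\<in>S - coord_group d i. divisor_var c) * q)"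
        unfolding S(2) using prod.subset_diff[OF i(2), of divisor_var] finite_subset[OF S(1) finite_coords]
        by (simp add: mult_ac)
      moreover have "(\<Prod>c\<in>S - coord_group d i. divisor_var c) * q \<in> coord_polys d"
        using S(1) q by (intro divisor_carrier) auto
      ultimately show ?thesis using residue_functional_group[OF i(1)] by simp
    qed
    with rc show "r \<in> K" by (simp add: K_def)
  qed
  ultimately have "chow_ideal d \<subseteq> K"
    unfolding chow_ideal_def by (rule divisor_ring.genideal_minimal)
  then have "p \<in> K" using assms(2) by (rule subsetD)
  then have "\<forall>q\<in>coord_polys d. residue_functional d (p * q) = 0" by (simp add: K_def)
  from bspec[OF this carrier_1] show ?thesis by simp
qed

section \<open>Uniqueness of the degree map\<close>

lemma scalar_simps:
  "scalar (x + y) = scalar x + scalar y" "scalar (x * y) = scalar x * scalar y" "scalar 1 = 1" "scalar 0 = 0"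
  "scalar (- x) = - scalar x" "scalar (x - y) = scalar x - scalar y" "scalar (numeral k) = numeral k"
  by (simp_all add: scalar_def single_add mult_single single_uminus single_diff)

lemma carrier_H [divisor_carrier]: "j \<le> d \<Longrightarrow> H j \<in> coord_polys d"
  unfolding H_def by (rule carrier_var) (auto simp: coords_def)

lemma coord_form_H_carrier:
  assumes "c \<in> coords d" shows "coord_form c H \<in> coord_polys d"
  unfolding coord_form_weights[OF assms, symmetric] by (intro divisor_carrier) auto

lemma coord_relation_ideal: "c \<in> coords d \<Longrightarrow> divisor_var c - coord_form c H \<in> chow_ideal d"
  using coord_relation chow_relations_subset by blast

lemma chow_ideal_uminus: "p \<in> chow_ideal d \<Longrightarrow> - p \<in> chow_ideal d"
  using chow_ideal_mult[of p d "- 1"] by (simp add: carrier_uminus carrier_1)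

lemma chow_ideal_0: "0 \<in> chow_ideal d"
  using additive_subgroup.zero_closed[OF ideal.axioms(1)[OF ideal_chow_ideal], of d] by simp

text \<open>
  A transversal picks a coordinate in each group; the remaining coordinates span a maximal cone of
  the fan.
\<close>
definition transversal :: "nat \<Rightarrow> (nat \<Rightarrow> coord) \<Rightarrow> bool" where
  "transversal d t \<longleftrightarrow> (\<forall>i\<le>d. t i \<in> coord_group d i)"

definition trans_span :: "nat \<Rightarrow> (nat \<Rightarrow> coord) \<Rightarrow> divisor_poly set" where
  "trans_span d t = {p. \<exists>a. p - (\<Sum>i\<le>d. scalar (a i) * divisor_var (t i)) \<in> chow_ideal d}"

lemma trans_spanI: "p - (\<Sum>i\<le>d. scalar (a i) * divisor_var (t i)) \<in> chow_ideal d \<Longrightarrow> p \<in> trans_span d t"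
  unfolding trans_span_def by (rule CollectI) (rule exI)

lemma trans_span_add:
  assumes "p \<in> trans_span d t" "q \<in> trans_span d t" shows "p + q \<in> trans_span d t"
proof -
  obtain a b where "p - (\<Sum>i\<le>d. scalar (a i) * divisor_var (t i)) \<in> chow_ideal d"
     "q - (\<Sum>i\<le>d. scalar (b i) * divisor_var (t i)) \<in> chow_ideal d"
    using assms unfolding trans_span_def by blast
  from chow_ideal_add[OF this]
  have "p + q - (\<Sum>i\<le>d. scalar (a i + b i) * divisor_var (t i)) \<in> chow_ideal d"
    by (simp add: scalar_simps sum.distrib algebra_simps)
  then show ?thesis by (rule trans_spanI)
qed

lemma trans_span_scalar:
  assumes "p \<in> trans_span d t" shows "scalar z * p \<in> trans_span d t"
proof -
  obtain a where "p - (\<Sum>i\<le>d. scalar (a i) * divisor_var (t i)) \<in> chow_ideal d"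
    using assms unfolding trans_span_def by blast
  from chow_ideal_mult[OF this carrier_scalar[of z]]
  have "scalar z * p - (\<Sum>i\<le>d. scalar (z * a i) * divisor_var (t i)) \<in> chow_ideal d"
    by (simp add: scalar_simps sum_distrib_left algebra_simps)
  then show ?thesis by (rule trans_spanI)
qed

lemma trans_span_diff:
  assumes "p \<in> trans_span d t" "q \<in> trans_span d t" shows "p - q \<in> trans_span d t"
  using trans_span_add[OF assms(1) trans_span_scalar[OF assms(2), of "-1"]] by (simp add: scalar_simps)

lemma trans_span_ideal: "p \<in> chow_ideal d \<Longrightarrow> p \<in> trans_span d t"
  unfolding trans_span_def by (auto intro!: exI[of _ "\<lambda>_. 0"] simp: scalar_simps)

lemma trans_span_sum: "(\<And>a. a \<in> A \<Longrightarrow> f a \<in> trans_span d t) \<Longrightarrow> (\<Sum>a\<in>A. f a) \<in> trans_span d t"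
  by (induction A rule: infinite_finite_induct) (auto intro: trans_span_add trans_span_ideal chow_ideal_0)

lemma trans_span_var:
  assumes "i \<le> d" shows "divisor_var (t i) \<in> trans_span d t"
proof -
  have "(\<Sum>j\<le>d. scalar (if j = i then 1 else 0) * divisor_var (t j)) = (\<Sum>j\<le>d. if j = i then divisor_var (t j) else 0)"
    by (intro sum.cong) (auto simp: scalar_simps)
  also have "\<dots> = divisor_var (t i)" using assms by simp
  finally have e: "(\<Sum>j\<le>d. scalar (if j = i then 1 else 0) * divisor_var (t j)) = divisor_var (t i)" .
  show ?thesis unfolding trans_span_def
    by (rule CollectI, rule exI[of _ "\<lambda>j. if j = i then 1 else 0"]) (simp only: e diff_self chow_ideal_0)
qed

lemma trans_span_cong:
  assumes "p \<in> trans_span d t" "p - q \<in> chow_ideal d" shows "q \<in> trans_span d t"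
  using trans_span_diff[OF assms(1) trans_span_ideal[OF assms(2)]] by simp

text \<open>Out-of-range neighbours, the truncated \<open>i - 1\<close> at i = 0 and d + 1 at i = d,
  have coefficient 0. For u_i the dominance is an equality, 2 = 1 + 1, which is why strictness is
  recorded only for rows with a = 0.\<close>

lemma coord_form_tridiagonal:
  assumes "c \<in> coord_group d i"
  obtains a b e :: real where "b > 0" "\<bar>a\<bar> + \<bar>e\<bar> \<le> b" "a = 0 \<Longrightarrow> \<bar>e\<bar> < b" "a = 0 \<or> 1 \<le> i" "e = 0 \<or> i < d"
    "coord_form c H = scalar (of_real a) * H (i - 1) + scalar (of_real b) * H i + scalar (of_real e) * H (i + 1)"
proof (cases c)
  case (Ac k n)
  have c: "c \<in> coords d" "coord_index c = i" using assms by (auto simp: coord_group_def)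
  show ?thesis
  proof (cases "k < 3")
    case True
    then show ?thesis using Ac c by (intro that[of 1 0 0]) (auto simp: scalar_simps)
  next
    case False
    then have n: "n \<le> 3 * d" "(n + 1) div 3 = i" using Ac c by (auto simp: coords_def)
    show ?thesis
    proof (cases n rule: mod3_cases)
      case (1 j)
      then have "j = i" using n by simp
      then show ?thesis using Ac False 1 by (intro that[of 3 0 0]) (auto simp: scalar_simps)
    next
      case (2 j)
      then have "j = i" "3 * j + 1 \<le> 3 * d" using n unfolding div_3_eq_iff by linarith+
      then have j: "j = i" "i < d" by simp_all
      have "n mod 3 = 1" "n div 3 = i" using 2 j by presburger+
      then show ?thesis using Ac False j by (intro that[of 2 0 1]) (auto simp: scalar_simps)
    next
      case (3 j)
      then have j: "i = Suc j" using n by simp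
      have "n mod 3 = 2" "n div 3 = j" using 3 by presburger+
      then show ?thesis using Ac False j by (intro that[of 2 1 0]) (auto simp: scalar_simps)
    qed
  qed
next
  case (Uc k)
  then have "k = i" "1 \<le> i" "i < d" using assms by (auto simp: coord_group_def coords_def)
  then show ?thesis using Uc by (intro that[of 2 "-1" "-1"]) (auto simp: scalar_simps)
qed

text \<open>
  Gaussian elimination for a tridiagonal, weakly diagonally dominant system: the off-diagonal
  entry stays smaller than 1 in absolute value.
\<close>
lemma trans_span_eliminate:
  assumes "transversal d t" "i \<le> d"
  shows "\<exists>u :: real. \<bar>u\<bar> < 1 \<and> (i = d \<longrightarrow> u = 0) \<and> H i - scalar (of_real u) * H (i + 1) \<in> trans_span d t"
  using assms(2)
proof (induction i rule: less_induct)
  case (less i)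
  have g: "t i \<in> coord_group d i" using assms(1) less.prems by (simp add: transversal_def)
  obtain a b e :: real where abe: "b > 0" "\<bar>a\<bar> + \<bar>e\<bar> \<le> b" "a = 0 \<Longrightarrow> \<bar>e\<bar> < b" "a = 0 \<or> 1 \<le> i" "e = 0 \<or> i < d"
    "coord_form (t i) H = scalar (of_real a) * H (i - 1) + scalar (of_real b) * H i + scalar (of_real e) * H (i + 1)"
    using coord_form_tridiagonal[OF g] by blast
  have "\<exists>u :: real. \<bar>u\<bar> < 1 \<and> scalar (of_real a) * (H (i - 1) - scalar (of_real u) * H i) \<in> trans_span d t"
  proof (cases "a = 0")
    case True
    then show ?thesis by (intro exI[of _ 0]) (simp add: scalar_simps trans_span_ideal chow_ideal_0)
  next
    case False
    then have "i - 1 < i" "i - 1 \<le> d" "i - 1 + 1 = i" using abe(4) less.prems by auto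
    then obtain u :: real where "\<bar>u\<bar> < 1" "H (i - 1) - scalar (of_real u) * H i \<in> trans_span d t"
      using less.IH[of "i - 1"] by auto
    then show ?thesis using trans_span_scalar by blast
  qed
  then obtain u :: real where u: "\<bar>u\<bar> < 1" "scalar (of_real a) * (H (i - 1) - scalar (of_real u) * H i) \<in> trans_span d t"
    by blast
  \<comment> \<open>The pivot of row i after H (i - 1) has been eliminated; |u| < 1 keeps it
    strictly above |e|.\<close>
  define c where "c = b + a * u"
  have c: "\<bar>e\<bar> < c"
  proof (cases "a = 0")
    case False
    have "\<bar>a * u\<bar> < \<bar>a\<bar>" using u(1) False by (simp add: abs_mult)
    then show ?thesis using abe(2) unfolding c_def by linarith
  qed (use abe(3) in \<open>simp add: c_def\<close>)
  then have c0: "c > 0" by linarith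
  have "coord_form (t i) H \<in> trans_span d t"
    by (rule trans_span_cong[OF trans_span_var[OF less.prems]]) (use g coord_relation_ideal in \<open>auto simp: coord_group_def\<close>)
  from trans_span_scalar[OF trans_span_diff[OF this u(2)], of "of_real (1 / c)"]
  have "scalar (of_real (1 / c)) * (scalar (of_real b) + scalar (of_real a) * scalar (of_real u)) * H i +
      scalar (of_real (1 / c)) * scalar (of_real e) * H (i + 1) \<in> trans_span d t"
    unfolding abe by (simp add: algebra_simps)
  moreover have "scalar (of_real (1 / c)) * (scalar (of_real b) + scalar (of_real a) * scalar (of_real u)) = 1"
    using c0 by (simp add: scalar_simps(1,2)[symmetric] scalar_simps(3) c_def flip: of_real_add of_real_mult of_real_divide)
  moreover have "scalar (of_real (1 / c)) * scalar (of_real e) = - scalar (of_real (- e / c))"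
    by (simp add: scalar_simps(2,5)[symmetric])
  ultimately have "H i - scalar (of_real (- e / c)) * H (i + 1) \<in> trans_span d t" by simp
  moreover have "\<bar>- e / c\<bar> < 1" using c c0 by simp
  ultimately show ?case using abe(5) by (intro exI[of _ "- e / c"]) auto
qed

text \<open>Back substitution, starting from \<open>H d\<close>, where the elimination coefficient
  is 0.\<close>

lemma trans_span_H:
  assumes "transversal d t" "j \<le> d"
  shows "H j \<in> trans_span d t"
  using assms(2)
proof (induction j rule: inc_induct)
  case base
  obtain u :: real where "d = d \<longrightarrow> u = 0" "H d - scalar (of_real u) * H (d + 1) \<in> trans_span d t"
    using trans_span_eliminate[OF assms(1) order_refl] by blast
  then show ?case by (simp add: scalar_simps)
next
  case (step j)
  obtain u :: real where "H j - scalar (of_real u) * H (j + 1) \<in> trans_span d t"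
    using trans_span_eliminate[OF assms(1), of j] step.hyps by auto
  from trans_span_add[OF this trans_span_scalar[OF step.IH, of "of_real u"]] show ?case by simp
qed

lemma trans_span_coord:
  assumes "transversal d t" "c \<in> coords d"
  shows "divisor_var c \<in> trans_span d t"
proof (rule trans_span_cong)
  have i: "of_int k = scalar (of_int k)" for k by (simp add: scalar_def)
  show "coord_form c H \<in> trans_span d t"
    unfolding coord_form_weights[OF assms(2), symmetric] i
    by (intro trans_span_sum trans_span_scalar trans_span_H[OF assms(1)]) auto
  show "coord_form c H - divisor_var c \<in> chow_ideal d"
    using chow_ideal_uminus[OF coord_relation_ideal[OF assms(2)]] by simp
qed


definition monom_prod :: "nat \<Rightarrow> (coord \<Rightarrow> nat) \<Rightarrow> divisor_poly" where
  "monom_prod d e = (\<Prod>c\<in>coords d. divisor_var c ^ e c)"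

definition cone_prod :: "nat \<Rightarrow> (nat \<Rightarrow> coord) \<Rightarrow> divisor_poly" where
  "cone_prod d t = (\<Prod>c\<in>coords d - t ` {..d}. divisor_var c)"

lemma monom_prod_carrier [divisor_carrier]: "monom_prod d e \<in> coord_polys d"
  unfolding monom_prod_def by (intro divisor_carrier)

lemma group_supported_in_chow_ideal:
  assumes "d \<ge> 1" "i \<le> d" "coord_group d i \<subseteq> A" "A \<subseteq> coords d"
  shows "(\<Prod>c\<in>A. divisor_var c) \<in> chow_ideal d"
proof -
  have "(\<Prod>c\<in>A. divisor_var c) = (\<Prod>c\<in>A - coord_group d i. divisor_var c) * (\<Prod>c\<in>coord_group d i. divisor_var c)"
    by (rule prod.subset_diff[OF assms(3) finite_subset[OF assms(4) finite_coords]])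
  also have "\<dots> = (\<Prod>c\<in>coord_group d i. divisor_var c) * (\<Prod>c\<in>A - coord_group d i. divisor_var c)"
    by (rule mult.commute)
  also have "\<dots> \<in> chow_ideal d"
    using assms by (intro chow_ideal_mult coord_group_prod_in_chow_ideal divisor_carrier) auto
  finally show ?thesis .
qed

lemma chow_ideal_prod_cong:
  assumes "finite A" "\<And>a. a \<in> A \<Longrightarrow> f a \<in> coord_polys d" "\<And>a. a \<in> A \<Longrightarrow> g a \<in> coord_polys d"
    "\<And>a. a \<in> A \<Longrightarrow> f a - g a \<in> chow_ideal d"
  shows "(\<Prod>a\<in>A. f a) - (\<Prod>a\<in>A. g a) \<in> chow_ideal d"
  using assms
proof (induction A)
  case (insert x A)
  have 1: "(f x - g x) * (\<Prod>a\<in>A. f a) \<in> chow_ideal d"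
    using insert.prems by (intro chow_ideal_mult divisor_carrier) auto
  have 2: "((\<Prod>a\<in>A. f a) - (\<Prod>a\<in>A. g a)) * g x \<in> chow_ideal d"
    using insert by (intro chow_ideal_mult) auto
  from chow_ideal_add[OF 1 2] show ?case using insert.hyps by (simp add: algebra_simps)
qed (simp add: chow_ideal_0)

lemma transversal_inj: "transversal d t \<Longrightarrow> inj_on t {..d}"
  unfolding transversal_def inj_on_def coord_group_def by (metis (mono_tags, lifting) atMost_iff mem_Collect_eq)

text \<open>Meant for the difference of two degree maps, read on representatives: both are 1 on
  \<open>Vol d\<close>, so the difference is 0 there.\<close>

locale top_degree_functional =
  fixes d :: nat and D :: "divisor_poly \<Rightarrow> complex"
  assumes d: "d \<ge> 1"
    and D_add: "\<And>p q. p \<in> coord_polys d \<Longrightarrow> q \<in> coord_polys d \<Longrightarrow> D (p + q) = D p + D q"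
    and D_scalar: "\<And>z p. p \<in> coord_polys d \<Longrightarrow> D (scalar z * p) = z * D p"
    and D_ideal: "\<And>p. p \<in> chow_ideal d \<Longrightarrow> D p = 0"
    and D_degree: "\<And>n p. p \<in> coord_polys d \<Longrightarrow> homogeneous_poly n p \<Longrightarrow> n \<noteq> 6 * d + 2 \<Longrightarrow> D p = 0"
    and D_Vol: "D (Vol d) = 0"
begin

lemma D_cong:
  assumes "p - q \<in> chow_ideal d" "q \<in> coord_polys d"
  shows "D p = D q"
  using D_add[OF chow_ideal_carrier[OF assms(1)] assms(2)] D_ideal[OF assms(1)] by simp

lemma D_0: "D 0 = 0" by (rule D_ideal[OF chow_ideal_0])

lemma D_sum: "(\<And>a. a \<in> A \<Longrightarrow> f a \<in> coord_polys d) \<Longrightarrow> D (\<Sum>a\<in>A. f a) = (\<Sum>a\<in>A. D (f a))"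
  by (induction A rule: infinite_finite_induct) (auto simp: D_0 D_add carrier_sum)

lemma D_expand:
  assumes "transversal d t" "c \<in> coords d" "p \<in> coord_polys d"
  obtains a where "D (divisor_var c * p) = (\<Sum>i\<le>d. a i * D (divisor_var (t i) * p))"
proof -
  obtain a where a: "divisor_var c - (\<Sum>i\<le>d. scalar (a i) * divisor_var (t i)) \<in> chow_ideal d"
    using trans_span_coord[OF assms(1,2)] unfolding trans_span_def by (rule CollectE) (erule exE)
  have t: "t i \<in> coords d" if "i \<le> d" for i
    using assms(1) that by (simp add: transversal_def coord_group_def)
  have s: "(\<Sum>i\<le>d. scalar (a i) * divisor_var (t i)) * p = (\<Sum>i\<le>d. scalar (a i) * (divisor_var (t i) * p))"
    by (simp add: sum_distrib_right mult.assoc)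
  have "divisor_var c * p - (\<Sum>i\<le>d. scalar (a i) * divisor_var (t i)) * p \<in> chow_ideal d"
    using chow_ideal_mult[OF a assms(3)] by (simp only: left_diff_distrib)
  then have "D (divisor_var c * p) = D (\<Sum>i\<le>d. scalar (a i) * (divisor_var (t i) * p))"
    unfolding s by (rule D_cong) (intro divisor_carrier t assms(3), simp)
  also have "\<dots> = (\<Sum>i\<le>d. D (scalar (a i) * (divisor_var (t i) * p)))"
    by (rule D_sum) (intro divisor_carrier t assms(3), simp)
  also have "\<dots> = (\<Sum>i\<le>d. a i * D (divisor_var (t i) * p))"
    by (intro sum.cong refl D_scalar divisor_carrier t assms(3)) simp
  finally show ?thesis by (rule that)
qed

lemma D_base: "D (cone_prod d (Ac 0)) = 0"
proof -
  have "(\<Prod>c\<in>coords d - base_coords d. divisor_var c) - (\<Prod>c\<in>coords d - base_coords d. coord_form c H) \<in> chow_ideal d"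
    by (rule chow_ideal_prod_cong) (simp_all add: finite_coords coord_relation_ideal coord_form_H_carrier carrier_var)
  then have "cone_prod d (Ac 0) - Vol d \<in> chow_ideal d"
    unfolding Vol_eq_vol_form prod_coord_form[symmetric] cone_prod_def base_coords_def .
  moreover have "Vol d \<in> coord_polys d"
    unfolding Vol_eq_vol_form prod_coord_form[symmetric]
    by (intro carrier_prod coord_form_H_carrier) simp
  ultimately show ?thesis using D_cong D_Vol by metis
qed

text \<open>Crossing a wall of the fan multiplies the class of a cone by a constant.\<close>
lemma D_wall:
  assumes t: "transversal d t" and k: "k \<le> d" and b: "b \<in> coord_group d k"
    and 0: "D (cone_prod d (t(k := b))) = 0"
  shows "D (cone_prod d t) = 0"
proof (cases "t k = b")
  case True
  then have "t(k := b) = t" by auto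
  with 0 show ?thesis by simp
next
  case False
  define P where "P = (\<Prod>c\<in>coords d - t ` {..d} - {b}. divisor_var c)"
  have tg: "t i \<in> coord_group d i" if "i \<le> d" for i using t that by (simp add: transversal_def)
  have ti: "coord_index (t i) = i" "t i \<in> coords d" if "i \<le> d" for i using tg[OF that] by (simp_all add: coord_group_def)
  have bi: "coord_index b = k" "b \<in> coords d" using b by (simp_all add: coord_group_def)
  have bt: "b \<notin> t ` {..d}"
  proof
    assume "b \<in> t ` {..d}"
    then obtain i where "i \<le> d" "b = t i" by auto
    then show False using ti(1)[of i] bi(1) False by auto
  qed
  have fin: "finite (coords d - t ` {..d} - {b})" using finite_coords by simp
  have P: "P \<in> coord_polys d" unfolding P_def by (intro divisor_carrier) simp
  have e1: "coords d - t ` {..d} = insert b (coords d - t ` {..d} - {b})" using bi(2) bt by blast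
  have c1: "cone_prod d t = divisor_var b * P"
    unfolding cone_prod_def P_def by (subst e1, subst prod.insert) (use fin in auto)
  have im: "(t(k := b)) ` {..d} = insert b (t ` {..d} - {t k})"
  proof -
    have "t i \<noteq> t k" if "i \<le> d" "i \<noteq> k" for i using ti(1)[OF that(1)] ti(1)[OF k] that(2) by metis
    then show ?thesis using k by auto
  qed
  have e2: "coords d - (t(k := b)) ` {..d} = insert (t k) (coords d - t ` {..d} - {b})"
    unfolding im using ti(2)[OF k] False k by auto
  have c2: "cone_prod d (t(k := b)) = divisor_var (t k) * P"
    unfolding cone_prod_def P_def e2 by (subst prod.insert) (use fin k in auto)
  \<comment> \<open>For i other than k, t i is the only member of group i missing from P, so the
    product contains a whole group and lies in the ideal.\<close>
  have c3: "D (divisor_var (t i) * P) = 0" if "i \<le> d" for i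
  proof (cases "i = k")
    case True
    then show ?thesis using 0 c2 by simp
  next
    case i: False
    have "divisor_var (t i) * P = (\<Prod>c\<in>insert (t i) (coords d - t ` {..d} - {b}). divisor_var c)"
      unfolding P_def by (subst prod.insert) (use fin that in auto)
    also have "\<dots> \<in> chow_ideal d"
    proof (rule group_supported_in_chow_ideal[OF d that])
      show "coord_group d i \<subseteq> insert (t i) (coords d - t ` {..d} - {b})"
      proof
        fix c assume c: "c \<in> coord_group d i"
        then have ci: "coord_index c = i" "c \<in> coords d" by (simp_all add: coord_group_def)
        have "c \<noteq> b" using ci bi i by auto
        moreover have "c = t i" if "c \<in> t ` {..d}"
          using that ci ti(1) by auto
        ultimately show "c \<in> insert (t i) (coords d - t ` {..d} - {b})" using ci by blast
      qed
      show "insert (t i) (coords d - t ` {..d} - {b}) \<subseteq> coords d" using ti(2)[OF that] by blast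
    qed
    finally show ?thesis by (rule D_ideal)
  qed
  obtain a where "D (divisor_var b * P) = (\<Sum>i\<le>d. a i * D (divisor_var (t i) * P))"
    by (rule D_expand[OF t bi(2) P])
  also have "\<dots> = 0" by (rule sum.neutral) (simp add: c3)
  finally show ?thesis unfolding c1 .
qed

lemma base_in_group: "i \<le> d \<Longrightarrow> Ac 0 i \<in> coord_group d i"
  by (auto simp: coord_group_def coords_def)

text \<open>Any transversal is connected to the base one by changing one group at a time, from index
  d downwards; each change crosses a wall.\<close>

lemma D_cone:
  assumes "transversal d t" shows "D (cone_prod d t) = 0"
proof -
  have "D (cone_prod d t) = 0" if "transversal d t" "\<And>i. k \<le> i \<Longrightarrow> i \<le> d \<Longrightarrow> t i = Ac 0 i" for k t
    using that
  proof (induction k arbitrary: t)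
    case 0
    then have "t ` {..d} = Ac 0 ` {..d}" by (intro image_cong) auto
    then show ?case using D_base by (simp add: cone_prod_def)
  next
    case (Suc k)
    show ?case
    proof (cases "k \<le> d")
      case True
      have "transversal d (t(k := Ac 0 k))"
        using Suc.prems(1) base_in_group by (auto simp: transversal_def)
      moreover have "(t(k := Ac 0 k)) i = Ac 0 i" if "k \<le> i" "i \<le> d" for i
        using Suc.prems(2)[of i] that by (cases "i = k") auto
      ultimately have "D (cone_prod d (t(k := Ac 0 k))) = 0" by (rule Suc.IH)
      then show ?thesis by (rule D_wall[OF Suc.prems(1) True base_in_group[OF True]])
    next
      case False
      then show ?thesis by (intro Suc.IH Suc.prems) auto
    qed
  qed
  from this[of t "Suc d"] show ?thesis using assms by simp
qed

text \<open>A moving argument: choose in each group a coordinate absent from the monomial and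
  rewrite one copy of a repeated factor in terms of these. Every resulting monomial has fewer absent
  coordinates, which is the induction measure.\<close>

lemma D_monom:
  assumes "(\<Sum>c\<in>coords d. e c) = 6 * d + 2"
  shows "D (monom_prod d e) = 0"
  using assms
proof (induction "card {c \<in> coords d. e c = 0}" arbitrary: e rule: less_induct)
  case less
  let ?Z = "\<lambda>e. {c \<in> coords d. e c = (0 :: nat)}"
  show ?case
  proof (cases "\<exists>i\<le>d. \<forall>c\<in>coord_group d i. e c \<noteq> 0")
    case True
    then obtain i where i: "i \<le> d" "\<And>c. c \<in> coord_group d i \<Longrightarrow> e c \<noteq> 0" by blast
    have "monom_prod d e = (\<Prod>c\<in>coords d. (if c \<in> coord_group d i then divisor_var c else 1) *
        divisor_var c ^ (if c \<in> coord_group d i then e c - 1 else e c))"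
      unfolding monom_prod_def
    proof (rule prod.cong[OF refl])
      fix c show "divisor_var c ^ e c = (if c \<in> coord_group d i then divisor_var c else 1) *
          divisor_var c ^ (if c \<in> coord_group d i then e c - 1 else e c)"
      proof (cases "c \<in> coord_group d i")
        case True
        then obtain k where "e c = Suc k" using i(2) not0_implies_Suc by metis
        with True show ?thesis by simp
      qed simp
    qed
    also have "\<dots> = (\<Prod>c\<in>coords d. if c \<in> coord_group d i then divisor_var c else 1) *
        (\<Prod>c\<in>coords d. divisor_var c ^ (if c \<in> coord_group d i then e c - 1 else e c))"
      by (rule prod.distrib)
    also have "(\<Prod>c\<in>coords d. if c \<in> coord_group d i then divisor_var c else 1) = (\<Prod>c\<in>coord_group d i. divisor_var c)"
    proof -
      have "coords d \<inter> coord_group d i = coord_group d i" using coord_group_subset by (rule Int_absorb1)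
      then show ?thesis
        using prod.inter_restrict[OF finite_coords, of divisor_var d "coord_group d i"] by (simp only:)
    qed
    also have "\<dots> * (\<Prod>c\<in>coords d. divisor_var c ^ (if c \<in> coord_group d i then e c - 1 else e c)) \<in> chow_ideal d"
      by (intro chow_ideal_mult coord_group_prod_in_chow_ideal d i divisor_carrier)
    finally show ?thesis by (rule D_ideal)
  next
    case False
    then have ex: "\<exists>c. c \<in> coord_group d i \<and> e c = 0" if "i \<le> d" for i using that by auto
    define t where "t i = (SOME c. c \<in> coord_group d i \<and> e c = 0)" for i
    have t0: "t i \<in> coord_group d i \<and> e (t i) = 0" if "i \<le> d" for i
      unfolding t_def by (rule someI_ex[OF ex[OF that]])
    then have t: "transversal d t" by (simp add: transversal_def)
    have tc: "t i \<in> coords d" "e (t i) = 0" if "i \<le> d" for i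
      using t0[OF that] by (auto simp: coord_group_def)
    show ?thesis
    proof (cases "\<exists>c\<in>coords d. e c \<ge> 2")
      case True
      then obtain c where c: "c \<in> coords d" "e c \<ge> 2" by blast
      define e' where "e' = e(c := e c - 1)"
      have step: "divisor_var b * monom_prod d f = monom_prod d (f(b := f b + 1))" if "b \<in> coords d" for b f
      proof -
        have 1: "monom_prod d g = divisor_var b ^ g b * (\<Prod>c\<in>coords d - {b}. divisor_var c ^ g c)" for g
          unfolding monom_prod_def by (rule prod.remove[OF finite_coords that])
        have 2: "(\<Prod>c\<in>coords d - {b}. divisor_var c ^ (f(b := f b + 1)) c) = (\<Prod>c\<in>coords d - {b}. divisor_var c ^ f c)"
          by (rule prod.cong) auto
        show ?thesis unfolding 1[of f] 1[of "f(b := f b + 1)"] 2 by (simp add: mult.assoc)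
      qed
      have "e'(c := e' c + 1) = e" using c by (auto simp: e'_def)
      then have m: "monom_prod d e = divisor_var c * monom_prod d e'" using step[OF c(1), of e'] by simp
      have "D (divisor_var (t i) * monom_prod d e') = 0" if i: "i \<le> d" for i
      proof -
        let ?f = "e'(t i := e' (t i) + 1)"
        have ne: "t i \<noteq> c" using tc(2)[OF i] c(2) by auto
        have Z: "?Z ?f = ?Z e - {t i}" using ne c tc(2)[OF i] by (auto simp: e'_def)
        have "card (?Z ?f) < card (?Z e)"
          unfolding Z by (rule card_Diff1_less) (use finite_coords tc[OF i] in auto)
        moreover have "(\<Sum>c\<in>coords d. ?f c) = 6 * d + 2"
        proof -
          have s: "(\<Sum>x\<in>coords d. g x) = g c + (g (t i) + (\<Sum>x\<in>coords d - {c} - {t i}. g x))" for g :: "coord \<Rightarrow> nat"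
            using sum.remove[OF finite_coords c(1), of g] sum.remove[of "coords d - {c}" "t i" g] tc(1)[OF i] ne finite_coords[of d] by simp
          have r: "(\<Sum>x\<in>coords d - {c} - {t i}. ?f x) = (\<Sum>x\<in>coords d - {c} - {t i}. e x)"
            by (rule sum.cong) (auto simp: e'_def)
          show ?thesis using less.prems c(2) ne unfolding s[of ?f] s[of e] r by (simp add: e'_def)
        qed
        ultimately have "D (monom_prod d ?f) = 0" by (rule less.hyps)
        then show ?thesis unfolding step[OF tc(1)[OF i]] .
      qed
      moreover obtain a where "D (divisor_var c * monom_prod d e') = (\<Sum>i\<le>d. a i * D (divisor_var (t i) * monom_prod d e'))"
        by (rule D_expand[OF t c(1) monom_prod_carrier])
      ultimately show ?thesis unfolding m by (simp add: sum.neutral)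
    next
      case False
      then have e01: "e c = (if e c = 0 then 0 else 1)" if "c \<in> coords d" for c using that by force
      \<comment> \<open>A squarefree monomial of degree 6 d + 2 in 7 d + 3 coordinates omits exactly
        d + 1 of them, hence exactly the chosen one from each group.\<close>
      have "6 * d + 2 = (\<Sum>c\<in>coords d. if e c = 0 then 0 else 1)"
        unfolding less.prems[symmetric] by (rule sum.cong[OF refl e01])
      also have "\<dots> = card (coords d - ?Z e)"
      proof -
        have "(\<Sum>c\<in>coords d. if e c = 0 then 0 else 1) = (\<Sum>c\<in>coords d - ?Z e. 1 :: nat)"
          by (rule sum.mono_neutral_cong_right) (auto simp: finite_coords)
        then show ?thesis by simp
      qed
      also have "\<dots> = card (coords d) - card (?Z e)"
        by (rule card_Diff_subset) (auto simp: finite_coords)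
      finally have "card (?Z e) = d + 1"
        using card_coords[OF d] card_mono[of "coords d" "?Z e"] finite_coords[of d] by simp
      moreover have "t ` {..d} \<subseteq> ?Z e" using tc by auto
      moreover have "card (t ` {..d}) = d + 1" using transversal_inj[OF t] by (simp add: card_image)
      ultimately have "t ` {..d} = ?Z e" by (intro card_subset_eq) (auto simp: finite_coords)
      moreover have "monom_prod d e = (\<Prod>c\<in>coords d - ?Z e. divisor_var c)"
        unfolding monom_prod_def
      proof (rule prod.mono_neutral_cong_right)
        fix c assume "c \<in> coords d - ?Z e"
        then have c: "c \<in> coords d" "e c \<noteq> 0" by auto
        have "e c = 1" using e01[OF c(1)] c(2) by presburger
        then show "divisor_var c ^ e c = divisor_var c" by simp
      qed (auto simp: finite_coords)
      ultimately have "monom_prod d e = cone_prod d t" by (simp add: cone_prod_def)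
      then show ?thesis using D_cone[OF t] by simp
    qed
  qed
qed

lemma single_eq_monom_prod:
  assumes "Poly_Mapping.keys m \<subseteq> coords d"
  shows "Poly_Mapping.single m z = scalar z * monom_prod d (Poly_Mapping.lookup m)"
proof -
  have pw: "divisor_var c ^ n = Poly_Mapping.single (Poly_Mapping.single c n) 1" for c n
    by (induction n) (simp_all add: divisor_var_def mult_single single_add[symmetric])
  have pr: "(\<Prod>c\<in>A. Poly_Mapping.single (f c) (1 :: complex)) = Poly_Mapping.single (\<Sum>c\<in>A. f c) 1" for A and f :: "coord \<Rightarrow> coord \<Rightarrow>\<^sub>0 nat"
    by (induction A rule: infinite_finite_induct) (simp_all add: mult_single)
  have "m = (\<Sum>c\<in>coords d. Poly_Mapping.single c (Poly_Mapping.lookup m c))"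
    by (subst poly_mapping_sum_singles, rule sum.mono_neutral_left)
       (use assms in \<open>auto simp: finite_coords in_keys_iff\<close>)
  then show ?thesis unfolding monom_prod_def pw pr by (simp add: scalar_def mult_single)
qed

theorem D_zero:
  assumes "p \<in> coord_polys d" shows "D p = 0"
proof -
  have "D (Poly_Mapping.single m (Poly_Mapping.lookup p m)) = 0" if m: "m \<in> Poly_Mapping.keys p" for m
  proof -
    have k: "Poly_Mapping.keys m \<subseteq> coords d" using assms m by (simp add: carrier_divisor_ring)
    have c: "Poly_Mapping.single m (Poly_Mapping.lookup p m) \<in> coord_polys d"
      using k by (auto simp: carrier_divisor_ring)
    have deg: "monomial_degree m = (\<Sum>c\<in>coords d. Poly_Mapping.lookup m c)"
      by (rule monomial_degree_superset[OF finite_coords k])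
    show ?thesis
    proof (cases "monomial_degree m = 6 * d + 2")
      case True
      then show ?thesis
        unfolding single_eq_monom_prod[OF k] D_scalar[OF monom_prod_carrier] using D_monom deg by simp
    next
      case False
      have "homogeneous_poly (monomial_degree m) (Poly_Mapping.single m (Poly_Mapping.lookup p m))"
        by (simp add: homogeneous_poly_def monomial_degree_def)
      then show ?thesis using D_degree[OF c _ False] by blast
    qed
  qed
  moreover have "Poly_Mapping.single m (Poly_Mapping.lookup p m) \<in> coord_polys d" if "m \<in> Poly_Mapping.keys p" for m
    using assms that by (auto simp: carrier_divisor_ring)
  ultimately have "D (\<Sum>m\<in>Poly_Mapping.keys p. Poly_Mapping.single m (Poly_Mapping.lookup p m)) = 0"
    by (subst D_sum) simp_all
  then show ?thesis using poly_mapping_sum_singles[of p] by simp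
qed

end

section \<open>The intersection number\<close>

lemma carrier_chow_ring: "carrier (chow_ring d) = chow_class d ` coord_polys d"
  by (auto simp: chow_ring_def FactRing_def A_RCOSETS_def' chow_class_def)

lemma chow_class_eq_iff:
  assumes "p \<in> coord_polys d" "q \<in> coord_polys d"
  shows "chow_class d p = chow_class d q \<longleftrightarrow> p - q \<in> chow_ideal d"
proof -
  have "p \<ominus>\<^bsub>divisor_ring d\<^esub> q = p - q"
  proof -
    have "\<ominus>\<^bsub>divisor_ring d\<^esub> q = - q"
      by (rule divisor_ring.minus_equality) (use assms carrier_uminus in simp_all)
    then show ?thesis by (simp add: a_minus_def)
  qed
  then show ?thesis
    using ring.quotient_eq_iff_same_a_r_cos[OF divisor_ring.ring_axioms ideal_chow_ideal assms]
    unfolding chow_class_def by simp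
qed

lemma chow_class_ring_hom: "chow_class d \<in> ring_hom (divisor_ring d) (chow_ring d)"
  using ideal.rcos_ring_hom[OF ideal_chow_ideal, of d] unfolding chow_ring_def chow_class_def[abs_def] .

lemma chow_class_add:
  "p \<in> coord_polys d \<Longrightarrow> q \<in> coord_polys d \<Longrightarrow>
   chow_class d p \<oplus>\<^bsub>chow_ring d\<^esub> chow_class d q = chow_class d (p + q)"
  using ring_hom_add[OF chow_class_ring_hom, of p d q] by simp

lemma chow_class_mult:
  "p \<in> coord_polys d \<Longrightarrow> q \<in> coord_polys d \<Longrightarrow>
   chow_class d p \<otimes>\<^bsub>chow_ring d\<^esub> chow_class d q = chow_class d (p * q)"
  using ring_hom_mult[OF chow_class_ring_hom, of p d q] by simp

text \<open>The choice of representative is immaterial by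
  \<open>residue_functional_chow_ideal\<close>; \<open>undefined\<close> off the carrier gives the
  extensionality that a degree map must have.\<close>

definition residue_integral :: "nat \<Rightarrow> divisor_poly set \<Rightarrow> complex" where
  "residue_integral d X = (if X \<in> carrier (chow_ring d)
     then residue_functional d (SOME p. p \<in> coord_polys d \<and> chow_class d p = X) else undefined)"

lemma residue_integral_class:
  assumes "d \<ge> 1" "p \<in> coord_polys d"
  shows "residue_integral d (chow_class d p) = residue_functional d p"
proof -
  define q where "q = (SOME q. q \<in> coord_polys d \<and> chow_class d q = chow_class d p)"
  have q: "q \<in> coord_polys d \<and> chow_class d q = chow_class d p"
    unfolding q_def by (rule someI[of _ p]) (simp add: assms(2))
  then have "q - p \<in> chow_ideal d" using chow_class_eq_iff[of q d p] assms(2) by blast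
  then have "residue_functional d q = residue_functional d p"
    using residue_functional_add[of "q - p" d p] residue_functional_chow_ideal[OF assms(1)] assms(2)
    by (simp add: chow_ideal_carrier)
  moreover have "chow_class d p \<in> carrier (chow_ring d)" using assms(2) by (simp add: carrier_chow_ring)
  ultimately show ?thesis by (simp add: residue_integral_def q_def[symmetric])
qed

lemma Vol_carrier: "Vol d \<in> coord_polys d"
  unfolding Vol_eq_vol_form prod_coord_form[symmetric]
  by (intro carrier_prod coord_form_H_carrier) simp

lemma is_degree_map_residue:
  assumes "d \<ge> 1" shows "is_degree_map d (residue_integral d)"
  unfolding is_degree_map_def
proof (intro conjI ballI allI impI)
  show "residue_integral d \<in> extensional (carrier (chow_ring d))"
    by (simp add: extensional_def residue_integral_def)
  show "residue_integral d (X \<oplus>\<^bsub>chow_ring d\<^esub> Y) = residue_integral d X + residue_integral d Y"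
    if "X \<in> carrier (chow_ring d)" "Y \<in> carrier (chow_ring d)" for X Y
    using that unfolding carrier_chow_ring
    by (auto simp: chow_class_add residue_integral_class[OF assms] carrier_add residue_functional_add)
  show "residue_integral d (chow_class d (scalar z) \<otimes>\<^bsub>chow_ring d\<^esub> X) = z * residue_integral d X"
    if "X \<in> carrier (chow_ring d)" for z X
    using that unfolding carrier_chow_ring
    by (auto simp: chow_class_mult carrier_scalar carrier_mult residue_integral_class[OF assms] residue_functional_scalar)
  show "residue_integral d (chow_class d p) = 0"
    if "p \<in> coord_polys d" "homogeneous_poly n p \<and> n \<noteq> 6 * d + 2" for n p
    using that residue_functional_homogeneous by (auto simp: residue_integral_class[OF assms])
  show "residue_integral d (chow_class d (Vol d)) = 1"
    by (simp add: residue_integral_class[OF assms Vol_carrier] residue_functional_Vol[OF assms])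
qed

lemma is_degree_map_unique:
  assumes "d \<ge> 1" "is_degree_map d I" "is_degree_map d I'"
  shows "I = I'"
proof -
  note I = assms(2)[unfolded is_degree_map_def] and I' = assms(3)[unfolded is_degree_map_def]
  have cl: "chow_class d p \<in> carrier (chow_ring d)" if "p \<in> coord_polys d" for p
    using that by (simp add: carrier_chow_ring)
  have add: "J (chow_class d (p + q)) = J (chow_class d p) + J (chow_class d q)"
    if "is_degree_map d J" "p \<in> coord_polys d" "q \<in> coord_polys d" for J p q
    using that cl unfolding is_degree_map_def by (simp add: chow_class_add[symmetric])
  have scal: "J (chow_class d (scalar z * p)) = z * J (chow_class d p)"
    if "is_degree_map d J" "p \<in> coord_polys d" for J z p
    using that cl unfolding is_degree_map_def by (simp add: chow_class_mult[symmetric] carrier_scalar)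
  have idl: "J (chow_class d p) = 0" if "is_degree_map d J" "p \<in> chow_ideal d" for J p
  proof -
    have "chow_class d p = chow_class d 0"
      using chow_class_eq_iff[of p d 0] that(2) by (simp add: chow_ideal_carrier carrier_0)
    moreover have "J (chow_class d 0) = 0" using scal[OF that(1) carrier_0, of 0] by simp
    ultimately show ?thesis by simp
  qed
  interpret top_degree_functional d "\<lambda>p. I (chow_class d p) - I' (chow_class d p)"
  proof
    show "1 \<le> d" by (rule assms(1))
  next
    fix n p assume "p \<in> coord_polys d" "homogeneous_poly n p" "n \<noteq> 6 * d + 2"
    then show "I (chow_class d p) - I' (chow_class d p) = 0" using I I' by simp
  next
    show "I (chow_class d (Vol d)) - I' (chow_class d (Vol d)) = 0" using I I' by simp
  next
    fix z p assume "p \<in> coord_polys d"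
    then show "I (chow_class d (scalar z * p)) - I' (chow_class d (scalar z * p)) = z * (I (chow_class d p) - I' (chow_class d p))"
      by (simp add: scal[OF assms(2)] scal[OF assms(3)] right_diff_distrib)
  next
    fix p q assume "p \<in> coord_polys d" "q \<in> coord_polys d"
    then show "I (chow_class d (p + q)) - I' (chow_class d (p + q)) =
        I (chow_class d p) - I' (chow_class d p) + (I (chow_class d q) - I' (chow_class d q))"
      by (simp add: add[OF assms(2)] add[OF assms(3)])
  next
    fix p assume "p \<in> chow_ideal d"
    then show "I (chow_class d p) - I' (chow_class d p) = 0"
      by (simp add: idl[OF assms(2)] idl[OF assms(3)])
  qed
  show ?thesis
  proof (rule extensionalityI)
    show "I \<in> extensional (carrier (chow_ring d))" "I' \<in> extensional (carrier (chow_ring d))"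
      using I I' by simp_all
    fix X assume "X \<in> carrier (chow_ring d)"
    then show "I X = I' X" using D_zero by (auto simp: carrier_chow_ring)
  qed
qed

theorem chow_integral_class:
  assumes "d \<ge> 1" "p \<in> coord_polys d"
  shows "chow_integral d (chow_class d p) = residue_functional d p"
proof -
  have "chow_integral d = residue_integral d"
    unfolding chow_integral_def
  proof (rule the_equality)
    show res: "is_degree_map d (residue_integral d)" by (rule is_degree_map_residue[OF assms(1)])
    show "I = residue_integral d" if "is_degree_map d I" for I
      by (rule is_degree_map_unique[OF assms(1) that res])
  qed
  then show ?thesis by (simp add: residue_integral_class[OF assms])
qed

text \<open>Multiplication by a variable shifts exponent vectors injectively, so every coefficient
  of the other factor can be read off the product.\<close>

lemma divisor_var_cancel:
  assumes "divisor_var c * f = divisor_var c * g" shows "f = g"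
proof (rule poly_mapping_eqI)
  fix n
  let ?m = "Poly_Mapping.single c (1 :: nat)"
  have "Poly_Mapping.lookup (divisor_var c * p) (?m + n) = Poly_Mapping.lookup p n" for p
  proof (induction p rule: poly_mapping_additive_induct)
    case (1 k a)
    show ?case by (simp add: divisor_var_def mult_single lookup_single)
  qed (simp add: distrib_left lookup_add)
  then show "Poly_Mapping.lookup f n = Poly_Mapping.lookup g n" using assms by metis
qed

lemma H_prod_cancel:
  assumes "finite A" "f * (\<Prod>i\<in>A. 6 * H i) = g * (\<Prod>i\<in>A. 6 * H i)"
  shows "f = g"
  using assms
proof (induction A arbitrary: f g)
  case (insert x A)
  have "(f * (6 * H x)) * (\<Prod>i\<in>A. 6 * H i) = (g * (6 * H x)) * (\<Prod>i\<in>A. 6 * H i)"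
    using insert.prems insert.hyps by (simp only: prod.insert mult.assoc not_False_eq_True)
  then have "f * (6 * H x) = g * (6 * H x)" by (rule insert.IH)
  then have "scalar (1 / 6) * (scalar 6 * (H x * f)) = scalar (1 / 6) * (scalar 6 * (H x * g))"
    by (simp add: scalar_simps mult_ac)
  then have "H x * f = H x * g"
    by (simp add: mult.assoc[symmetric] scalar_simps(2)[symmetric] scalar_simps(3))
  then show ?case unfolding H_def by (rule divisor_var_cancel)
qed simp

definition e6_middle :: "'a \<Rightarrow> 'a \<Rightarrow> 'a :: comm_ring_1" where
  "e6_middle x y = (5 * x + y) * (4 * x + 2 * y) * (3 * x + 3 * y) * (2 * x + 4 * y) * (x + 5 * y)"

lemma e6_eq: "e6 x y = 6 * x * e6_middle x y * (6 * y)"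
proof -
  have "{0..6 :: nat} = {0, 1, 2, 3, 4, 5, 6}" by auto
  then have "e6 x y = (6 * x) * ((5 * x + y) * ((4 * x + 2 * y) * ((3 * x + 3 * y) * ((2 * x + 4 * y) * ((x + 5 * y) * (6 * y))))))"
    by (simp add: e6_def)
  then show ?thesis by (simp only: e6_middle_def mult.assoc)
qed

lemma e6_quotient_eq:
  assumes "d \<ge> 1"
  shows "e6_quotient d = 6 * H 0 * (\<Prod>i = 1..d. 6 * H i * e6_middle (H (i - 1)) (H i))"
  unfolding e6_quotient_def
proof (rule the_equality)
  \<comment> \<open>The left end factors of the \<open>e6\<close>, shifted by one index, are the
    denominator times 6 H_0.\<close>
  have "(\<Prod>i = 1..d. 6 * H (i - 1)) = 6 * H 0 * (\<Prod>i = 1..<d. 6 * H i)"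
  proof -
    have "(\<Prod>i = 1..d. 6 * H (i - 1)) = (\<Prod>i = 0..<d. 6 * H i)"
      by (rule prod.reindex_bij_witness[where i = Suc and j = "\<lambda>i. i - 1"]) auto
    also have "\<dots> = 6 * H 0 * (\<Prod>i = 1..<d. 6 * H i)"
      using assms by (simp add: prod.atLeast_Suc_lessThan)
    finally show ?thesis .
  qed
  moreover have "(\<Prod>i = 1..d. e6 (H (i - 1)) (H i)) =
     (\<Prod>i = 1..d. 6 * H (i - 1)) * (\<Prod>i = 1..d. 6 * H i * e6_middle (H (i - 1)) (H i))"
    unfolding e6_eq prod.distrib[symmetric] by (intro prod.cong) (simp_all add: mult_ac)
  ultimately show 1: "6 * H 0 * (\<Prod>i = 1..d. 6 * H i * e6_middle (H (i - 1)) (H i)) * (\<Prod>i = 1..<d. 6 * H i) =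
     (\<Prod>i = 1..d. e6 (H (i - 1)) (H i))"
    by (simp add: mult_ac)
  fix f assume "f * (\<Prod>i = 1..<d. 6 * H i) = (\<Prod>i = 1..d. e6 (H (i - 1)) (H i))"
  then show "f = 6 * H 0 * (\<Prod>i = 1..d. 6 * H i * e6_middle (H (i - 1)) (H i))"
    unfolding 1[symmetric] by (rule H_prod_cancel[rotated]) simp
qed

lemma e6_quotient_carrier:
  assumes "d \<ge> 1" shows "e6_quotient d \<in> coord_polys d"
  unfolding e6_quotient_eq[OF assms] e6_middle_def by (intro divisor_carrier) auto

text \<open>The degree is 1 + 1 + 6 d, exactly the top one, so \<open>form_coeff\<close> keeps the
  whole polynomial.\<close>

lemma graded_eval_e6_quotient:
  assumes "d \<ge> 1"
  shows "graded_eval (\<lambda>c. coord_form c h) (H 0 * e6_quotient d) =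
    monom (h 0 * (6 * h 0 * (\<Prod>i = 1..d. 6 * h i * e6_middle (h (i - 1)) (h i)))) (6 * d + 2)"
proof -
  have H: "graded_eval (\<lambda>c. coord_form c h) (H j) = monom (h j) 1" for j by (simp add: H_def)
  have n: "numeral l * monom a k = monom (numeral l * a) k" for l k and a :: complex
    by (simp add: numeral_poly smult_monom)
  have m: "graded_eval (\<lambda>c. coord_form c h) (6 * H j * e6_middle (H i) (H j)) = monom (6 * h j * e6_middle (h i) (h j)) 6" for i j
    unfolding e6_middle_def graded_eval_mult graded_eval_add graded_eval_numeral H n add_monom mult_monom
    by (simp add: eval_nat_numeral)
  show ?thesis
    unfolding e6_quotient_eq[OF assms] graded_eval_mult[of _ "H 0"] graded_eval_mult[of _ "6 * H 0"] graded_eval_prod m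
    unfolding graded_eval_mult graded_eval_numeral H n prod_monom mult_monom by (simp add: mult.commute)
qed

text \<open>The factors 2x + y and x + 2y are the classes of a_(3,3j+1) and a_(3,3j+2) and will
  cancel against the denominator; the remaining cubic is the edge factor of the chain.\<close>

lemma e6_middle_edge: "2 * e6_middle x y = (2 * x + y) * (x + 2 * y) * edge_poly x y"
  by (simp add: e6_middle_def edge_poly_def algebra_simps)

text \<open>The constants combine to 6 * 3^d / 3^(d+1) = 2: a 3 from each of the d steps and the 6
  in front, against the 3^(d+1) in the product of the coordinate classes.\<close>

lemma e6_integrand:
  assumes h: "h \<in> torus_set" and d: "d \<ge> 1"
  shows "h 0 * (6 * h 0 * (\<Prod>i = 1..d. 6 * h i * e6_middle (h (i - 1)) (h i))) * form_weight d h = 2 * chain_kernel d h"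
proof -
  define A where "A = (\<Prod>i\<le>d. h i)"
  define E where "E = (\<Prod>i = 1..d. edge_poly (h (i - 1)) (h i))"
  define M where "M = (\<Prod>i = 0..<d. (2 * h i + h (i + 1)) * (h i + 2 * h (i + 1)))"
  define U where "U = (\<Prod>k = 1..<d. 2 * h k - h (k - 1) - h (k + 1))"
  have U: "(\<Prod>k = 1..<d. - h (k - 1) + 2 * h k - h (k + 1)) = U"
    unfolding U_def by (intro prod.cong) simp_all
  have A3: "(\<Prod>i = 0..d. h i ^ 3) = A ^ 3" "(\<Prod>i\<le>d. h i ^ 3) = A ^ 3"
    by (simp_all add: A_def prod_power_distrib atMost_atLeast0)
  have form: "(\<Prod>c\<in>coords d. coord_form c h) = 3 ^ (d + 1) * A ^ 3 * M * U * A"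
    using prod.subset_diff[OF base_coords_subset finite_coords, of "\<lambda>c. coord_form c h" d]
    unfolding prod_coord_form prod_H_base vol_form_def U A3 M_def[symmetric] A_def[symmetric] .
  have "(\<Prod>c\<in>coords d. coord_form c h) \<noteq> 0"
    using torus_low_nonzero[OF torus_low_coord_form h] by (simp add: finite_coords)
  then have nz: "A \<noteq> 0" "M \<noteq> 0" "U \<noteq> 0" unfolding form by auto
  have "h 0 * (\<Prod>i = 1..d. 6 * h i * e6_middle (h (i - 1)) (h i)) = 3 ^ d * A * M * E"
  proof -
    have "(\<Prod>i = 1..d. 6 * h i * e6_middle (h (i - 1)) (h i)) =
        (\<Prod>i = 1..d. 3 * h i * ((2 * h (i - 1) + h i) * (h (i - 1) + 2 * h i)) * edge_poly (h (i - 1)) (h i))"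
    proof (intro prod.cong refl)
      fix i
      have "6 * h i * e6_middle (h (i - 1)) (h i) = 3 * h i * (2 * e6_middle (h (i - 1)) (h i))" by simp
      then show "6 * h i * e6_middle (h (i - 1)) (h i) = 3 * h i * ((2 * h (i - 1) + h i) * (h (i - 1) + 2 * h i)) * edge_poly (h (i - 1)) (h i)"
        unfolding e6_middle_edge by (simp only: mult.assoc)
    qed
    also have "\<dots> = 3 ^ d * (\<Prod>i = 1..d. h i) * (\<Prod>i = 1..d. (2 * h (i - 1) + h i) * (h (i - 1) + 2 * h i)) * E"
      by (simp add: prod.distrib E_def)
    also have "(\<Prod>i = 1..d. (2 * h (i - 1) + h i) * (h (i - 1) + 2 * h i)) = M"
      unfolding M_def by (rule prod.reindex_bij_witness[where i = Suc and j = "\<lambda>i. i - 1"]) auto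
    finally have 1: "(\<Prod>i = 1..d. 6 * h i * e6_middle (h (i - 1)) (h i)) = 3 ^ d * (\<Prod>i = 1..d. h i) * M * E" .
    have "A = h 0 * (\<Prod>i = 1..d. h i)"
      by (simp add: A_def atMost_atLeast0 prod.atLeast_Suc_atMost)
    then show ?thesis unfolding 1 by (simp only: mult_ac)
  qed
  then have "h 0 * (6 * h 0 * (\<Prod>i = 1..d. 6 * h i * e6_middle (h (i - 1)) (h i))) = 6 * h 0 * (3 ^ d * A * M * E)"
  proof -
    assume X: "h 0 * (\<Prod>i = 1..d. 6 * h i * e6_middle (h (i - 1)) (h i)) = 3 ^ d * A * M * E"
    show ?thesis unfolding X[symmetric] by (simp only: mult_ac)
  qed
  then show ?thesis
    unfolding form_weight_def form chain_kernel_def A3 U_def[symmetric] A_def[symmetric] E_def[symmetric]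
    using nz by (simp add: field_simps)
qed

theorem w_corr_eq_chain_mean:
  assumes "d \<ge> 1"
  shows "w_corr d 1 0 = 2 * chain_mean d"
proof -
  have c: "H 0 * e6_quotient d \<in> coord_polys d"
    using assms by (intro divisor_carrier e6_quotient_carrier) simp_all
  have "w_corr d 1 0 = residue_functional d (H 0 * e6_quotient d)"
    using chow_integral_class[OF assms c] by (simp add: w_corr_def)
  also have "\<dots> = torus_mean {..d} (\<lambda>h. 2 * chain_kernel d h)"
    unfolding residue_functional_def form_coeff_def graded_eval_e6_quotient[OF assms]
    by (rule torus_mean_cong) (simp only: coeff_monom refl if_True e6_integrand[OF _ assms])
  also have "\<dots> = 2 * chain_mean d" by (simp add: torus_mean_cmult chain_mean_def)
  finally show ?thesis .
qed

theorem theorem1p3: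
  fixes d :: nat
  assumes "d \<ge> 1"
  shows "w_coeff d = 1 / 2 * w_corr d 1 0"
  using w_corr_eq_chain_mean[OF assms] chain_mean_eq_w_coeff[OF assms] by simp

end
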